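(* Let $1\le r\in\mathbf N$, $2^{r-1}\le n\le 2^r-1$, and let $f:\mathbf R^n\to\mathcal A_r$ be an original with growth exponents satisfying $a_1<a_{-1}$. Let $u(p,t;\zeta)$ be either the Cartesian kernel (C) or the spherical kernel (S). Then the image $\mathcal F^n(f,u;p;\zeta)=\int_{\mathbf R^n}f(t)\exp(-u(p,t;\zeta))\,dt$ is $\mathcal A_r$-holomorphic (that is, locally analytic) in $p$ in the domain $\{p\in\mathcal A_r: a_1<\mathrm{Re}(p)<a_{-1}\}$, and is also $\mathcal A_r$-holomorphic in $\zeta\in\mathcal A_r$.
   Context: Cayley–Dickson algebras: $\mathcal A_0=\mathbf R$ and $\mathcal A_{r+1}=\mathcal A_r\oplus\mathcal A_r\mathbf l$ with $(\xi+\eta\mathbf l)(\gamma+\delta\mathbf l)=(\xi\gamma-\delta^*\eta)+(\delta\xi+\eta\gamma^* )\mathbf l$, $(\xi+\eta\mathbf l)^*=\xi^*-\eta\mathbf l$ (so $\mathcal A_1=\mathbf C$, $\mathcal A_2=\mathbf H$, $\mathcal A_3$ is the octonion algebra). The standard basis of $\mathcal A_r$ is $i_0=1,i_1,\dots,i_{2^r-1}$, with $i_j^2=-1$ and $i_ji_k=-i_ki_j$ for $j\ne k$, $j,k\ge1$. $\mathrm{Re}(z)=(z+z^* )/2$, $|z|^2=zz^*$, $\exp(z)=\sum_k z^k/k!$. Write $p=\sum_j p_ji_j$, $\zeta=\sum_j\zeta_ji_j$ with $p_j,\zeta_j\in\mathbf R$. When $n<2^r-1$ one puts $p_m=\zeta_m=t_m=0$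 for $m>n$. Originals: $f:\mathbf R^n\to\mathcal A_r$ is an original if (1) $f$ is continuous almost everywhere for the Lebesgue measure; (2) each partial function $t_j\mapsto f(t_1,\dots,t_n)$ (other variables fixed) has on each finite interval only finitely many discontinuities, all of the first kind (finite one-sided limits exist); (3) each partial function $g_j(t_j)=f(t)$ satisfies, except possibly at its discontinuities of the first kind, a Hölder condition $|g_j(t_j+h)-g_j(t_j)|\le A_j|h|^{\alpha_j}$ for $|h|<\delta_j$, with constants $0<\alpha_j\le1$, $A_j>0$, $\delta_j>0$ (for the given $t$); (4) there are $a_1=a_1(f),a_{-1}=a_{-1}(f)\in\mathbf R$ and constants $C_v>0$ such that for each $v\in\{-1,1\}^n$, $|f(t)|<C_v\exp(\sum_{j=1}^n a_{v_j}t_j)$ for all $t\in U_v:=\{t\in\mathbf R^n: v_jt_j\ge0\ \forall j\}$. Kernels: (C) Cartesian: $u(p,t;\zeta)=p_0(t_1+\dots+t_n)+\sum_{j=1}^n p_jt_ji_j+\zeta$. (S) Spherical: with $s_j=s_j(n;t)=t_j+\dots+t_n$, $u(p,t;\zeta)=p_0s_1+M(p,t;\zeta)+\zeta_0$, where, with $N=2^r-1$ and $\phi_j=p_js_j+\zeta_j$, $M=\phi_1[\,i_1\cos\phi_2+i_2\sin\phi_2\cos\phi_3+\dots+i_{N-1}\sin\phi_2\cdots\sin\phi_{N-1}\cos\phi_N+i_N\sin\phi_2\cdots\sin\phi_{N-1}\sin\phi_N]$. $\mathcal A_r$-holomorphic (locally analytic): near every point of the domain the function is the sum of a convergent series of noncommutative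 (nonassociative) monomials in the variable with coefficients in $\mathcal A_r$. For $r\ge2$ each real component $h_j$ of $h\in\mathcal A_r$ is regarded as a function of $h$ through $h_j=\frac12\big(-hi_j+i_j(2^r-2)^{-1}\{-h+\sum_{k=1}^{2^r-1}i_k(hi_k^* )\}\big)$ for $j\ge1$ and $h_0=\frac12\big(h+(2^r-2)^{-1}\{-h+\sum_{k=1}^{2^r-1}i_k(hi_k^* )\}\big)$. *)

theory Defs
  imports "HOL-Analysis.Analysis"
begin

section \<open>Cayley--Dickson doubling on coordinate sequences\<close>

text \<open>
  An element of the algebra \<open>A_r\<close> is a real sequence vanishing from index \<open>2^r\<close> on.  In
  \<open>A_(r+1) = A_r + A_r l\<close> the element \<open>\<xi> + \<eta> l\<close> has \<open>\<xi>\<close> in the positions below \<open>2^r\<close> and \<open>\<eta>\<close> in the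
  next \<open>2^r\<close> positions, so the standard basis satisfies \<open>i_(2^r + k) = i_k l\<close> for \<open>k < 2^r\<close>.
\<close>

definition cd_lo :: "nat \<Rightarrow> (nat \<Rightarrow> real) \<Rightarrow> nat \<Rightarrow> real"
  where "cd_lo r x = (\<lambda>k. if k < 2 ^ r then x k else 0)"

definition cd_hi :: "nat \<Rightarrow> (nat \<Rightarrow> real) \<Rightarrow> nat \<Rightarrow> real"
  where "cd_hi r x = (\<lambda>k. if k < 2 ^ r then x (2 ^ r + k) else 0)"

definition cd_join :: "nat \<Rightarrow> (nat \<Rightarrow> real) \<Rightarrow> (nat \<Rightarrow> real) \<Rightarrow> nat \<Rightarrow> real"
  where "cd_join r \<xi> \<eta> = (\<lambda>k. if k < 2 ^ r then \<xi> k else \<eta> (k - 2 ^ r))"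

primrec cd_conj :: "nat \<Rightarrow> (nat \<Rightarrow> real) \<Rightarrow> nat \<Rightarrow> real" where
  "cd_conj 0 x = x"
| "cd_conj (Suc r) x = cd_join r (cd_conj r (cd_lo r x)) (\<lambda>k. - cd_hi r x k)"

primrec cd_mult :: "nat \<Rightarrow> (nat \<Rightarrow> real) \<Rightarrow> (nat \<Rightarrow> real) \<Rightarrow> nat \<Rightarrow> real" where
  "cd_mult 0 x y = (\<lambda>k. x k * y k)"
| "cd_mult (Suc r) x y =
    (let \<xi> = cd_lo r x; \<eta> = cd_hi r x; \<gamma> = cd_lo r y; \<delta> = cd_hi r y
     in cd_join r (\<lambda>k. cd_mult r \<xi> \<gamma> k - cd_mult r (cd_conj r \<delta>) \<eta> k)
                  (\<lambda>k. cd_mult r \<delta> \<xi> k + cd_mult r \<eta> (cd_conj r \<gamma>) k))"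

definition cd_supp :: "nat \<Rightarrow> (nat \<Rightarrow> real) \<Rightarrow> bool"
  where "cd_supp r x \<longleftrightarrow> (\<forall>k\<ge>2 ^ r. x k = 0)"

lemma cd_supp_lo [simp]: "cd_supp r (cd_lo r x)"
  and cd_supp_hi [simp]: "cd_supp r (cd_hi r x)"
  by (auto simp: cd_supp_def cd_lo_def cd_hi_def)

lemma cd_supp_join:
  assumes "cd_supp r x" "cd_supp r y"
  shows "cd_supp (Suc r) (cd_join r x y)"
  using assms by (auto simp: cd_supp_def cd_join_def)

lemma cd_supp_conj: "cd_supp r x \<Longrightarrow> cd_supp r (cd_conj r x)"
proof (induction r arbitrary: x)
  case (Suc r)
  have "cd_supp r (\<lambda>k. - cd_hi r x k)"
    using cd_supp_hi[of r x] by (auto simp: cd_supp_def)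
  with Suc.IH[of "cd_lo r x"] show ?case by (auto intro!: cd_supp_join)
qed simp

lemma cd_supp_mult: "cd_supp r x \<Longrightarrow> cd_supp r y \<Longrightarrow> cd_supp r (cd_mult r x y)"
proof (induction r arbitrary: x y)
  case 0
  then show ?case by (simp add: cd_supp_def)
next
  case (Suc r)
  have d: "cd_supp r (\<lambda>k. a k - b k)" if "cd_supp r a" "cd_supp r b" for a b
    using that by (auto simp: cd_supp_def)
  have s: "cd_supp r (\<lambda>k. a k + b k)" if "cd_supp r a" "cd_supp r b" for a b
    using that by (auto simp: cd_supp_def)
  show ?case
    unfolding cd_mult.simps Let_def
    by (intro cd_supp_join d s Suc.IH cd_supp_conj cd_supp_lo cd_supp_hi)
qed


section \<open>The algebra as a Euclidean space\<close>

text \<open>The type \<open>'r cd\<close> is \<open>A_r\<close> with \<open>r = CARD('r)\<close>.\<close>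

typedef ('r::finite) cd = "{x :: nat \<Rightarrow> real. cd_supp CARD('r) x}"
  morphisms cd_coord Abs_cd
  by (rule exI[of _ "\<lambda>_. 0"]) (simp add: cd_supp_def)

setup_lifting type_definition_cd

lemma cd_coord_eq_0: "2 ^ CARD('r) \<le> k \<Longrightarrow> cd_coord (z :: 'r::finite cd) k = 0"
  using cd_coord[of z] by (simp add: cd_supp_def)

lemma cd_eqI: "(\<And>k. k < 2 ^ CARD('r) \<Longrightarrow> cd_coord z k = cd_coord w k) \<Longrightarrow> z = w"
  for z w :: "'r::finite cd"
  by (metis cd_coord_eq_0 cd_coord_inject ext linorder_not_le)

instantiation cd :: (finite) real_vector
begin

lift_definition zero_cd :: "'a cd" is "\<lambda>_. 0" by (simp add: cd_supp_def)
lift_definition plus_cd :: "'a cd \<Rightarrow> 'a cd \<Rightarrow> 'a cd" is "\<lambda>x y k. x k + y k"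
  by (simp add: cd_supp_def)
lift_definition minus_cd :: "'a cd \<Rightarrow> 'a cd \<Rightarrow> 'a cd" is "\<lambda>x y k. x k - y k"
  by (simp add: cd_supp_def)
lift_definition uminus_cd :: "'a cd \<Rightarrow> 'a cd" is "\<lambda>x k. - x k"
  by (simp add: cd_supp_def)
lift_definition scaleR_cd :: "real \<Rightarrow> 'a cd \<Rightarrow> 'a cd" is "\<lambda>c x k. c * x k"
  by (simp add: cd_supp_def)

instance
  by (standard; transfer; simp add: algebra_simps)

end

lemma cd_coord_simps [simp]:
  "cd_coord 0 k = 0" "cd_coord (z + w) k = cd_coord z k + cd_coord w k"
  "cd_coord (z - w) k = cd_coord z k - cd_coord w k" "cd_coord (- z) k = - cd_coord z k"
  "cd_coord (c *\<^sub>R z) k = c * cd_coord z k"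
  by (transfer; simp)+

lemma cd_coord_sum [simp]: "cd_coord (\<Sum>x\<in>A. f x) k = (\<Sum>x\<in>A. cd_coord (f x) k)"
  by (induction A rule: infinite_finite_induct) auto

lift_definition cd_i :: "nat \<Rightarrow> 'r::finite cd"
  is "\<lambda>j k. if k = j \<and> j < 2 ^ CARD('r) then 1 else 0"
  by (auto simp: cd_supp_def)

lemma cd_coord_i:
  "cd_coord (cd_i j :: 'r::finite cd) k = (if k = j \<and> j < 2 ^ CARD('r) then 1 else 0)"
  by transfer simp

instantiation cd :: (finite) real_inner
begin

definition inner_cd :: "'a cd \<Rightarrow> 'a cd \<Rightarrow> real"
  where "inner_cd z w = (\<Sum>k<2 ^ CARD('a). cd_coord z k * cd_coord w k)"
definition norm_cd :: "'a cd \<Rightarrow> real" where "norm_cd z = sqrt (inner z z)"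
definition sgn_cd :: "'a cd \<Rightarrow> 'a cd" where "sgn_cd z = z /\<^sub>R norm z"
definition dist_cd :: "'a cd \<Rightarrow> 'a cd \<Rightarrow> real" where "dist_cd z w = norm (z - w)"
definition uniformity_cd :: "('a cd \<times> 'a cd) filter"
  where "uniformity_cd = (INF e\<in>{0<..}. principal {(z, w). dist z w < e})"
definition open_cd :: "'a cd set \<Rightarrow> bool"
  where "open_cd U \<longleftrightarrow> (\<forall>z\<in>U. eventually (\<lambda>(z', w). z' = z \<longrightarrow> w \<in> U) uniformity)"

instance
proof
  fix x y z :: "'a cd" and c :: real and U :: "'a cd set"
  show "dist x y = norm (x - y)" by (rule dist_cd_def)
  show "sgn x = x /\<^sub>R norm x" by (rule sgn_cd_def)
  show "(uniformity :: ('a cd \<times> 'a cd) filter) =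
      (INF e\<in>{0<..}. principal {(x, y). dist x y < e})"
    by (rule uniformity_cd_def)
  show "open U \<longleftrightarrow> (\<forall>x\<in>U. eventually (\<lambda>(x', y). x' = x \<longrightarrow> y \<in> U) uniformity)"
    by (rule open_cd_def)
  show "inner x y = inner y x" by (simp add: inner_cd_def mult.commute)
  show "inner (x + y) z = inner x z + inner y z"
    by (simp add: inner_cd_def sum.distrib algebra_simps)
  show "inner (c *\<^sub>R x) y = c * inner x y"
    by (simp add: inner_cd_def sum_distrib_left algebra_simps)
  show "0 \<le> inner x x" by (simp add: inner_cd_def sum_nonneg)
  show "inner x x = 0 \<longleftrightarrow> x = 0"
    by (auto simp: inner_cd_def sum_nonneg_eq_0_iff intro!: cd_eqI)
  show "norm x = sqrt (inner x x)" by (rule norm_cd_def)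
qed

end

lemma inner_cd_i: "j < 2 ^ CARD('r) \<Longrightarrow> inner z (cd_i j) = cd_coord (z :: 'r::finite cd) j"
proof -
  assume j: "j < 2 ^ CARD('r)"
  have "inner z (cd_i j) = (\<Sum>k<2 ^ CARD('r). if k = j then cd_coord z k else 0)"
    unfolding inner_cd_def by (rule sum.cong) (simp_all add: cd_coord_i j)
  then show ?thesis using j by simp
qed

lemma cd_i_inject:
  assumes "j < 2 ^ CARD('r)"
  shows "(cd_i j :: 'r::finite cd) = cd_i k \<longleftrightarrow> j = k"
proof
  assume "(cd_i j :: 'r cd) = cd_i k"
  then have "cd_coord (cd_i j :: 'r cd) j = cd_coord (cd_i k :: 'r cd) j" by (rule arg_cong)
  then show "j = k" using assms by (simp add: cd_coord_i split: if_splits)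
qed simp

instantiation cd :: (finite) euclidean_space
begin

definition Basis_cd :: "'a cd set" where "Basis_cd = cd_i ` {..<2 ^ CARD('a)}"

instance
proof
  fix u v x :: "'a cd"
  have "cd_i 0 \<in> (Basis :: 'a cd set)" by (simp add: Basis_cd_def)
  then show "(Basis :: 'a cd set) \<noteq> {}" by blast
  show "finite (Basis :: 'a cd set)" by (simp add: Basis_cd_def)
  show "inner u v = (if u = v then 1 else 0)" if uv: "u \<in> Basis" "v \<in> Basis"
  proof -
    obtain j k where "u = cd_i j" "v = cd_i k" "j < 2 ^ CARD('a)" "k < 2 ^ CARD('a)"
      using uv by (auto simp: Basis_cd_def)
    then show ?thesis by (simp add: inner_cd_i cd_coord_i cd_i_inject)
  qed
  show "(\<forall>u\<in>Basis. inner x u = 0) \<longleftrightarrow> x = 0"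
    by (auto simp: Basis_cd_def inner_cd_i intro!: cd_eqI)
qed

end

instantiation cd :: (finite) "{one, times}"
begin

definition one_cd :: "'a cd" where "one_cd = cd_i 0"
lift_definition times_cd :: "'a cd \<Rightarrow> 'a cd \<Rightarrow> 'a cd" is "cd_mult CARD('a)"
  by (simp add: cd_supp_mult)

instance ..

end

text \<open>
  This makes \<open>z ^ k\<close> available, with \<open>z ^ Suc k = z * z ^ k\<close>; the bracketing is immaterial since the
  algebras are power-associative.
\<close>

instance cd :: (finite) power ..

lift_definition cd_cnj :: "'r::finite cd \<Rightarrow> 'r cd" is "cd_conj CARD('r)"
  by (simp add: cd_supp_conj)

definition cd_Re :: "'r::finite cd \<Rightarrow> real" where "cd_Re z = cd_coord z 0"

definition cd_exp :: "'r::finite cd \<Rightarrow> 'r cd" where "cd_exp z = (\<Sum>k. z ^ k /\<^sub>R fact k)"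

subsection \<open>Consistency with the algebraic descriptions of real part and norm\<close>

lemma cd_conj_eq:
  "cd_supp r x \<Longrightarrow> cd_conj r x = (\<lambda>k. if k = 0 then x k else - x k)"
proof (induction r arbitrary: x)
  case 0
  then show ?case by (auto simp: cd_supp_def fun_eq_iff)
next
  case (Suc r)
  have zero: "x k = 0" if "\<not> k - 2 ^ r < 2 ^ r" for k
    using Suc.prems that by (simp add: cd_supp_def)
  have "cd_conj (Suc r) x k = (if k = 0 then x k else - x k)" for k
    using zero[of k] unfolding cd_conj.simps Suc.IH[OF cd_supp_lo]
    by (cases "k < 2 ^ r"; cases "k - 2 ^ r < 2 ^ r")
       (auto simp: cd_join_def cd_lo_def cd_hi_def)
  then show ?case by (rule ext)
qed

lemma cd_coord_cnj: "cd_coord (cd_cnj z) k = (if k = 0 then cd_coord z k else - cd_coord z k)"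
  for z :: "'r::finite cd"
  using cd_coord[of z] by (simp add: cd_cnj.rep_eq cd_conj_eq)

lemma cd_Re_eq: "cd_Re z *\<^sub>R 1 = (1 / 2) *\<^sub>R (z + cd_cnj z)"
  unfolding one_cd_def by (rule cd_eqI) (auto simp: cd_Re_def cd_coord_i cd_coord_cnj)

lemma cd_mult_uminus:
  "cd_mult r (\<lambda>k. - x k) y = (\<lambda>k. - cd_mult r x y k)"
  "cd_mult r x (\<lambda>k. - y k) = (\<lambda>k. - cd_mult r x y k)"
proof (induction r arbitrary: x y)
  case (Suc r)
  have lo: "cd_lo r (\<lambda>k. - f k) = (\<lambda>k. - cd_lo r f k)"
    and hi: "cd_hi r (\<lambda>k. - f k) = (\<lambda>k. - cd_hi r f k)" for f
    by (auto simp: cd_lo_def cd_hi_def fun_eq_iff)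
  have co: "cd_conj r (\<lambda>k. - f k) = (\<lambda>k. - cd_conj r f k)" if "cd_supp r f" for f
    using that by (auto simp: cd_conj_eq cd_supp_def fun_eq_iff)
  { case 1
    show ?case by (auto simp: Let_def lo hi Suc.IH cd_join_def fun_eq_iff)
  next
    case 2
    show ?case by (auto simp: Let_def lo hi co Suc.IH cd_join_def fun_eq_iff) }
qed auto

lemma cd_mult_add:
  "cd_supp r x \<Longrightarrow> cd_supp r x' \<Longrightarrow> cd_supp r y \<Longrightarrow>
    cd_mult r (\<lambda>k. x k + x' k) y = (\<lambda>k. cd_mult r x y k + cd_mult r x' y k)"
  "cd_supp r x \<Longrightarrow> cd_supp r y \<Longrightarrow> cd_supp r y' \<Longrightarrow>
    cd_mult r x (\<lambda>k. y k + y' k) = (\<lambda>k. cd_mult r x y k + cd_mult r x y' k)"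
proof (induction r arbitrary: x x' y y')
  case (Suc r)
  have lo: "cd_lo r (\<lambda>k. f k + g k) = (\<lambda>k. cd_lo r f k + cd_lo r g k)"
    and hi: "cd_hi r (\<lambda>k. f k + g k) = (\<lambda>k. cd_hi r f k + cd_hi r g k)" for f g
    by (auto simp: cd_lo_def cd_hi_def fun_eq_iff)
  have co: "cd_conj r (\<lambda>k. f k + g k) = (\<lambda>k. cd_conj r f k + cd_conj r g k)"
    if "cd_supp r f" "cd_supp r g" for f g
  proof -
    have "cd_supp r (\<lambda>k. f k + g k)" using that by (auto simp: cd_supp_def)
    with that show ?thesis by (auto simp: cd_conj_eq fun_eq_iff)
  qed
  { case 1
    show ?case
      by (simp only: cd_mult.simps Let_def lo hi Suc.IH cd_supp_conj cd_supp_lo cd_supp_hi)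
         (auto simp: cd_join_def)
  next
    case 2
    show ?case
      by (simp only: cd_mult.simps Let_def lo hi co Suc.IH cd_supp_conj cd_supp_lo cd_supp_hi)
         (auto simp: cd_join_def) }
qed (auto simp: algebra_simps)

lemma cd_conj_conj: "cd_supp r x \<Longrightarrow> cd_conj r (cd_conj r x) = x"
  using cd_conj_eq[OF cd_supp_conj, of r x] by (simp add: cd_conj_eq[of r x] fun_eq_iff)

lemma sum_lo_hi: "(\<Sum>k<2 ^ Suc r. (x k)\<^sup>2) = (\<Sum>k<2 ^ r. (cd_lo r x k)\<^sup>2) + (\<Sum>k<2 ^ r. (cd_hi r x k)\<^sup>2)"
  for x :: "nat \<Rightarrow> real"
  using sum.atLeastLessThan_concat[of 0 "2 ^ r" "2 ^ r + 2 ^ r" "\<lambda>k. (x k)\<^sup>2"]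
    sum.shift_bounds_nat_ivl[of "\<lambda>k. (x k)\<^sup>2" 0 "2 ^ r" "2 ^ r"]
  by (simp add: cd_lo_def cd_hi_def atLeast0LessThan add.commute mult_2)

lemma cd_mult_conj:
  assumes "cd_supp r x"
  shows "cd_mult r x (cd_conj r x) = (\<lambda>k. if k = 0 then \<Sum>j<2 ^ r. (x j)\<^sup>2 else 0)"
    and "cd_mult r (cd_conj r x) x = (\<lambda>k. if k = 0 then \<Sum>j<2 ^ r. (x j)\<^sup>2 else 0)"
  using assms
proof (induction r arbitrary: x)
  case 0
  { case 1 then show ?case by (auto simp: cd_supp_def fun_eq_iff power2_eq_square)
  next
    case 2 then show ?case by (auto simp: cd_supp_def fun_eq_iff power2_eq_square) }
next
  case (Suc r)
  have lo: "cd_lo r (cd_conj (Suc r) x) = cd_conj r (cd_lo r x)" for x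
    using cd_supp_conj[OF cd_supp_lo, of r x]
    by (auto simp: cd_lo_def cd_join_def cd_supp_def fun_eq_iff)
  have hi: "cd_hi r (cd_conj (Suc r) x) = (\<lambda>k. - cd_hi r x k)" for x
    by (auto simp: cd_hi_def cd_join_def fun_eq_iff)
  have co: "cd_conj r (\<lambda>k. - cd_hi r x k) = (\<lambda>k. - cd_conj r (cd_hi r x) k)" for x
    using cd_supp_hi[of r x] by (auto simp: cd_conj_eq cd_supp_def fun_eq_iff)
  { case 1
    show ?case
      by (simp only: cd_mult.simps Let_def lo hi co cd_mult_uminus cd_conj_conj[OF cd_supp_lo]
            Suc.IH[OF cd_supp_lo] Suc.IH[OF cd_supp_hi] sum_lo_hi[of _ r])
         (auto simp: cd_join_def fun_eq_iff)
  next
    case 2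
    show ?case
      by (simp only: cd_mult.simps Let_def lo hi co cd_mult_uminus cd_conj_conj[OF cd_supp_lo]
            Suc.IH[OF cd_supp_lo] Suc.IH[OF cd_supp_hi] sum_lo_hi[of _ r])
         (auto simp: cd_join_def fun_eq_iff) }
qed

lemma cd_norm_eq: "z * cd_cnj z = (norm z)\<^sup>2 *\<^sub>R 1" "cd_cnj z * z = (norm z)\<^sup>2 *\<^sub>R 1"
  for z :: "'r::finite cd"
  using cd_mult_conj[of "CARD('r)" "cd_coord z"] cd_coord[of z]
  by (auto intro!: cd_eqI simp: times_cd.rep_eq cd_cnj.rep_eq one_cd_def cd_coord_i norm_cd_def
      inner_cd_def power2_eq_square sum_nonneg)

lemma cd_distrib: "(z + z') * w = z * w + z' * w" "z * (w + w') = z * w + z * w'"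
  and cd_minus: "(- z) * w = - (z * w)" "z * (- w) = - (z * w)"
  for z z' w w' :: "'r::finite cd"
  using cd_coord[of z] cd_coord[of z'] cd_coord[of w] cd_coord[of w']
  by (auto intro!: cd_eqI simp: times_cd.rep_eq plus_cd.rep_eq uminus_cd.rep_eq cd_mult_add
      cd_mult_uminus)

lemma cd_i_squared:
  assumes "1 \<le> j" "j < 2 ^ CARD('r)"
  shows "cd_i j * cd_i j = (- 1 :: 'r::finite cd)"
proof -
  have "cd_cnj (cd_i j) = (- cd_i j :: 'r cd)"
    using assms by (auto intro!: cd_eqI simp: cd_coord_cnj cd_coord_i)
  moreover have "(norm (cd_i j :: 'r cd))\<^sup>2 = 1"
    using assms by (simp add: power2_norm_eq_inner inner_cd_i cd_coord_i)
  ultimately show ?thesis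
    using cd_norm_eq(1)[of "cd_i j :: 'r cd"] by (simp add: cd_minus) (metis minus_minus)
qed

lemma cd_i_anticommute:
  assumes "1 \<le> j" "1 \<le> k" "j \<noteq> k" "j < 2 ^ CARD('r)" "k < 2 ^ CARD('r)"
  shows "cd_i j * cd_i k = - (cd_i k * cd_i j :: 'r::finite cd)"
proof -
  let ?z = "cd_i j + cd_i k :: 'r cd"
  have "cd_cnj ?z = - ?z"
    using assms by (auto intro!: cd_eqI simp: cd_coord_cnj cd_coord_i)
  moreover have "(norm ?z)\<^sup>2 = 2"
    using assms by (simp add: power2_norm_eq_inner inner_add_right inner_cd_i cd_coord_i)
  ultimately have "- (?z * ?z) = 2 *\<^sub>R 1"
    using cd_norm_eq(1)[of ?z] by (simp only: cd_minus)
  moreover have "?z * ?z = (cd_i j * cd_i k + cd_i k * cd_i j) - 2 *\<^sub>R 1"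
    using assms by (simp add: cd_distrib cd_i_squared scaleR_2)
  ultimately show ?thesis by (simp add: algebra_simps eq_neg_iff_add_eq_0)
qed

section \<open>Holomorphic functions\<close>

datatype 'a na_monomial = Var | Coeff 'a | Times "'a na_monomial" "'a na_monomial"

primrec na_eval :: "'a::times na_monomial \<Rightarrow> 'a \<Rightarrow> 'a" where
  "na_eval Var h = h"
| "na_eval (Coeff c) h = c"
| "na_eval (Times m m') h = na_eval m h * na_eval m' h"

text \<open>
  Convergence of a series of monomials is normal convergence on a ball, that is, absolute and
  uniform with a summable majorant.  Convergence in a weaker sense, dependent on the order of the
  terms, would admit nonanalytic functions: for \<open>r \<ge> 2\<close> all real coordinates of \<open>h\<close> are sums of
  monomials in \<open>h\<close>, so that by the Weierstrass approximation theorem every continuous function is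
  locally the limit of a uniformly convergent series of sums of monomials.
\<close>

definition cd_holomorphic_on :: "('r::finite cd \<Rightarrow> 'r cd) \<Rightarrow> 'r cd set \<Rightarrow> bool"
  (infix "cd'_holomorphic'_on" 50)
  where "F cd_holomorphic_on U \<longleftrightarrow>
    (\<forall>z0\<in>U. \<exists>\<rho>>0. ball z0 \<rho> \<subseteq> U \<and>
      (\<exists>(m :: nat \<Rightarrow> 'r cd na_monomial) (B :: nat \<Rightarrow> real). summable B \<and>
        (\<forall>z\<in>ball z0 \<rho>. (\<forall>k. norm (na_eval (m k) (z - z0)) \<le> B k) \<and>
          (\<lambda>k. na_eval (m k) (z - z0)) sums F z)))"


section \<open>Originals\<close>

definition partial_fun :: "(real ^ 'n \<Rightarrow> 'b) \<Rightarrow> real ^ 'n \<Rightarrow> 'n \<Rightarrow> real \<Rightarrow> 'b"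
  where "partial_fun f t j s = f (\<chi> k. if k = j then s else t $ k)"

definition first_kind_discontinuity :: "(real \<Rightarrow> 'b::topological_space) \<Rightarrow> real \<Rightarrow> bool"
  where "first_kind_discontinuity g s \<longleftrightarrow>
    \<not> isCont g s \<and> (\<exists>l. (g \<longlongrightarrow> l) (at_left s)) \<and> (\<exists>l. (g \<longlongrightarrow> l) (at_right s))"

text \<open>The exponents \<open>a_1\<close> and \<open>a_(-1)\<close> are given as a function on the signs \<open>1\<close> and \<open>-1\<close>.\<close>

definition growth_exponents :: "(real ^ 'n \<Rightarrow> 'r::finite cd) \<Rightarrow> (int \<Rightarrow> real) \<Rightarrow> bool"
  where "growth_exponents f a \<longleftrightarrow>
    (\<forall>v :: 'n \<Rightarrow> int. range v \<subseteq> {-1, 1} \<longrightarrow>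
      (\<exists>C>0. \<forall>t. (\<forall>j. of_int (v j) * t $ j \<ge> 0) \<longrightarrow>
        norm (f t) < C * exp (\<Sum>j\<in>UNIV. a (v j) * t $ j)))"

definition is_original :: "(real ^ 'n \<Rightarrow> 'r::finite cd) \<Rightarrow> bool"
  where "is_original f \<longleftrightarrow>
    (AE t in lebesgue. isCont f t) \<and>
    (\<forall>t j a b. finite {s \<in> {a..b}. \<not> isCont (partial_fun f t j) s}) \<and>
    (\<forall>t j s. \<not> isCont (partial_fun f t j) s \<longrightarrow>
      first_kind_discontinuity (partial_fun f t j) s) \<and>
    (\<forall>t j. \<not> first_kind_discontinuity (partial_fun f t j) (t $ j) \<longrightarrow>
      (\<exists>A \<alpha> \<delta>. 0 < A \<and> 0 < \<alpha> \<and> \<alpha> \<le> 1 \<and> 0 < \<delta> \<and>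
        (\<forall>h. \<bar>h\<bar> < \<delta> \<longrightarrow>
          norm (partial_fun f t j (t $ j + h) - partial_fun f t j (t $ j)) \<le> A * \<bar>h\<bar> powr \<alpha>))) \<and>
    (\<exists>a. growth_exponents f a)"


section \<open>Kernels and image\<close>

text \<open>
  Throughout, \<open>e\<close> enumerates the index type by \<open>1, \<dots>, n\<close>, so that \<open>t_j\<close> is \<open>t $ e j\<close>.
\<close>

definition cartesian_kernel ::
    "nat \<Rightarrow> (nat \<Rightarrow> 'n) \<Rightarrow> 'r::finite cd \<Rightarrow> real ^ 'n \<Rightarrow> 'r cd \<Rightarrow> 'r cd"
  where "cartesian_kernel n e p t \<zeta> =
    (cd_coord p 0 * (\<Sum>j=1..n. t $ e j)) *\<^sub>R 1 + (\<Sum>j=1..n. (cd_coord p j * t $ e j) *\<^sub>R cd_i j) + \<zeta>"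

text \<open>
  The coefficient of \<open>i_k\<close> in \<open>M\<close> is \<open>\<phi>_1 sin \<phi>_2 \<dots> sin \<phi>_k cos \<phi>_(k+1)\<close> for \<open>k < N\<close>, and the cosine
  is absent for \<open>k = N\<close>; for \<open>r = 1\<close> this leaves \<open>M = \<phi>_1 i_1\<close>.  For \<open>j > n\<close> the sum \<open>s_j\<close> is empty.
\<close>

definition spherical_kernel ::
    "nat \<Rightarrow> (nat \<Rightarrow> 'n) \<Rightarrow> 'r::finite cd \<Rightarrow> real ^ 'n \<Rightarrow> 'r cd \<Rightarrow> 'r cd"
  where "spherical_kernel n e p t \<zeta> =
    (let N = 2 ^ CARD('r) - 1;
         s = (\<lambda>j. \<Sum>m=j..n. t $ e m);
         \<phi> = (\<lambda>j. cd_coord p j * s j + cd_coord \<zeta> j);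
         M = (\<Sum>k=1..N. (\<phi> 1 * (\<Prod>m=2..k. sin (\<phi> m)) * (if k < N then cos (\<phi> (k + 1)) else 1))
                *\<^sub>R cd_i k)
     in (cd_coord p 0 * s 1) *\<^sub>R 1 + M + cd_coord \<zeta> 0 *\<^sub>R 1)"

text \<open>
  If \<open>n < 2^r - 1\<close>, the components of \<open>p\<close> and \<open>\<zeta>\<close> of index above \<open>n\<close> are put to \<open>0\<close> before they enter
  the kernel; if \<open>n = 2^r - 1\<close>, truncation is the identity.
\<close>

definition cd_truncate :: "nat \<Rightarrow> 'r::finite cd \<Rightarrow> 'r cd"
  where "cd_truncate n z = (\<Sum>j\<le>n. cd_coord z j *\<^sub>R cd_i j)"

definition image_integrand ::
    "nat \<Rightarrow> (real ^ 'n \<Rightarrow> 'r::finite cd) \<Rightarrow> ('r cd \<Rightarrow> real ^ 'n \<Rightarrow> 'r cd \<Rightarrow> 'r cd)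
      \<Rightarrow> 'r cd \<Rightarrow> 'r cd \<Rightarrow> real ^ 'n \<Rightarrow> 'r cd"
  where "image_integrand n f u p \<zeta> t = f t * cd_exp (- u (cd_truncate n p) t (cd_truncate n \<zeta>))"

definition laplace_image ::
    "nat \<Rightarrow> (real ^ 'n \<Rightarrow> 'r::finite cd) \<Rightarrow> ('r cd \<Rightarrow> real ^ 'n \<Rightarrow> 'r cd \<Rightarrow> 'r cd)
      \<Rightarrow> 'r cd \<Rightarrow> 'r cd \<Rightarrow> 'r cd"
  where "laplace_image n f u p \<zeta> = (LINT t|lebesgue. image_integrand n f u p \<zeta> t)"

definition growth_strip :: "(int \<Rightarrow> real) \<Rightarrow> 'r::finite cd set"
  where "growth_strip a = {p. a 1 < cd_Re p \<and> cd_Re p < a (-1)}"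

end

theory Submission
  imports Defs "HOL-Complex_Analysis.Cauchy_Integral_Formula"
begin

text \<open>
  At a base point the integrand is expanded, for each \<open>t\<close>, into a normally convergent series of real
  coefficients depending on \<open>t\<close> times monomials in the increment \<open>h\<close>.  If the sums of the absolute
  values of the terms on \<open>\<bar>h\<bar> < \<rho>\<close> are bounded by an integrable function of \<open>t\<close>, integration term
  by term gives the monomial series of the image.  Functions with such expansions are closed under
  products and power series.

  For \<open>r \<ge> 2\<close> the real coordinates of \<open>h\<close> are sums of monomials, so that only a real expansion in
  coordinates is needed, with a bound \<open>exp (- Re u)\<close> up to a factor \<open>exp (L \<rho> \<bar>t\<bar>)\<close>: the oscillating
  part of the exponential must not contribute \<open>exp \<bar>Im u\<bar>\<close>.  For the spherical kernel \<open>M\<close> is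
  \<open>\<phi>_1\<close> times a unit, and the exponential is a polynomial in sines and cosines of the \<open>\<phi>_j\<close>.  For
  the Cartesian kernel it is \<open>cos \<surd>q\<close> and \<open>sin \<surd>q / \<surd>q\<close> with \<open>q = \<Sum> (p_j t_j + \<zeta>_j)\<^sup>2\<close>; these are
  entire in \<open>q\<close> and bounded on parabolic regions around the positive axis, so that Cauchy's
  inequalities bound their Taylor coefficients.  For \<open>r = 1\<close> one uses that the exponential is
  multiplicative.  The growth condition on \<open>f\<close> gives exponential decay of \<open>f(t) exp (- Re u)\<close> with
  some margin, which absorbs \<open>exp (L \<rho> \<bar>t\<bar>)\<close> for small \<open>\<rho>\<close>.
\<close>

section \<open>Multiplication in the Cayley--Dickson algebras\<close>

text \<open>The strip controls only Re p, whereas the imaginary part of the kernel is of size |p|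
  |t| with |p| arbitrary. Hence the base point must never pass through a power series with absolute
  values; only the increment, of size \<rho> |t|, may. For sines and cosines the addition theorems
  separate the two. For the Cartesian kernel, q = V^2 at the base point has an increment with cross
  terms of order V \<rho> |t|, quadratic in |t|. It is harmless because the k-th Taylor coefficient
  at V^2 is of order (\<delta> max(V, \<delta>))^(-k): with \<delta> of order 1 + \<rho> |t| the
  series is dominated by a geometric one, at the price of a factor exp \<delta>. Nonassociativity
  forbids rebracketing, and only real factors move freely through a product. Therefore all
  dependence on t is kept in real coefficients, the monomials depend on h alone and are combined by
  bracketing, and the integral acts on the coefficients only.\<close>

lemma cd_lo_join: "cd_supp r x \<Longrightarrow> cd_lo r (cd_join r x y) = x"
  and cd_hi_join: "cd_supp r y \<Longrightarrow> cd_hi r (cd_join r x y) = y"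
  by (auto simp: cd_lo_def cd_hi_def cd_join_def cd_supp_def fun_eq_iff)

lemma cd_join_lo_hi: "cd_supp (Suc r) x \<Longrightarrow> cd_join r (cd_lo r x) (cd_hi r x) = x"
  by (auto simp: cd_lo_def cd_hi_def cd_join_def cd_supp_def fun_eq_iff)

lemma cd_join_scale: "cd_join r (\<lambda>k. c * x k) (\<lambda>k. c * y k) = (\<lambda>k. c * cd_join r x y k)"
  by (auto simp: cd_join_def fun_eq_iff)

lemma cd_supp_diff: "cd_supp r x \<Longrightarrow> cd_supp r y \<Longrightarrow> cd_supp r (\<lambda>k. x k - y k)"
  and cd_supp_add: "cd_supp r x \<Longrightarrow> cd_supp r y \<Longrightarrow> cd_supp r (\<lambda>k. x k + y k)"
  and cd_supp_uminus: "cd_supp r x \<Longrightarrow> cd_supp r (\<lambda>k. - x k)"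
  and cd_supp_scale: "cd_supp r x \<Longrightarrow> cd_supp r (\<lambda>k. c * x k)"
  by (auto simp: cd_supp_def)

lemma cd_conj_diff:
  assumes "cd_supp r x" "cd_supp r y"
  shows "cd_conj r (\<lambda>k. x k - y k) = (\<lambda>k. cd_conj r x k - cd_conj r y k)"
  using cd_supp_diff[OF assms] assms by (auto simp: cd_conj_eq fun_eq_iff)

lemma cd_conj_uminus: "cd_supp r x \<Longrightarrow> cd_conj r (\<lambda>k. - x k) = (\<lambda>k. - cd_conj r x k)"
  using cd_supp_uminus[of r x] by (auto simp: cd_conj_eq fun_eq_iff)

lemma cd_conj_scale: "cd_supp r x \<Longrightarrow> cd_conj r (\<lambda>k. c * x k) = (\<lambda>k. c * cd_conj r x k)"
  using cd_supp_scale[of r x c] by (auto simp: cd_conj_eq fun_eq_iff)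

lemma cd_mult_scale:
  "cd_supp r x \<Longrightarrow> cd_supp r y \<Longrightarrow> cd_mult r (\<lambda>k. c * x k) y = (\<lambda>k. c * cd_mult r x y k)"
  "cd_supp r x \<Longrightarrow> cd_supp r y \<Longrightarrow> cd_mult r x (\<lambda>k. c * y k) = (\<lambda>k. c * cd_mult r x y k)"
proof (induction r arbitrary: x y)
  case (Suc r)
  have lo: "cd_lo r (\<lambda>k. c * f k) = (\<lambda>k. c * cd_lo r f k)"
    and hi: "cd_hi r (\<lambda>k. c * f k) = (\<lambda>k. c * cd_hi r f k)" for f
    by (auto simp: cd_lo_def cd_hi_def fun_eq_iff)
  { case 1
    show ?case
      by (simp only: cd_mult.simps Let_def lo hi Suc.IH cd_supp_conj cd_supp_lo cd_supp_hi)
         (auto simp: cd_join_def fun_eq_iff algebra_simps)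
  next
    case 2
    show ?case
      by (simp only: cd_mult.simps Let_def lo hi Suc.IH cd_supp_conj cd_supp_lo cd_supp_hi
            cd_conj_scale)
         (auto simp: cd_join_def fun_eq_iff algebra_simps) }
qed (auto simp: fun_eq_iff)

lemma cd_conj_mult:
  "cd_supp r x \<Longrightarrow> cd_supp r y \<Longrightarrow>
    cd_conj r (cd_mult r x y) = cd_mult r (cd_conj r y) (cd_conj r x)"
proof (induction r arbitrary: x y)
  case 0
  then show ?case by (simp add: fun_eq_iff)
next
  case (Suc r)
  have lo: "cd_lo r (cd_conj (Suc r) x) = cd_conj r (cd_lo r x)" for x
    by (simp add: cd_lo_join cd_supp_conj)
  have hi: "cd_hi r (cd_conj (Suc r) x) = (\<lambda>k. - cd_hi r x k)" for x
    by (simp add: cd_hi_join cd_supp_uminus)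
  show ?case
    unfolding cd_conj.simps(2)[of r "cd_mult (Suc r) x y"]
    by (simp only: cd_mult.simps(2) Let_def lo hi
          cd_lo_join cd_hi_join cd_supp_diff cd_supp_add cd_supp_mult cd_supp_conj cd_supp_lo
          cd_supp_hi cd_conj_diff Suc.IH cd_conj_conj cd_mult_uminus cd_conj_uminus)
       (auto simp: cd_join_def fun_eq_iff)
qed

section \<open>Multiplication by basis elements\<close>

definition cd_unit :: "nat \<Rightarrow> nat \<Rightarrow> real"
  where "cd_unit k = (\<lambda>j. if j = k then 1 else 0)"

definition cd_sign :: "nat \<Rightarrow> real"
  where "cd_sign k = (if k = 0 then 1 else - 1)"

lemma cd_supp_unit: "k < 2 ^ r \<Longrightarrow> cd_supp r (cd_unit k)"
  by (auto simp: cd_supp_def cd_unit_def)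

lemma cd_conj_unit: "k < 2 ^ r \<Longrightarrow> cd_conj r (cd_unit k) = (\<lambda>j. cd_sign k * cd_unit k j)"
  using cd_conj_eq[OF cd_supp_unit[of k r]] by (auto simp: cd_unit_def cd_sign_def)

lemma cd_lo_unit: "cd_lo r (cd_unit k) = (if k < 2 ^ r then cd_unit k else (\<lambda>_. 0))"
  by (auto simp: cd_lo_def cd_unit_def fun_eq_iff)

lemma cd_hi_unit:
  "cd_hi r (cd_unit k) =
    (if 2 ^ r \<le> k \<and> k < 2 ^ Suc r then cd_unit (k - 2 ^ r) else (\<lambda>_. 0))"
  by (auto simp: cd_hi_def cd_unit_def fun_eq_iff)

lemma cd_mult_zero: "cd_mult r (\<lambda>_. 0) y = (\<lambda>_. 0)" "cd_mult r y (\<lambda>_. 0) = (\<lambda>_. 0)"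
proof (induction r arbitrary: y)
  case (Suc r)
  have "cd_lo r (\<lambda>_. 0) = (\<lambda>_. 0)" "cd_hi r (\<lambda>_. 0) = (\<lambda>_. 0)" "cd_conj r (\<lambda>_. 0) = (\<lambda>_. 0)"
    by (auto simp: cd_lo_def cd_hi_def cd_conj_eq cd_supp_def)
  then show "cd_mult (Suc r) (\<lambda>_. 0) y = (\<lambda>_. 0)" "cd_mult (Suc r) y (\<lambda>_. 0) = (\<lambda>_. 0)" for y
    by (simp_all only: cd_mult.simps Let_def Suc.IH) (simp_all add: cd_join_def)
qed auto

lemma cd_conj_zero: "cd_conj r (\<lambda>_. 0) = (\<lambda>_. 0)"
  by (auto simp: cd_conj_eq cd_supp_def)

lemma cd_mult_unit_0:
  "cd_supp r x \<Longrightarrow> cd_mult r (cd_unit 0) x = x" "cd_supp r x \<Longrightarrow> cd_mult r x (cd_unit 0) = x"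
proof (induction r arbitrary: x)
  case 0
  { case 1 then show ?case by (auto simp: cd_unit_def cd_supp_def fun_eq_iff)
  next
    case 2 then show ?case by (auto simp: cd_unit_def cd_supp_def fun_eq_iff) }
next
  case (Suc r)
  { case 1 then show ?case
      by (simp add: Let_def cd_lo_unit cd_hi_unit cd_mult_zero Suc.IH cd_join_lo_hi)
  next
    case 2 then show ?case
      by (simp add: Let_def cd_lo_unit cd_hi_unit cd_mult_zero Suc.IH cd_join_lo_hi cd_conj_zero
          cd_conj_unit cd_sign_def) }
qed

text \<open>
  The algebras are not alternative for \<open>r \<ge> 4\<close>, but the alternative laws hold for repeated
  multiplication by a basis element.
\<close>

lemma cd_mult_unit_twice:
  "k < 2 ^ r \<Longrightarrow> cd_supp r x \<Longrightarrow>
    cd_mult r (cd_unit k) (cd_mult r (cd_unit k) x) = (\<lambda>j. cd_sign k * x j)"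
  "k < 2 ^ r \<Longrightarrow> cd_supp r x \<Longrightarrow>
    cd_mult r (cd_mult r x (cd_unit k)) (cd_unit k) = (\<lambda>j. cd_sign k * x j)"
proof (induction r arbitrary: k x)
  case 0
  { case 1 then show ?case by (auto simp: cd_unit_def cd_sign_def cd_supp_def fun_eq_iff)
  next
    case 2 then show ?case by (auto simp: cd_unit_def cd_sign_def cd_supp_def fun_eq_iff) }
next
  case (Suc r)
  note S = cd_lo_join cd_hi_join cd_supp_diff cd_supp_add cd_supp_mult cd_supp_conj cd_supp_lo
    cd_supp_hi cd_supp_uminus cd_supp_unit cd_supp_scale cd_mult_zero cd_conj_zero
  have sg: "cd_sign k * (cd_sign k * y) = y" for k y
    by (simp add: cd_sign_def)
  show "cd_mult (Suc r) (cd_unit k) (cd_mult (Suc r) (cd_unit k) x) = (\<lambda>j. cd_sign k * x j)"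
    if k: "k < 2 ^ Suc r" and x: "cd_supp (Suc r) x" for k x
  proof (cases "k < 2 ^ r")
    case True
    then show ?thesis
      using Suc.IH[of k] x
      by (simp add: Let_def S cd_lo_unit cd_hi_unit cd_join_scale cd_join_lo_hi)
  next
    case False
    \<comment> \<open>Here the unit is \<open>e l\<close> with a unit \<open>e\<close> of the lower
      algebra. Multiplying twice from the left turns the halves \<gamma> and \<delta> into
      -((\<gamma> (conj e)) e) and -(e ((conj e) \<delta>)). So both laws of the induction
      hypothesis are used, and the sign of \<open>e\<close> occurs twice and cancels
      (\<open>sg\<close>).\<close>
    then have "k - 2 ^ r < 2 ^ r" using k by simp
    moreover have "cd_sign k = - 1" using False by (cases k) (auto simp: cd_sign_def)
    ultimately show ?thesis
      using False k x Suc.IH[of "k - 2 ^ r"]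
        cd_join_scale[of r "-1" "cd_lo r x" "cd_hi r x"]
      by (simp add: Let_def S cd_lo_unit cd_hi_unit cd_join_lo_hi cd_conj_mult cd_conj_conj
          cd_conj_unit cd_mult_scale cd_mult_uminus cd_conj_uminus sg)
  qed
  show "cd_mult (Suc r) (cd_mult (Suc r) x (cd_unit k)) (cd_unit k) = (\<lambda>j. cd_sign k * x j)"
    if k: "k < 2 ^ Suc r" and x: "cd_supp (Suc r) x" for k x
  proof (cases "k < 2 ^ r")
    case True
    then show ?thesis
      using Suc.IH[of k] x
      by (simp add: Let_def S cd_lo_unit cd_hi_unit cd_join_scale cd_join_lo_hi cd_conj_unit
          cd_mult_scale sg)
  next
    case False
    then have "k - 2 ^ r < 2 ^ r" using k by simp
    moreover have "cd_sign k = - 1" using False by (cases k) (auto simp: cd_sign_def)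
    ultimately show ?thesis
      using False k x Suc.IH[of "k - 2 ^ r"]
        cd_join_scale[of r "-1" "cd_lo r x" "cd_hi r x"]
      by (simp add: Let_def S cd_lo_unit cd_hi_unit cd_join_lo_hi cd_conj_mult cd_conj_conj
          cd_conj_unit cd_mult_scale cd_mult_uminus cd_conj_uminus sg)
  qed
qed

section \<open>Product, norm, conjugation and coordinates on the type\<close>

lemma cd_scaleR: "(c *\<^sub>R x) * y = c *\<^sub>R (x * y)" "x * (c *\<^sub>R y) = c *\<^sub>R (x * y)"
  for x y :: "'r::finite cd"
  using cd_coord[of x] cd_coord[of y]
  by (auto intro!: cd_eqI simp: times_cd.rep_eq scaleR_cd.rep_eq cd_mult_scale)

lemma cd_mult_1 [simp]: "1 * x = x" "x * 1 = x" for x :: "'r::finite cd"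
proof -
  have 1: "cd_coord (1 :: 'r cd) = cd_unit 0"
    by (auto simp: one_cd_def cd_coord_i cd_unit_def)
  show "1 * x = x" "x * 1 = x"
    using cd_coord[of x]
    by (auto intro!: cd_eqI simp: times_cd.rep_eq cd_mult_unit_0 1)
qed

lemma cd_norm_i: "j < 2 ^ CARD('r) \<Longrightarrow> norm (cd_i j :: 'r::finite cd) = 1"
  by (auto simp: norm_eq_sqrt_inner inner_cd_i cd_coord_i)

lemma cd_norm_1 [simp]: "norm (1 :: 'r::finite cd) = 1"
  by (simp add: one_cd_def cd_norm_i)

lemma cd_bounded_bilinear: "bounded_bilinear ((*) :: 'r::finite cd \<Rightarrow> 'r cd \<Rightarrow> 'r cd)"
  unfolding bilinear_conv_bounded_bilinear[symmetric]
  by (auto simp: bilinear_def cd_distrib cd_scaleR intro!: linearI)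

lemma cd_expand: "z = (\<Sum>j<2 ^ CARD('r). cd_coord z j *\<^sub>R cd_i j)" for z :: "'r::finite cd"
proof (rule cd_eqI)
  fix k assume k: "k < (2::nat) ^ CARD('r)"
  have "(\<Sum>j<2 ^ CARD('r). cd_coord z j * cd_coord (cd_i j :: 'r cd) k)
    = (\<Sum>j<2 ^ CARD('r). if j = k then cd_coord z j else 0)"
    by (rule sum.cong) (auto simp: cd_coord_i)
  also have "\<dots> = cd_coord z k" using k by simp
  finally show "cd_coord z k = cd_coord (\<Sum>j<2 ^ CARD('r). cd_coord z j *\<^sub>R (cd_i j :: 'r cd)) k"
    by (simp only: cd_coord_sum cd_coord_simps)
qed

lemma abs_cd_coord_le: "\<bar>cd_coord z j\<bar> \<le> norm z" for z :: "'r::finite cd"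
proof (cases "j < 2 ^ CARD('r)")
  case True
  then show ?thesis
    using Cauchy_Schwarz_ineq2[of z "cd_i j"] by (simp add: inner_cd_i cd_norm_i)
qed (simp add: cd_coord_eq_0)

lemma cd_cnj_linear: "cd_cnj (x + y) = cd_cnj x + cd_cnj y" "cd_cnj (c *\<^sub>R x) = c *\<^sub>R cd_cnj x"
  for x y :: "'r::finite cd"
  by (auto intro!: cd_eqI simp: cd_coord_cnj)

lemma cd_cnj_mult: "cd_cnj (x * y) = cd_cnj y * cd_cnj x" for x y :: "'r::finite cd"
  using cd_coord[of x] cd_coord[of y]
  by (auto intro!: cd_eqI simp: times_cd.rep_eq cd_cnj.rep_eq cd_conj_mult)

lemma cd_cnj_i:
  "j < 2 ^ CARD('r) \<Longrightarrow> cd_cnj (cd_i j :: 'r::finite cd) = cd_sign j *\<^sub>R cd_i j"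
  by (auto intro!: cd_eqI simp: cd_coord_cnj cd_coord_i cd_sign_def)

text \<open>Polarisation of \<open>cd_norm_eq\<close> at z + i_j: the mixed terms are a product plus
  its conjugate, hence twice a real part. A coordinate is thereby reached by one multiplication and
  one conjugation, without any rebracketing.\<close>

lemma cd_coord_eq_Re:
  fixes z :: "'r::finite cd"
  assumes "j < 2 ^ CARD('r)"
  shows "cd_coord z j = cd_Re (z * cd_cnj (cd_i j))"
proof -
  let ?w = "cd_i j :: 'r cd"
  have add: "(z + ?w) * cd_cnj (z + ?w) = z * cd_cnj z + ?w * cd_cnj ?w + (z * cd_cnj ?w + ?w * cd_cnj z)"
    by (simp add: cd_cnj_linear cd_distrib)
  have "(norm (z + ?w))\<^sup>2 = (norm z)\<^sup>2 + (norm ?w)\<^sup>2 + 2 * cd_coord z j"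
    using assms by (simp add: power2_norm_eq_inner inner_add inner_commute inner_cd_i)
  then have "(2 * cd_coord z j) *\<^sub>R 1 = z * cd_cnj ?w + ?w * cd_cnj z"
    using add unfolding cd_norm_eq by (simp add: scaleR_add_left)
  moreover have "?w * cd_cnj z = cd_cnj (z * cd_cnj ?w)"
  proof -
    have "cd_cnj (cd_cnj ?w) = ?w" by (auto intro!: cd_eqI simp: cd_coord_cnj)
    then show ?thesis by (simp add: cd_cnj_mult)
  qed
  ultimately have "cd_coord ((2 * cd_coord z j) *\<^sub>R (1::'r cd)) 0 =
      cd_coord (z * cd_cnj ?w + cd_cnj (z * cd_cnj ?w)) 0"
    by simp
  then show ?thesis
    by (simp add: cd_coord_cnj one_cd_def cd_coord_i cd_Re_def)
qed

lemma cd_i_twice: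
  fixes x :: "'r::finite cd"
  assumes "k < 2 ^ CARD('r)"
  shows "cd_i k * (cd_i k * x) = cd_sign k *\<^sub>R x"
proof -
  have 1: "cd_coord (cd_i k :: 'r cd) = cd_unit k"
    using assms by (auto simp: cd_coord_i cd_unit_def)
  show ?thesis
    using cd_coord[of x] assms
    by (auto intro!: cd_eqI simp: times_cd.rep_eq scaleR_cd.rep_eq 1 cd_mult_unit_twice)
qed

text \<open>For distinct imaginary units, anticommuting the inner product gives i_k (i_k i_j), which
  the alternative law for basis elements evaluates.\<close>

lemma cd_i_conjugation:
  assumes "1 \<le> k" "k < 2 ^ CARD('r)" "j < 2 ^ CARD('r)"
  shows "cd_i k * (cd_i j * cd_cnj (cd_i k)) =
    (if j = 0 \<or> j = k then cd_i j else - cd_i j :: 'r::finite cd)"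
proof -
  consider "j = 0" | "j = k" "j \<noteq> 0" | "j \<noteq> 0" "j \<noteq> k" by blast
  then show ?thesis
  proof cases
    case 1
    then show ?thesis
      using assms cd_norm_eq(1)[of "cd_i k :: 'r cd"] by (simp add: cd_norm_i flip: one_cd_def)
  next
    case 2
    then show ?thesis
      using assms cd_i_twice[of k "cd_i k :: 'r cd"]
      by (simp add: cd_cnj_i cd_sign_def cd_minus)
  next
    case 3
    then have "cd_i k * (cd_i j * cd_cnj (cd_i k)) = cd_i k * (cd_i k * cd_i j :: 'r cd)"
      using assms cd_i_anticommute[of j k, where 'r='r]
      by (simp add: cd_cnj_i cd_sign_def cd_minus)
    then show ?thesis
      using 3 assms by (simp add: cd_i_twice cd_sign_def)
  qed
qed

text \<open>Count signs with N = 2^r: the coordinate 0 is kept by all N - 1 conjugations, while a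
  coordinate l >= 1 is kept by one of them (k = l) and negated by the other N - 2. For r = 1 both
  sides vanish, so that the conjugate can be solved for only when r >= 2.\<close>

lemma cd_cnj_eq_sum:
  "(2 ^ CARD('r) - 2) *\<^sub>R cd_cnj h =
    (\<Sum>k\<in>{1..<2 ^ CARD('r)}. cd_i k * (h * cd_cnj (cd_i k))) - h" for h :: "'r::finite cd"
proof -
  let ?N = "2 ^ CARD('r) :: nat"
  interpret bounded_bilinear "(*) :: 'r cd \<Rightarrow> 'r cd \<Rightarrow> 'r cd" by (rule cd_bounded_bilinear)
  have "?N \<ge> 2" using self_le_power[of 2 "CARD('r)"] by simp
  have "cd_coord (\<Sum>k\<in>{1..<?N}. cd_i k * (h * cd_cnj (cd_i k))) l
      = (real ?N - 2) * cd_coord (cd_cnj h) l + cd_coord h l" if l: "l < ?N" for l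
  proof -
    have "cd_i k * (h * cd_cnj (cd_i k))
        = (\<Sum>j<?N. (if j = 0 \<or> j = k then cd_coord h j else - cd_coord h j) *\<^sub>R cd_i j)"
      if "k \<in> {1..<?N}" for k
    proof -
      have "cd_i k * (h * cd_cnj (cd_i k))
          = (\<Sum>j<?N. cd_coord h j *\<^sub>R (cd_i k * (cd_i j * cd_cnj (cd_i k))))"
        by (subst cd_expand[of h]) (simp add: sum_left sum_right cd_scaleR)
      also have "\<dots> = (\<Sum>j<?N. (if j = 0 \<or> j = k then cd_coord h j else - cd_coord h j) *\<^sub>R cd_i j)"
        using that by (intro sum.cong) (auto simp: cd_i_conjugation)
      finally show ?thesis .
    qed
    moreover have "cd_coord (\<Sum>j<?N. x j *\<^sub>R cd_i j :: 'r cd) l = x l" for x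
    proof -
      have "(\<Sum>j<?N. x j * cd_coord (cd_i j :: 'r cd) l) = (\<Sum>j<?N. if j = l then x j else 0)"
        by (rule sum.cong) (auto simp: cd_coord_i)
      then show ?thesis using l by simp
    qed
    ultimately have "cd_coord (\<Sum>k\<in>{1..<?N}. cd_i k * (h * cd_cnj (cd_i k))) l
        = (\<Sum>k\<in>{1..<?N}. (if l = 0 \<or> l = k then cd_coord h l else - cd_coord h l))"
      by simp
    also have "\<dots> = (real ?N - 2) * cd_coord (cd_cnj h) l + cd_coord h l"
    proof (cases "l = 0")
      case True
      then show ?thesis using \<open>?N \<ge> 2\<close> by (simp add: cd_coord_cnj of_nat_diff algebra_simps)
    next
      case False
      have "(\<Sum>k\<in>{1..<?N}. (if l = 0 \<or> l = k then cd_coord h l else - cd_coord h l))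
          = (\<Sum>k\<in>{1..<?N}. - cd_coord h l + (if l = k then 2 * cd_coord h l else 0))"
        using False by (intro sum.cong) auto
      also have "\<dots> = - (real ?N - 1) * cd_coord h l + 2 * cd_coord h l"
        using False l \<open>?N \<ge> 2\<close> unfolding sum.distrib by (simp add: of_nat_diff algebra_simps)
      finally show ?thesis using False by (simp add: cd_coord_cnj algebra_simps)
    qed
    finally show ?thesis .
  qed
  then show ?thesis by (intro cd_eqI) (simp del: cd_coord_sum)
qed

text \<open>The span of 1 and \<open>m\<close> is a copy of the complex numbers:
  \<open>\<psi>\<close> is bounded, linear and multiplicative, so it carries the exponential series
  of the complex plane to that of \<open>cd_exp\<close>.\<close>

lemma cd_exp_plane:
  fixes m :: "'r::finite cd"
  assumes "m * m = - 1"
  shows "cd_exp (x *\<^sub>R 1 + b *\<^sub>R m) = (exp x * cos b) *\<^sub>R 1 + (exp x * sin b) *\<^sub>R m"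
proof -
  define \<psi> where "\<psi> w = Re w *\<^sub>R 1 + Im w *\<^sub>R m" for w
  have mult: "\<psi> (v * w) = \<psi> v * \<psi> w" for v w
    by (simp add: \<psi>_def cd_distrib cd_scaleR assms algebra_simps)
  have pow: "\<psi> (w ^ k) = \<psi> w ^ k" for w k
    by (induction k) (simp_all add: mult, simp add: \<psi>_def)
  have "bounded_linear \<psi>"
    unfolding \<psi>_def
    by (intro bounded_linear_add bounded_linear_compose[OF bounded_linear_scaleR_left]
        bounded_linear_Re bounded_linear_Im)
  from bounded_linear.sums[OF this exp_converges[of "Complex x b"]]
  have "(\<lambda>k. \<psi> (Complex x b) ^ k /\<^sub>R fact k) sums \<psi> (exp (Complex x b))"
    by (simp add: linear_scale[OF bounded_linear.linear[OF \<open>bounded_linear \<psi>\<close>]] pow)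
  then show ?thesis
    by (simp add: sums_iff cd_exp_def \<psi>_def exp_eq_polar[of "Complex x b"] cis.sel Re_exp Im_exp)
qed

lemma cd_imag_unit_square:
  fixes m :: "'r::finite cd"
  assumes "cd_coord m 0 = 0" "norm m = 1"
  shows "m * m = - 1"
proof -
  have "cd_cnj m = - m"
    using assms by (auto intro!: cd_eqI simp: cd_coord_cnj)
  then show ?thesis
    using cd_norm_eq(1)[of m] assms by (simp add: cd_minus) (metis minus_minus)
qed

section \<open>Normally convergent expansions with parameters\<close>

text \<open>Boundedness of the bilinear product provides such a constant. Asking for at least 1 lets
  the weighted norm below dominate the Euclidean one and permits surplus factors in later
  estimates.\<close>

definition cd_mult_const :: "'r::finite itself \<Rightarrow> real"
  where "cd_mult_const _ = (SOME K. 1 \<le> K \<and> (\<forall>x y :: 'r cd. norm (x * y) \<le> K * norm x * norm y))"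

lemma cd_mult_const:
  "1 \<le> cd_mult_const TYPE('r)"
  "norm (x * y) \<le> cd_mult_const TYPE('r) * norm x * norm y" for x y :: "'r::finite cd"
proof -
  obtain K where K: "norm (x * y) \<le> norm x * norm y * K" for x y :: "'r cd"
    using bounded_bilinear.bounded[OF cd_bounded_bilinear] by blast
  have "norm (x * y) \<le> max K 1 * norm x * norm y" for x y :: "'r cd"
  proof -
    have "norm x * norm y * K \<le> norm x * norm y * max K 1" by (intro mult_left_mono) auto
    with K[of x y] show ?thesis by (simp add: mult_ac)
  qed
  then have "\<exists>K. 1 \<le> K \<and> (\<forall>x y :: 'r cd. norm (x * y) \<le> K * norm x * norm y)"
    by (intro exI[of _ "max K 1"]) auto
  from someI_ex[OF this]
  show "1 \<le> cd_mult_const TYPE('r)"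
    "norm (x * y) \<le> cd_mult_const TYPE('r) * norm x * norm y" for x y :: "'r cd"
    unfolding cd_mult_const_def by blast+
qed

text \<open>The Euclidean norm is not submultiplicative for \<open>r \<ge> 4\<close>; this multiple of it is.\<close>

definition cd_wnorm :: "'r::finite cd \<Rightarrow> real"
  where "cd_wnorm x = cd_mult_const TYPE('r) * norm x"

lemma cd_wnorm_mult: "cd_wnorm (x * y) \<le> cd_wnorm x * cd_wnorm y"
  for x y :: "'r::finite cd"
proof -
  have "cd_mult_const TYPE('r) * norm (x * y)
      \<le> cd_mult_const TYPE('r) * (cd_mult_const TYPE('r) * norm x * norm y)"
    using cd_mult_const(1)[where 'r='r] by (intro mult_left_mono cd_mult_const) auto
  then show ?thesis by (simp add: cd_wnorm_def mult_ac)
qed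

lemma cd_wnorm_nonneg [simp]: "0 \<le> cd_wnorm x" for x :: "'r::finite cd"
  using cd_mult_const(1)[where 'r='r] by (simp add: cd_wnorm_def)

lemma norm_le_cd_wnorm: "norm x \<le> cd_wnorm x" for x :: "'r::finite cd"
  using cd_mult_const(1)[where 'r='r] mult_right_mono[of 1 "cd_mult_const TYPE('r)" "norm x"]
  by (simp add: cd_wnorm_def)

lemma cd_wnorm_scaleR: "cd_wnorm (c *\<^sub>R x) = \<bar>c\<bar> * cd_wnorm x" for x :: "'r::finite cd"
  by (simp add: cd_wnorm_def)

text \<open>The coefficients \<open>c\<close> are real, so they commute with every bracketing, and
  they alone depend on the parameter \<open>t\<close>. The majorants \<open>\<beta>\<close> hold
  uniformly in \<open>h\<close> and are free of \<open>t\<close>, so that integrating |c| yields a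
  summable majorant. Sums are unordered, which allows double series to be renumbered, and
  \<open>B\<close> bounds finite partial sums pointwise in \<open>t\<close>, so that bounds multiply
  under products before any integrability is asked for.\<close>

definition expansion ::
    "'t measure \<Rightarrow> real \<Rightarrow> ('t \<Rightarrow> 'r::finite cd \<Rightarrow> 'r cd) \<Rightarrow> ('t \<Rightarrow> real) \<Rightarrow>
      (nat \<Rightarrow> 't \<Rightarrow> real) \<Rightarrow> (nat \<Rightarrow> 'r cd na_monomial) \<Rightarrow> (nat \<Rightarrow> real) \<Rightarrow> bool"
  where "expansion M \<rho> g B c m \<beta> \<longleftrightarrow>
    (\<forall>k. c k \<in> borel_measurable M) \<and> (\<forall>k. 0 \<le> \<beta> k) \<and>
    (\<forall>k h. norm h < \<rho> \<longrightarrow> cd_wnorm (na_eval (m k) h) \<le> \<beta> k) \<and>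
    (\<forall>t F. finite F \<longrightarrow> (\<Sum>k\<in>F. \<bar>c k t\<bar> * \<beta> k) \<le> B t) \<and>
    (\<forall>t h. norm h < \<rho> \<longrightarrow> ((\<lambda>k. c k t *\<^sub>R na_eval (m k) h) has_sum g t h) UNIV)"

definition expands ::
    "'t measure \<Rightarrow> real \<Rightarrow> ('t \<Rightarrow> 'r::finite cd \<Rightarrow> 'r cd) \<Rightarrow> ('t \<Rightarrow> real) \<Rightarrow> bool"
  where "expands M \<rho> g B \<longleftrightarrow> (\<exists>c m \<beta>. expansion M \<rho> g B c m \<beta>)"

lemma summable_on_if_norm_sum_le:
  fixes f :: "'i \<Rightarrow> 'b::banach"
  assumes "\<And>F. finite F \<Longrightarrow> (\<Sum>k\<in>F. norm (f k)) \<le> B"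
  shows "f summable_on UNIV"
proof (rule abs_summable_summable)
  show "f abs_summable_on UNIV"
    unfolding abs_summable_iff_bdd_above using assms by (intro bdd_aboveI2[where M=B]) auto
qed

lemma expandsE:
  assumes "expands M \<rho> g B"
  obtains c \<beta> m where "\<And>k::nat. c k \<in> borel_measurable M" "\<And>k. 0 \<le> \<beta> k"
    "\<And>k h. norm h < \<rho> \<Longrightarrow> cd_wnorm (na_eval (m k) h) \<le> \<beta> k"
    "\<And>t F. finite F \<Longrightarrow> (\<Sum>k\<in>F. \<bar>c k t\<bar> * \<beta> k) \<le> B t"
    "\<And>t h. norm h < \<rho> \<Longrightarrow> ((\<lambda>k. c k t *\<^sub>R na_eval (m k) h) has_sum g t h) UNIV"
proof -
  from assms obtain c m \<beta> where
    c: "\<forall>k::nat. c k \<in> borel_measurable M" "\<forall>k. 0 \<le> \<beta> k"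
    "\<forall>k h. norm h < \<rho> \<longrightarrow> cd_wnorm (na_eval (m k) h) \<le> \<beta> k"
    "\<forall>t F. finite F \<longrightarrow> (\<Sum>k\<in>F. \<bar>c k t\<bar> * \<beta> k) \<le> B t"
    "\<forall>t h. norm h < \<rho> \<longrightarrow> ((\<lambda>k. c k t *\<^sub>R na_eval (m k) h) has_sum g t h) UNIV"
    unfolding expands_def expansion_def by (elim exE conjE)
  show thesis
    by (rule that[OF c(1)[rule_format] c(2)[rule_format] c(3)[rule_format] c(4)[rule_format]
          c(5)[rule_format]])
qed

lemma expandsI:
  assumes "\<And>k::nat. c k \<in> borel_measurable M" "\<And>k. 0 \<le> \<beta> k"
    "\<And>k h. norm h < \<rho> \<Longrightarrow> cd_wnorm (na_eval (m k) h) \<le> \<beta> k"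
    "\<And>t F. finite F \<Longrightarrow> (\<Sum>k\<in>F. \<bar>c k t\<bar> * \<beta> k) \<le> B t"
    "\<And>t h. norm h < \<rho> \<Longrightarrow> ((\<lambda>k. c k t *\<^sub>R na_eval (m k) h) has_sum g t h) UNIV"
  shows "expands M \<rho> g B"
  unfolding expands_def expansion_def
  by (rule exI[of _ c], rule exI[of _ m], rule exI[of _ \<beta>]) (simp add: assms)

lemma expands_nonneg: "expands M \<rho> g B \<Longrightarrow> 0 \<le> B t"
  unfolding expands_def expansion_def by (metis finite.emptyI sum.empty)

lemma expands_mono:
  assumes "expands M \<rho> g B" and B': "\<And>t. B t \<le> B' t"
  shows "expands M \<rho> g B'"
proof (rule expandsE[OF assms(1)])
  fix c :: "nat \<Rightarrow> 'a \<Rightarrow> real" and \<beta> m assume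
    c: "\<And>k. c k \<in> borel_measurable M" and \<beta>: "\<And>k. 0 \<le> \<beta> k"
    "\<And>k h. norm h < \<rho> \<Longrightarrow> cd_wnorm (na_eval (m k) h) \<le> \<beta> k"
    and B: "\<And>t F. finite F \<Longrightarrow> (\<Sum>k\<in>F. \<bar>c k t\<bar> * \<beta> k) \<le> B t"
    and s: "\<And>t h. norm h < \<rho> \<Longrightarrow> ((\<lambda>k. c k t *\<^sub>R na_eval (m k) h) has_sum g t h) UNIV"
  show ?thesis
    by (rule expandsI[OF c \<beta> order_trans[OF B B'] s])
qed

lemma expands_monomial:
  fixes M :: "'t measure" and m :: "'r::finite cd na_monomial"
  assumes "\<And>h. norm h < \<rho> \<Longrightarrow> cd_wnorm (na_eval m h) \<le> \<beta>" "0 \<le> \<beta>"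
  shows "expands M \<rho> (\<lambda>t h. na_eval m h) (\<lambda>t. \<beta>)"
proof (rule expandsI)
  fix t :: 't and F :: "nat set" and h :: "'r cd"
  let ?c = "\<lambda>(k::nat) (t::'t). if k = 0 then 1 else 0 :: real"
  show "?c k \<in> borel_measurable M" for k by simp
  show "(\<Sum>k\<in>F. \<bar>?c k t\<bar> * \<beta>) \<le> \<beta>" if "finite F"
    using that assms by (simp add: if_distrib if_distribR cong: if_cong)
  have "((\<lambda>k. ?c k t *\<^sub>R na_eval m h) has_sum (\<Sum>k\<in>{0}. ?c k t *\<^sub>R na_eval m h)) {0}"
    by (rule has_sum_finite) simp
  then show "((\<lambda>k. ?c k t *\<^sub>R na_eval m h) has_sum na_eval m h) UNIV"
    by (subst has_sum_cong_neutral[where T="{0}"]) auto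
qed (use assms in auto)

lemma expands_const: "expands M \<rho> (\<lambda>t h. d) (\<lambda>t. cd_wnorm d)"
  using expands_monomial[of \<rho> "Coeff d" "cd_wnorm d"] by simp

lemma expands_var: "0 \<le> \<rho> \<Longrightarrow> expands M \<rho> (\<lambda>t h. h :: 'r::finite cd) (\<lambda>t. cd_mult_const TYPE('r) * \<rho>)"
  using expands_monomial[of \<rho> "Var :: 'r cd na_monomial" "cd_mult_const TYPE('r) * \<rho>"]
    cd_mult_const(1)[where 'r='r]
  by (simp add: cd_wnorm_def)

lemma expands_scale:
  assumes [measurable]: "a \<in> borel_measurable M" and "expands M \<rho> g B"
  shows "expands M \<rho> (\<lambda>t h. a t *\<^sub>R g t h) (\<lambda>t. \<bar>a t\<bar> * B t)"
proof (rule expandsE[OF assms(2)])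
  fix c :: "nat \<Rightarrow> 'a \<Rightarrow> real" and \<beta> m assume
    [measurable]: "\<And>k. c k \<in> borel_measurable M" and \<beta>: "\<And>k. 0 \<le> \<beta> k"
    "\<And>k h. norm h < \<rho> \<Longrightarrow> cd_wnorm (na_eval (m k) h) \<le> \<beta> k"
    and B: "\<And>t F. finite F \<Longrightarrow> (\<Sum>k\<in>F. \<bar>c k t\<bar> * \<beta> k) \<le> B t"
    and s: "\<And>t h. norm h < \<rho> \<Longrightarrow> ((\<lambda>k. c k t *\<^sub>R na_eval (m k) h) has_sum g t h) UNIV"
  show ?thesis
  proof (rule expandsI)
    show "(\<lambda>t. a t * c k t) \<in> borel_measurable M" for k by simp
    show "(\<Sum>k\<in>F. \<bar>a t * c k t\<bar> * \<beta> k) \<le> \<bar>a t\<bar> * B t" if "finite F" for F t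
      using mult_left_mono[OF B[OF that], of "\<bar>a t\<bar>" t]
      by (simp add: abs_mult sum_distrib_left mult.assoc)
    show "((\<lambda>k. (a t * c k t) *\<^sub>R na_eval (m k) h) has_sum a t *\<^sub>R g t h) UNIV"
      if "norm h < \<rho>" for t h
      using has_sum_bounded_linear[OF bounded_linear_scaleR_right s[OF that], of "a t"] by simp
  qed (use \<beta> in auto)
qed

text \<open>The Cauchy product over pairs of indices. Each pair contributes a bracketed product of
  monomials, and submultiplicativity of \<open>cd_wnorm\<close> makes the product of the majorants a
  majorant.\<close>

lemma expands_mult:
  assumes "expands M \<rho> g B" "expands M \<rho> g' B'"
  shows "expands M \<rho> (\<lambda>t h. g t h * g' t h) (\<lambda>t. B t * B' t)"
proof (rule expandsE[OF assms(1)], rule expandsE[OF assms(2)])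
  fix c :: "nat \<Rightarrow> 'a \<Rightarrow> real" and \<beta> m assume
    [measurable]: "\<And>k. c k \<in> borel_measurable M" and \<beta>: "\<And>k. 0 \<le> \<beta> k"
    "\<And>k h. norm h < \<rho> \<Longrightarrow> cd_wnorm (na_eval (m k) h) \<le> \<beta> k"
    and B: "\<And>t F. finite F \<Longrightarrow> (\<Sum>k\<in>F. \<bar>c k t\<bar> * \<beta> k) \<le> B t"
    and s: "\<And>t h. norm h < \<rho> \<Longrightarrow> ((\<lambda>k. c k t *\<^sub>R na_eval (m k) h) has_sum g t h) UNIV"
  fix c' :: "nat \<Rightarrow> 'a \<Rightarrow> real" and \<beta>' m' assume
    [measurable]: "\<And>k. c' k \<in> borel_measurable M" and \<beta>': "\<And>k. 0 \<le> \<beta>' k"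
    "\<And>k h. norm h < \<rho> \<Longrightarrow> cd_wnorm (na_eval (m' k) h) \<le> \<beta>' k"
    and B': "\<And>t F. finite F \<Longrightarrow> (\<Sum>k\<in>F. \<bar>c' k t\<bar> * \<beta>' k) \<le> B' t"
    and s': "\<And>t h. norm h < \<rho> \<Longrightarrow> ((\<lambda>k. c' k t *\<^sub>R na_eval (m' k) h) has_sum g' t h) UNIV"
  define C where "C = (\<lambda>(i, j) t. c i t * c' j t)"
  define N where "N = (\<lambda>(i, j). Times (m i) (m' j))"
  define b where "b = (\<lambda>(i, j). \<beta> i * \<beta>' j)"
  have [measurable]: "C k \<in> borel_measurable M" for k
    by (cases k) (simp add: C_def)
  have b0: "0 \<le> b k" for k
    using \<beta> \<beta>' by (cases k) (simp add: b_def)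
  have bN: "cd_wnorm (na_eval (N k) h) \<le> b k" if "norm h < \<rho>" for k h
  proof (cases k)
    case (Pair i j)
    have "cd_wnorm (na_eval (m i) h * na_eval (m' j) h) \<le> \<beta> i * \<beta>' j"
      using \<beta>(2)[OF that] \<beta>'(2)[OF that] \<beta>(1)
      by (intro order_trans[OF cd_wnorm_mult] mult_mono) auto
    then show ?thesis by (simp add: Pair N_def b_def)
  qed
  have bd: "(\<Sum>k\<in>F. \<bar>C k t\<bar> * b k) \<le> B t * B' t" if "finite F" for F t
  proof -
    have "(\<Sum>k\<in>F. \<bar>C k t\<bar> * b k) \<le> (\<Sum>k\<in>fst ` F \<times> snd ` F. \<bar>C k t\<bar> * b k)"
      using that b0 by (intro sum_mono2 finite_cartesian_product) (auto simp: rev_image_eqI)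
    also have "\<dots> = (\<Sum>i\<in>fst ` F. \<bar>c i t\<bar> * \<beta> i) * (\<Sum>j\<in>snd ` F. \<bar>c' j t\<bar> * \<beta>' j)"
      unfolding sum_product sum.cartesian_product
      by (intro sum.cong) (auto simp: C_def b_def abs_mult)
    also have "\<dots> \<le> B t * B' t"
      using that \<beta> \<beta>' expands_nonneg[OF assms(1)]
      by (intro mult_mono B B' sum_nonneg) auto
    finally show ?thesis .
  qed
  have sum: "((\<lambda>k. C k t *\<^sub>R na_eval (N k) h) has_sum g t h * g' t h) UNIV"
    if h: "norm h < \<rho>" for t h
  proof -
    have "(\<lambda>k. C k t *\<^sub>R na_eval (N k) h) summable_on UNIV"
    proof (rule summable_on_if_norm_sum_le[where B="B t * B' t"])
      fix F :: "(nat \<times> nat) set" assume F: "finite F"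
      have "(\<Sum>k\<in>F. norm (C k t *\<^sub>R na_eval (N k) h)) \<le> (\<Sum>k\<in>F. \<bar>C k t\<bar> * b k)"
        by (intro sum_mono) (simp add: mult_left_mono order_trans[OF norm_le_cd_wnorm bN[OF h]])
      with bd[OF F] show "(\<Sum>k\<in>F. norm (C k t *\<^sub>R na_eval (N k) h)) \<le> B t * B' t"
        by (rule order_trans[rotated])
    qed
    \<comment> \<open>Absolute boundedness yields some unordered double sum; summing over the second
      index first then identifies its value.\<close>
    then obtain S where S: "((\<lambda>k. C k t *\<^sub>R na_eval (N k) h) has_sum S) UNIV"
      by (auto simp: summable_on_def)
    have "((\<lambda>i. (c i t *\<^sub>R na_eval (m i) h) * g' t h) has_sum S) UNIV"
    proof (rule has_sum_SigmaD)
      show "((\<lambda>k. C k t *\<^sub>R na_eval (N k) h) has_sum S) (UNIV \<times> UNIV)"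
        using S by simp
      show "((\<lambda>j. C (i, j) t *\<^sub>R na_eval (N (i, j)) h) has_sum
          (c i t *\<^sub>R na_eval (m i) h) * g' t h) UNIV" for i
        using has_sum_bounded_linear[OF bounded_bilinear.bounded_linear_right[OF cd_bounded_bilinear]
            s'[OF h], of "c i t *\<^sub>R na_eval (m i) h"]
        by (simp add: C_def N_def cd_scaleR mult.commute)
    qed
    moreover have "((\<lambda>i. (c i t *\<^sub>R na_eval (m i) h) * g' t h) has_sum g t h * g' t h) UNIV"
      by (rule has_sum_bounded_linear[OF bounded_bilinear.bounded_linear_left[OF cd_bounded_bilinear]
            s[OF h]])
    ultimately show ?thesis using S has_sum_unique by blast
  qed
  show ?thesis
  proof (rule expandsI)
    show "C (prod_decode k) \<in> borel_measurable M" for k by simp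
    show "0 \<le> b (prod_decode k)" for k by (rule b0)
    show "cd_wnorm (na_eval (N (prod_decode k)) h) \<le> b (prod_decode k)" if "norm h < \<rho>" for k h
      using that by (rule bN)
    show "(\<Sum>k\<in>F. \<bar>C (prod_decode k) t\<bar> * b (prod_decode k)) \<le> B t * B' t" if "finite F" for F t
      using bd[of "prod_decode ` F" t] that by (simp add: sum.reindex inj_prod_decode)
    show "((\<lambda>k. C (prod_decode k) t *\<^sub>R na_eval (N (prod_decode k)) h) has_sum g t h * g' t h) UNIV"
      if "norm h < \<rho>" for t h
      by (subst has_sum_reindex_bij_betw[OF bij_prod_decode]) (rule sum[OF that])
  qed
qed

text \<open>Flattens a series of expansions into a single one by numbering pairs. Finite sums
  (padded with zeros) and power series are both obtained from it.\<close>

lemma expands_infsum: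
  assumes g: "\<And>i::nat. expands M \<rho> (g i) (B i)"
    and B': "\<And>t F. finite F \<Longrightarrow> (\<Sum>i\<in>F. B i t) \<le> B' t"
    and G: "\<And>t h. norm h < \<rho> \<Longrightarrow> ((\<lambda>i. g i t h) has_sum G t h) UNIV"
  shows "expands M \<rho> G B'"
proof -
  obtain c m \<beta> where *: "expansion M \<rho> (g i) (B i) (c i) (m i) (\<beta> i)" for i
    using g unfolding expands_def by metis
  have [measurable]: "c i k \<in> borel_measurable M" for i k using *[of i] unfolding expansion_def by blast
  have \<beta>: "0 \<le> \<beta> i k" "norm h < \<rho> \<Longrightarrow> cd_wnorm (na_eval (m i k) h) \<le> \<beta> i k" for i k h
    using *[of i] unfolding expansion_def by blast+
  have B: "(\<Sum>k\<in>F. \<bar>c i k t\<bar> * \<beta> i k) \<le> B i t" if "finite F" for F i t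
    using *[of i] that unfolding expansion_def by blast
  have s: "((\<lambda>k. c i k t *\<^sub>R na_eval (m i k) h) has_sum g i t h) UNIV"
    if "norm h < \<rho>" for i t h using *[of i] that unfolding expansion_def by blast
  define C where "C = (\<lambda>(i, j) t. c i j t)"
  define N where "N = (\<lambda>(i, j). m i j)"
  define b where "b = (\<lambda>(i, j). \<beta> i j)"
  have [measurable]: "C k \<in> borel_measurable M" for k
    by (cases k) (simp add: C_def)
  have b0: "0 \<le> b k" for k
    using \<beta> by (cases k) (simp add: b_def)
  have bN: "cd_wnorm (na_eval (N k) h) \<le> b k" if "norm h < \<rho>" for k h
    using \<beta>(2)[OF that] by (cases k) (simp add: N_def b_def)
  have bd: "(\<Sum>k\<in>F. \<bar>C k t\<bar> * b k) \<le> B' t" if "finite F" for F t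
  proof -
    have "(\<Sum>k\<in>F. \<bar>C k t\<bar> * b k) \<le> (\<Sum>k\<in>fst ` F \<times> snd ` F. \<bar>C k t\<bar> * b k)"
      using that b0 by (intro sum_mono2 finite_cartesian_product) (auto simp: rev_image_eqI)
    also have "\<dots> = (\<Sum>i\<in>fst ` F. \<Sum>j\<in>snd ` F. \<bar>c i j t\<bar> * \<beta> i j)"
      by (simp add: sum.cartesian_product C_def b_def case_prod_unfold)
    also have "\<dots> \<le> (\<Sum>i\<in>fst ` F. B i t)"
      using that by (intro sum_mono B) auto
    also have "\<dots> \<le> B' t" using that by (intro B') auto
    finally show ?thesis .
  qed
  have sum: "((\<lambda>k. C k t *\<^sub>R na_eval (N k) h) has_sum G t h) UNIV"
    if h: "norm h < \<rho>" for t h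
  proof -
    have "(\<lambda>k. C k t *\<^sub>R na_eval (N k) h) summable_on UNIV"
    proof (rule summable_on_if_norm_sum_le[where B="B' t"])
      fix F :: "(nat \<times> nat) set" assume F: "finite F"
      have "(\<Sum>k\<in>F. norm (C k t *\<^sub>R na_eval (N k) h)) \<le> (\<Sum>k\<in>F. \<bar>C k t\<bar> * b k)"
        by (intro sum_mono) (simp add: mult_left_mono order_trans[OF norm_le_cd_wnorm bN[OF h]])
      with bd[OF F] show "(\<Sum>k\<in>F. norm (C k t *\<^sub>R na_eval (N k) h)) \<le> B' t"
        by (rule order_trans[rotated])
    qed
    then obtain S where S: "((\<lambda>k. C k t *\<^sub>R na_eval (N k) h) has_sum S) UNIV"
      by (auto simp: summable_on_def)
    have "((\<lambda>i. g i t h) has_sum S) UNIV"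
    proof (rule has_sum_SigmaD)
      show "((\<lambda>k. C k t *\<^sub>R na_eval (N k) h) has_sum S) (UNIV \<times> UNIV)"
        using S by simp
      show "((\<lambda>j. C (i, j) t *\<^sub>R na_eval (N (i, j)) h) has_sum g i t h) UNIV" for i
        using s[OF h] by (simp add: C_def N_def)
    qed
    with S G[OF h, of t] show ?thesis using has_sum_unique by blast
  qed
  show ?thesis
  proof (rule expandsI)
    show "C (prod_decode k) \<in> borel_measurable M" for k by simp
    show "0 \<le> b (prod_decode k)" for k by (rule b0)
    show "cd_wnorm (na_eval (N (prod_decode k)) h) \<le> b (prod_decode k)" if "norm h < \<rho>" for k h
      using that by (rule bN)
    show "(\<Sum>k\<in>F. \<bar>C (prod_decode k) t\<bar> * b (prod_decode k)) \<le> B' t" if "finite F" for F t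
      using bd[of "prod_decode ` F" t] that by (simp add: sum.reindex inj_prod_decode)
    show "((\<lambda>k. C (prod_decode k) t *\<^sub>R na_eval (N (prod_decode k)) h) has_sum G t h) UNIV"
      if "norm h < \<rho>" for t h
      by (subst has_sum_reindex_bij_betw[OF bij_prod_decode]) (rule sum[OF that])
  qed
qed

lemma expands_zero: "expands M \<rho> (\<lambda>t h. 0 :: 'r::finite cd) (\<lambda>t. 0)"
  using expands_const[of M \<rho> "0 :: 'r cd"] by (simp add: cd_wnorm_def)

lemma expands_add:
  assumes "expands M \<rho> g B" "expands M \<rho> g' B'"
  shows "expands M \<rho> (\<lambda>t h. g t h + g' t h) (\<lambda>t. B t + B' t)"
proof (rule expands_infsum)
  let ?g = "\<lambda>i::nat. if i = 0 then g else if i = 1 then g' else (\<lambda>t h. 0)"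
  let ?B = "\<lambda>i::nat. if i = 0 then B else if i = 1 then B' else (\<lambda>t. 0)"
  show e: "expands M \<rho> (?g i) (?B i)" for i
    using assms expands_zero by auto
  show "(\<Sum>i\<in>F. ?B i t) \<le> B t + B' t" if "finite F" for F t
  proof -
    have "(\<Sum>i\<in>F. ?B i t) \<le> (\<Sum>i\<in>F \<union> {0, 1}. ?B i t)"
      using that expands_nonneg[OF e] by (intro sum_mono2) auto
    also have "\<dots> = (\<Sum>i\<in>{0, 1}. ?B i t)"
      using that by (intro sum.mono_neutral_right) auto
    finally show ?thesis by simp
  qed
  show "((\<lambda>i. ?g i t h) has_sum g t h + g' t h) UNIV" for t h
  proof -
    have "((\<lambda>i. ?g i t h) has_sum (\<Sum>i\<in>{0, 1}. ?g i t h)) {0, 1}"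
      by (rule has_sum_finite) simp
    then show ?thesis
      by (subst has_sum_cong_neutral[where T="{0, 1}"]) auto
  qed
qed

lemma expands_sum:
  assumes "\<And>i. i \<in> I \<Longrightarrow> expands M \<rho> (g i) (B i)"
  shows "expands M \<rho> (\<lambda>t h. \<Sum>i\<in>I. g i t h) (\<lambda>t. \<Sum>i\<in>I. B i t)"
  using assms by (induction I rule: infinite_finite_induct) (auto intro: expands_zero expands_add)

text \<open>The factor \<open>cd_wnorm 1\<close> stems from the empty product and stays a single
  factor for every exponent. Hence power series keep their domination by powers of
  \<open>B t\<close>, with no constant raised to the power \<open>k\<close>.\<close>

lemma expands_power:
  fixes g :: "'t \<Rightarrow> 'r::finite cd \<Rightarrow> 'r cd"
  assumes "expands M \<rho> g B"
  shows "expands M \<rho> (\<lambda>t h. g t h ^ k) (\<lambda>t. cd_wnorm (1 :: 'r cd) * B t ^ k)"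
proof (induction k)
  case 0
  show ?case using expands_const[of M \<rho> "1 :: 'r cd"] by simp
next
  case (Suc k)
  show ?case
    using expands_mult[OF assms Suc.IH] by (simp add: mult_ac)
qed

lemma expands_power_series:
  fixes g :: "'t \<Rightarrow> 'r::finite cd \<Rightarrow> 'r cd"
  assumes "expands M \<rho> g B"
    and "\<And>k. a k \<in> borel_measurable M"
    and "\<And>t F. finite F \<Longrightarrow> (\<Sum>k\<in>F. \<bar>a k t\<bar> * B t ^ k) \<le> B' t"
    and "\<And>t h. norm h < \<rho> \<Longrightarrow> ((\<lambda>k. a k t *\<^sub>R g t h ^ k) has_sum G t h) UNIV"
  shows "expands M \<rho> G (\<lambda>t. cd_wnorm (1 :: 'r cd) * B' t)"
proof (rule expands_infsum)
  show "expands M \<rho> (\<lambda>t h. a k t *\<^sub>R g t h ^ k) (\<lambda>t. \<bar>a k t\<bar> * (cd_wnorm (1 :: 'r cd) * B t ^ k))"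
    for k by (intro expands_scale expands_power assms)
  show "(\<Sum>k\<in>F. \<bar>a k t\<bar> * (cd_wnorm (1 :: 'r cd) * B t ^ k)) \<le> cd_wnorm (1 :: 'r cd) * B' t"
    if "finite F" for F t
    using mult_left_mono[OF assms(3)[OF that], of "cd_wnorm (1 :: 'r cd)" t]
    by (simp add: sum_distrib_left mult_ac)
  show "((\<lambda>k. a k t *\<^sub>R g t h ^ k) has_sum G t h) UNIV" if "norm h < \<rho>" for t h
    using that by (rule assms)
qed

text \<open>Integrability is recorded separately because the integral of a nonintegrable function is
  0 by convention, so the series identity alone would not show that the integral exists.\<close>

definition integral_expands :: "'t measure \<Rightarrow> real \<Rightarrow> ('t \<Rightarrow> 'r::finite cd \<Rightarrow> 'r cd) \<Rightarrow> bool"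
  where "integral_expands M \<rho> g \<longleftrightarrow> (\<forall>h. norm h < \<rho> \<longrightarrow> integrable M (\<lambda>t. g t h)) \<and>
    (\<exists>m b. summable b \<and> (\<forall>h. norm h < \<rho> \<longrightarrow>
      (\<forall>k. norm (na_eval (m k) h) \<le> b k) \<and> (\<lambda>k. na_eval (m k) h) sums (LINT t|M. g t h)))"

text \<open>Integrating the finite sums of |c| times \<beta> against the dominating \<open>W\<close>
  shows that the integrated majorants are summable; the same majorants justify exchanging sum and
  integral for each increment.\<close>

lemma integral_expandsI:
  assumes "expands M \<rho> g B" and W: "integrable M W" "\<And>t. B t \<le> W t"
  shows "integral_expands M \<rho> g"
proof (rule expandsE[OF assms(1)])
  fix c :: "nat \<Rightarrow> 'a \<Rightarrow> real" and \<beta> m assume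
    [measurable]: "\<And>k. c k \<in> borel_measurable M" and \<beta>: "\<And>k. 0 \<le> \<beta> k"
    "\<And>k h. norm h < \<rho> \<Longrightarrow> cd_wnorm (na_eval (m k) h) \<le> \<beta> k"
    and B: "\<And>t F. finite F \<Longrightarrow> (\<Sum>k\<in>F. \<bar>c k t\<bar> * \<beta> k) \<le> B t"
    and s: "\<And>t h. norm h < \<rho> \<Longrightarrow> ((\<lambda>k. c k t *\<^sub>R na_eval (m k) h) has_sum g t h) UNIV"
  have int1: "integrable M (\<lambda>t. \<bar>c k t\<bar> * \<beta> k)" for k
  proof (rule Bochner_Integration.integrable_bound[OF W(1)])
    show "AE t in M. norm (\<bar>c k t\<bar> * \<beta> k) \<le> norm (W t)"
    proof (rule AE_I2)
      fix t show "norm (\<bar>c k t\<bar> * \<beta> k) \<le> norm (W t)"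
        using B[of "{k}" t] W(2)[of t] \<beta>(1)[of k] by (simp add: abs_mult)
    qed
  qed simp
  define b where "b k = (LINT t|M. \<bar>c k t\<bar> * \<beta> k)" for k
  have b0: "0 \<le> b k" for k
    using \<beta>(1) by (simp add: b_def integral_nonneg_AE)
  have b: "summable b"
  proof (rule bounded_imp_summable)
    show "0 \<le> b k" for k by (rule b0)
    show "(\<Sum>k\<le>n. b k) \<le> (LINT t|M. W t)" for n
    proof -
      have "(\<Sum>k\<le>n. b k) = (LINT t|M. (\<Sum>k\<le>n. \<bar>c k t\<bar> * \<beta> k))"
        unfolding b_def by (rule Bochner_Integration.integral_sum[symmetric]) (rule int1)
      also have "\<dots> \<le> (LINT t|M. W t)"
        using order_trans[OF B W(2)]
        by (intro integral_mono Bochner_Integration.integrable_sum int1 W(1)) auto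
      finally show ?thesis .
    qed
  qed
  \<comment> \<open>Monomials carry no scalars, so the integrated coefficient enters as a constant
    of the algebra, namely a real multiple of 1.\<close>
  define n where "n k = Times (Coeff ((LINT t|M. c k t) *\<^sub>R 1)) (m k)" for k
  have n: "na_eval (n k) h = (LINT t|M. c k t) *\<^sub>R na_eval (m k) h" for k h
    by (simp add: n_def cd_scaleR)
  have nb: "norm (na_eval (n k) h) \<le> b k" if "norm h < \<rho>" for k h
  proof -
    have "norm (na_eval (n k) h) \<le> \<bar>LINT t|M. c k t\<bar> * \<beta> k"
      using order_trans[OF norm_le_cd_wnorm \<beta>(2)[OF that]] unfolding n
      by (simp add: mult_left_mono)
    also have "\<dots> \<le> (LINT t|M. \<bar>c k t\<bar>) * \<beta> k"
      by (intro mult_right_mono \<beta> integral_abs_bound)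
    finally show ?thesis by (simp add: b_def)
  qed
  have *: "integrable M (\<lambda>t. g t h) \<and> (\<lambda>k. na_eval (n k) h) sums (LINT t|M. g t h)"
    if h: "norm h < \<rho>" for h
  proof -
    let ?f = "\<lambda>k t. c k t *\<^sub>R na_eval (m k) h"
    have fb: "norm (?f k t) \<le> \<bar>c k t\<bar> * \<beta> k" for k t
      using order_trans[OF norm_le_cd_wnorm \<beta>(2)[OF h]] by (simp add: mult_left_mono)
    have int: "integrable M (?f k)" for k
      by (rule Bochner_Integration.integrable_bound[OF int1[of k]])
         (use fb \<beta>(1) in \<open>auto simp: abs_mult intro!: AE_I2\<close>)
    have g: "g t h = (\<Sum>k. ?f k t)" for t
      using has_sum_imp_sums[OF s[OF h]] by (simp add: sums_iff)
    have AE: "AE t in M. summable (\<lambda>k. norm (?f k t))"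
    proof (rule AE_I2)
      fix t
      show "summable (\<lambda>k. norm (?f k t))"
      proof (rule summable_comparison_test'[where N=0])
        show "summable (\<lambda>k. \<bar>c k t\<bar> * \<beta> k)"
          using B \<beta>(1) by (intro bounded_imp_summable[where B="B t"]) auto
        show "norm (norm (?f k t)) \<le> \<bar>c k t\<bar> * \<beta> k" for k using fb[of k t] by simp
      qed
    qed
    have sm: "summable (\<lambda>k. LINT t|M. norm (?f k t))"
    proof (rule summable_comparison_test'[OF b, where N=0])
      fix k
      have "(LINT t|M. norm (?f k t)) \<le> b k"
        unfolding b_def by (intro integral_mono integrable_norm int int1 fb)
      then show "norm (LINT t|M. norm (?f k t)) \<le> b k"
        by (simp add: integral_nonneg_AE)
    qed
    \<comment> \<open>Only the product of |c| and \<beta> is known to be integrable. If \<beta> is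
      0, the coefficient itself may fail to be, and its integral has the default value 0; but then
      the monomial vanishes and both sides are 0.\<close>
    have "na_eval (n k) h = integral\<^sup>L M (?f k)" for k
    proof (cases "na_eval (m k) h = 0")
      case False
      then have "\<beta> k \<noteq> 0"
        using order_trans[OF norm_le_cd_wnorm \<beta>(2)[OF h, of k]] by auto
      then have "integrable M (\<lambda>t. \<bar>c k t\<bar>)" using int1[of k] by simp
      then have "integrable M (c k)" by (simp add: integrable_abs_iff)
      then show ?thesis by (simp add: n)
    qed (simp add: n)
    with integrable_suminf[OF int AE sm] sums_integral[OF int AE sm]
    show ?thesis by (simp add: g)
  qed
  show ?thesis
    unfolding integral_expands_def using b nb * by blast
qed

lemma expands_norm_le:
  assumes "expands M \<rho> g B" "norm h < \<rho>"
  shows "norm (g t h) \<le> B t"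
proof (rule expandsE[OF assms(1)])
  fix c :: "nat \<Rightarrow> 'a \<Rightarrow> real" and \<beta> m assume
    \<beta>: "\<And>k h. norm h < \<rho> \<Longrightarrow> cd_wnorm (na_eval (m k) h) \<le> \<beta> k"
    and B: "\<And>t F. finite F \<Longrightarrow> (\<Sum>k\<in>F. \<bar>c k t\<bar> * \<beta> k) \<le> B t"
    and s: "\<And>t h. norm h < \<rho> \<Longrightarrow> ((\<lambda>k. c k t *\<^sub>R na_eval (m k) h) has_sum g t h) UNIV"
  have "(\<lambda>n. \<Sum>k<n. c k t *\<^sub>R na_eval (m k) h) \<longlonglongrightarrow> g t h"
    using has_sum_imp_sums[OF s[OF assms(2)]] by (simp add: sums_def)
  then show ?thesis
  proof (rule Lim_bounded[OF tendsto_norm, where M=0], intro allI impI)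
    fix n
    have "norm (\<Sum>k<n. c k t *\<^sub>R na_eval (m k) h) \<le> (\<Sum>k<n. \<bar>c k t\<bar> * \<beta> k)"
      by (intro sum_norm_le)
         (simp add: mult_left_mono order_trans[OF norm_le_cd_wnorm \<beta>[OF assms(2)]])
    also have "\<dots> \<le> B t" by (rule B) simp
    finally show "norm (\<Sum>k<n. c k t *\<^sub>R na_eval (m k) h) \<le> B t" .
  qed
qed

section \<open>Conjugation and real coordinates of an expansion\<close>

lemma cd_wnorm_minus [simp]: "cd_wnorm (- x) = cd_wnorm x" for x :: "'r::finite cd"
  by (simp add: cd_wnorm_def)

lemma cd_wnorm_1: "cd_wnorm (1 :: 'r::finite cd) = cd_mult_const TYPE('r)"
  by (simp add: cd_wnorm_def)

lemma cd_wnorm_i: "j < 2 ^ CARD('r) \<Longrightarrow> cd_wnorm (cd_i j :: 'r::finite cd) = cd_mult_const TYPE('r)"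
  by (simp add: cd_wnorm_def cd_norm_i)

text \<open>Divides \<open>cd_cnj_eq_sum\<close> by 2^r - 2, which is at least 2 here and is
  estimated away. Each of the fewer than 2^r conjugations by basis elements costs K^2, with K the
  multiplication constant, and the subtracted term costs 1.\<close>

lemma expands_cnj:
  fixes g :: "'t \<Rightarrow> 'r::finite cd \<Rightarrow> 'r cd"
  assumes "2 \<le> CARD('r)" "expands M \<rho> g B"
  shows "expands M \<rho> (\<lambda>t h. cd_cnj (g t h))
    (\<lambda>t. (1 + 2 ^ CARD('r) * (cd_mult_const TYPE('r))\<^sup>2) * B t)"
proof -
  let ?K = "cd_mult_const TYPE('r)" and ?N = "2 ^ CARD('r) :: nat"
  have N: "(4::nat) \<le> ?N"
    using power_increasing[OF assms(1), of "2::nat"] by simp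
  then have N': "(4::real) \<le> 2 ^ CARD('r)"
    by (metis of_nat_le_iff of_nat_numeral of_nat_power)
  have S1: "expands M \<rho>
      (\<lambda>t h. \<Sum>k\<in>{1..<?N}. cd_i k * (g t h * cd_cnj (cd_i k)))
      (\<lambda>t. \<Sum>k\<in>{1..<?N}. cd_wnorm (cd_i k :: 'r cd) * (B t * cd_wnorm (cd_cnj (cd_i k) :: 'r cd)))"
    by (intro expands_sum expands_mult expands_const assms)
  have S2: "expands M \<rho> (\<lambda>t h. (-1) *\<^sub>R g t h) (\<lambda>t. \<bar>-1\<bar> * B t)"
    by (rule expands_scale[OF _ assms(2)]) simp
  have "expands M \<rho>
      (\<lambda>t h. (1 / (2 ^ CARD('r) - 2)) *\<^sub>R
        ((\<Sum>k\<in>{1..<?N}. cd_i k * (g t h * cd_cnj (cd_i k))) + (-1) *\<^sub>R g t h))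
      (\<lambda>t. \<bar>1 / (2 ^ CARD('r) - 2)\<bar> * ((\<Sum>k\<in>{1..<?N}.
        cd_wnorm (cd_i k :: 'r cd) * (B t * cd_wnorm (cd_cnj (cd_i k) :: 'r cd))) + \<bar>-1\<bar> * B t))"
    by (rule expands_scale[OF _ expands_add[OF S1 S2]]) simp
  also have "(\<lambda>t h. (1 / (2 ^ CARD('r) - 2)) *\<^sub>R
        ((\<Sum>k\<in>{1..<?N}. cd_i k * (g t h * cd_cnj (cd_i k))) + (-1) *\<^sub>R g t h))
      = (\<lambda>t h. cd_cnj (g t h))"
  proof (intro ext)
    fix t h
    have "(\<Sum>k\<in>{1..<?N}. cd_i k * (g t h * cd_cnj (cd_i k))) + (-1) *\<^sub>R g t h
        = (2 ^ CARD('r) - 2) *\<^sub>R cd_cnj (g t h)"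
      using cd_cnj_eq_sum[of "g t h"] by simp
    then show "(1 / (2 ^ CARD('r) - 2)) *\<^sub>R
        ((\<Sum>k\<in>{1..<?N}. cd_i k * (g t h * cd_cnj (cd_i k))) + (-1) *\<^sub>R g t h) = cd_cnj (g t h)"
      using N' by simp
  qed
  finally show ?thesis
  proof (rule expands_mono)
    fix t
    have B: "0 \<le> B t" using assms(2) by (rule expands_nonneg)
    have "(\<Sum>k\<in>{1..<?N}. cd_wnorm (cd_i k :: 'r cd) * (B t * cd_wnorm (cd_cnj (cd_i k) :: 'r cd)))
        = (\<Sum>k\<in>{1..<?N}. ?K\<^sup>2 * B t)"
      by (intro sum.cong)
         (auto simp: cd_cnj_i cd_wnorm_scaleR cd_wnorm_i cd_sign_def power2_eq_square)
    also have "\<dots> \<le> 2 ^ CARD('r) * ?K\<^sup>2 * B t"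
      using B N by (simp add: of_nat_diff algebra_simps)
    finally have S: "(\<Sum>k\<in>{1..<?N}.
        cd_wnorm (cd_i k :: 'r cd) * (B t * cd_wnorm (cd_cnj (cd_i k) :: 'r cd))) + \<bar>-1\<bar> * B t
        \<le> (1 + 2 ^ CARD('r) * ?K\<^sup>2) * B t"
      by (simp add: algebra_simps)
    have "\<bar>1 / (2 ^ CARD('r) - 2 :: real)\<bar> \<le> 1"
      using N' by (simp add: field_simps)
    then have "\<bar>1 / (2 ^ CARD('r) - 2 :: real)\<bar> * ((\<Sum>k\<in>{1..<?N}.
        cd_wnorm (cd_i k :: 'r cd) * (B t * cd_wnorm (cd_cnj (cd_i k) :: 'r cd))) + \<bar>-1\<bar> * B t)
        \<le> 1 * ((1 + 2 ^ CARD('r) * ?K\<^sup>2) * B t)"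
      using B by (intro mult_mono S) (auto intro!: add_nonneg_nonneg sum_nonneg)
    then show "\<bar>1 / (2 ^ CARD('r) - 2 :: real)\<bar> * ((\<Sum>k\<in>{1..<?N}.
        cd_wnorm (cd_i k :: 'r cd) * (B t * cd_wnorm (cd_cnj (cd_i k) :: 'r cd))) + \<bar>-1\<bar> * B t)
        \<le> (1 + 2 ^ CARD('r) * ?K\<^sup>2) * B t" by simp
  qed
qed

text \<open>The cost of reading off a coordinate: one multiplication constant for the factor conj
  i_j, and the factor of \<open>expands_cnj\<close> for the conjugation in the real part.\<close>

definition cd_coord_const :: "'r::finite itself \<Rightarrow> real"
  where "cd_coord_const _ =
    cd_mult_const TYPE('r) * (1 + 2 ^ CARD('r) * (cd_mult_const TYPE('r))\<^sup>2)"

lemma cd_coord_const_nonneg: "0 \<le> cd_coord_const TYPE('r::finite)"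
  using cd_mult_const(1)[where 'r='r] by (simp add: cd_coord_const_def)

text \<open>
  For \<open>r \<ge> 2\<close> conjugation is a sum of monomials, hence so are the real part and, since
  \<open>h_j = Re (h i_j\<^sup>*)\<close>, all real coordinates.
\<close>

lemma expands_coord:
  fixes g :: "'t \<Rightarrow> 'r::finite cd \<Rightarrow> 'r cd"
  assumes "2 \<le> CARD('r)" "j < 2 ^ CARD('r)" "expands M \<rho> g B"
  shows "expands M \<rho> (\<lambda>t h. cd_coord (g t h) j *\<^sub>R 1) (\<lambda>t. cd_coord_const TYPE('r) * B t)"
proof -
  let ?K = "cd_mult_const TYPE('r)" and ?C = "1 + 2 ^ CARD('r) * (cd_mult_const TYPE('r))\<^sup>2"
  let ?w = "cd_cnj (cd_i j) :: 'r cd"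
  have w: "cd_wnorm ?w = ?K"
    using assms(2) by (simp add: cd_cnj_i cd_wnorm_scaleR cd_wnorm_i cd_sign_def)
  have 1: "expands M \<rho> (\<lambda>t h. g t h * ?w) (\<lambda>t. B t * cd_wnorm ?w)"
    by (intro expands_mult expands_const assms)
  have "expands M \<rho> (\<lambda>t h. (1/2) *\<^sub>R (g t h * ?w + cd_cnj (g t h * ?w)))
      (\<lambda>t. \<bar>1/2\<bar> * (B t * cd_wnorm ?w + ?C * (B t * cd_wnorm ?w)))"
    by (intro expands_scale expands_add expands_cnj 1 assms) auto
  also have "(\<lambda>t h. (1/2) *\<^sub>R (g t h * ?w + cd_cnj (g t h * ?w))) = (\<lambda>t h. cd_coord (g t h) j *\<^sub>R 1)"
    by (simp add: fun_eq_iff cd_coord_eq_Re[OF assms(2)] cd_Re_eq)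
  finally show ?thesis
  proof (rule expands_mono)
    fix t
    have "0 \<le> B t" using assms(3) by (rule expands_nonneg)
    then have "0 \<le> (2 ^ CARD('r) * ?K\<^sup>2) * (?K * B t)"
      using cd_mult_const(1)[where 'r='r] by simp
    then show "\<bar>1/2\<bar> * (B t * cd_wnorm ?w + ?C * (B t * cd_wnorm ?w)) \<le> cd_coord_const TYPE('r) * B t"
      unfolding w cd_coord_const_def by (simp add: algebra_simps)
  qed
qed

section \<open>Real-valued functions, represented as multiples of 1\<close>

lemma scaleR_one_mult: "(x *\<^sub>R 1) * (y *\<^sub>R (1 :: 'r::finite cd)) = (x * y) *\<^sub>R 1"
  by (simp add: cd_scaleR)

lemma scaleR_one_power: "(x *\<^sub>R (1 :: 'r::finite cd)) ^ k = (x ^ k) *\<^sub>R 1"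
  by (induction k) (simp_all add: scaleR_one_mult)

lemma expands_real_power_series:
  fixes g G :: "'t \<Rightarrow> 'r::finite cd \<Rightarrow> real"
  assumes "expands M \<rho> (\<lambda>t h. g t h *\<^sub>R (1 :: 'r cd)) B"
    and "\<And>k. a k \<in> borel_measurable M"
    and "\<And>t F. finite F \<Longrightarrow> (\<Sum>k\<in>F. \<bar>a k t\<bar> * B t ^ k) \<le> B' t"
    and "\<And>t h. norm h < \<rho> \<Longrightarrow> ((\<lambda>k. a k t * g t h ^ k) has_sum G t h) UNIV"
  shows "expands M \<rho> (\<lambda>t h. G t h *\<^sub>R (1 :: 'r cd)) (\<lambda>t. cd_mult_const TYPE('r) * B' t)"
  using expands_power_series[OF assms(1-3), of "\<lambda>t h. G t h *\<^sub>R 1"]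
    has_sum_bounded_linear[OF bounded_linear_scaleR_left[of "1 :: 'r cd"] assms(4)]
  by (simp add: cd_wnorm_1 scaleR_one_power)

lemma sum_pow_fact_le_exp:
  assumes "finite F" "0 \<le> x"
  shows "(\<Sum>k\<in>F. x ^ k / fact k) \<le> exp (x::real)"
  using assms exp_converges[of x]
  by (intro order_trans[OF sum_le_suminf]) (auto simp: sums_iff divide_inverse mult.commute)

text \<open>Serves the exponential, cosine and sine at once: the coefficients are dominated by those
  of the exponential series, whence the bound exp (B t).\<close>

lemma expands_entire_real:
  fixes g :: "'t \<Rightarrow> 'r::finite cd \<Rightarrow> real"
  assumes "expands M \<rho> (\<lambda>t h. g t h *\<^sub>R (1 :: 'r cd)) B"
    and "\<And>k. \<bar>a k\<bar> \<le> 1 / fact k" and "\<And>x::real. (\<lambda>k. a k * x ^ k) sums f x"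
  shows "expands M \<rho> (\<lambda>t h. f (g t h) *\<^sub>R (1 :: 'r cd)) (\<lambda>t. cd_mult_const TYPE('r) * exp (B t))"
proof (rule expands_real_power_series[OF assms(1), where a="\<lambda>k t. a k"])
  note B = expands_nonneg[OF assms(1)]
  show "(\<Sum>k\<in>F. \<bar>a k\<bar> * B t ^ k) \<le> exp (B t)" if "finite F" for F t
  proof -
    have "(\<Sum>k\<in>F. \<bar>a k\<bar> * B t ^ k) \<le> (\<Sum>k\<in>F. 1 / fact k * B t ^ k)"
      using B by (intro sum_mono mult_right_mono assms) auto
    also have "\<dots> \<le> exp (B t)" using sum_pow_fact_le_exp[OF that B] by simp
    finally show ?thesis .
  qed
  show "((\<lambda>k. a k * g t h ^ k) has_sum f (g t h)) UNIV" for t h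
  proof (rule norm_summable_imp_has_sum[OF _ assms(3)])
    have "summable (\<lambda>k. 1 / fact k * \<bar>g t h\<bar> ^ k)"
      using summable_exp[of "\<bar>g t h\<bar>"] by (simp add: divide_inverse)
    then show "summable (\<lambda>k. norm (a k * g t h ^ k))"
      by (rule summable_comparison_test'[where N=0])
         (simp add: abs_mult power_abs mult_right_mono assms(2) del: times_divide_eq_left)
  qed
qed simp

lemma expands_exp:
  fixes g :: "'t \<Rightarrow> 'r::finite cd \<Rightarrow> real"
  assumes "expands M \<rho> (\<lambda>t h. g t h *\<^sub>R (1 :: 'r cd)) B"
  shows "expands M \<rho> (\<lambda>t h. exp (g t h) *\<^sub>R (1 :: 'r cd)) (\<lambda>t. cd_mult_const TYPE('r) * exp (B t))"
  using exp_converges[where 'a=real]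
  by (intro expands_entire_real[OF assms, where a="\<lambda>k. 1 / fact k"]) (auto simp: divide_inverse)

text \<open>The base angle \<phi> is split off by the addition theorems and survives only in
  coefficients of absolute value at most 1. Expanding the whole argument would cost exp |\<phi>|,
  which the decay available after multiplication by the original need not compensate.\<close>

lemma expands_cos_sin:
  fixes g :: "'t \<Rightarrow> 'r::finite cd \<Rightarrow> real"
  assumes "expands M \<rho> (\<lambda>t h. g t h *\<^sub>R (1 :: 'r cd)) B" and [measurable]: "\<phi> \<in> borel_measurable M"
  shows "expands M \<rho> (\<lambda>t h. cos (\<phi> t + g t h) *\<^sub>R (1 :: 'r cd))
      (\<lambda>t. 2 * cd_mult_const TYPE('r) * exp (B t))" (is ?cos)
    and "expands M \<rho> (\<lambda>t h. sin (\<phi> t + g t h) *\<^sub>R (1 :: 'r cd))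
      (\<lambda>t. 2 * cd_mult_const TYPE('r) * exp (B t))" (is ?sin)
proof -
  let ?K = "cd_mult_const TYPE('r)"
  have c: "expands M \<rho> (\<lambda>t h. cos (g t h) *\<^sub>R (1 :: 'r cd)) (\<lambda>t. ?K * exp (B t))"
    using cos_converges[where 'a=real]
    by (intro expands_entire_real[OF assms(1), where a=cos_coeff]) (auto simp: cos_coeff_def)
  have s: "expands M \<rho> (\<lambda>t h. sin (g t h) *\<^sub>R (1 :: 'r cd)) (\<lambda>t. ?K * exp (B t))"
    using sin_converges[where 'a=real]
    by (intro expands_entire_real[OF assms(1), where a=sin_coeff]) (auto simp: sin_coeff_def)
  have le: "\<bar>a\<bar> * (?K * exp (B t)) + \<bar>b\<bar> * (?K * exp (B t)) \<le> 2 * ?K * exp (B t)"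
    if "\<bar>a\<bar> \<le> 1" "\<bar>b\<bar> \<le> 1" for a b t
  proof -
    have "(\<bar>a\<bar> + \<bar>b\<bar>) * (?K * exp (B t)) \<le> 2 * (?K * exp (B t))"
      using that cd_mult_const(1)[where 'r='r] by (intro mult_right_mono) auto
    then show ?thesis by (simp add: algebra_simps)
  qed
  have "expands M \<rho> (\<lambda>t h. cos (\<phi> t) *\<^sub>R (cos (g t h) *\<^sub>R (1 :: 'r cd))
        + (- sin (\<phi> t)) *\<^sub>R (sin (g t h) *\<^sub>R 1))
      (\<lambda>t. \<bar>cos (\<phi> t)\<bar> * (?K * exp (B t)) + \<bar>- sin (\<phi> t)\<bar> * (?K * exp (B t)))"
    by (intro expands_add expands_scale c s) measurable
  also have "(\<lambda>t h. cos (\<phi> t) *\<^sub>R (cos (g t h) *\<^sub>R (1 :: 'r cd))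
        + (- sin (\<phi> t)) *\<^sub>R (sin (g t h) *\<^sub>R 1)) = (\<lambda>t h. cos (\<phi> t + g t h) *\<^sub>R (1 :: 'r cd))"
    by (simp add: cos_add scaleR_diff_left)
  finally show ?cos by (rule expands_mono) (intro le, auto)
  have "expands M \<rho> (\<lambda>t h. sin (\<phi> t) *\<^sub>R (cos (g t h) *\<^sub>R (1 :: 'r cd))
        + cos (\<phi> t) *\<^sub>R (sin (g t h) *\<^sub>R 1))
      (\<lambda>t. \<bar>sin (\<phi> t)\<bar> * (?K * exp (B t)) + \<bar>cos (\<phi> t)\<bar> * (?K * exp (B t)))"
    by (intro expands_add expands_scale c s) measurable
  also have "(\<lambda>t h. sin (\<phi> t) *\<^sub>R (cos (g t h) *\<^sub>R (1 :: 'r cd))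
        + cos (\<phi> t) *\<^sub>R (sin (g t h) *\<^sub>R 1)) = (\<lambda>t h. sin (\<phi> t + g t h) *\<^sub>R (1 :: 'r cd))"
    by (simp add: sin_add scaleR_add_left)
  finally show ?sin by (rule expands_mono) (intro le, auto)
qed

lemma expands_prod:
  fixes g :: "'i \<Rightarrow> 't \<Rightarrow> 'r::finite cd \<Rightarrow> real"
  assumes "\<And>i. i \<in> I \<Longrightarrow> expands M \<rho> (\<lambda>t h. g i t h *\<^sub>R (1 :: 'r cd)) (B i)"
  shows "expands M \<rho> (\<lambda>t h. (\<Prod>i\<in>I. g i t h) *\<^sub>R (1 :: 'r cd))
    (\<lambda>t. cd_mult_const TYPE('r) * (\<Prod>i\<in>I. B i t))"
  using assms
proof (induction I rule: infinite_finite_induct)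
  case (insert i I)
  then have "expands M \<rho> (\<lambda>t h. (g i t h *\<^sub>R (1 :: 'r cd)) * ((\<Prod>i\<in>I. g i t h) *\<^sub>R 1))
    (\<lambda>t. B i t * (cd_mult_const TYPE('r) * (\<Prod>i\<in>I. B i t)))"
    by (intro expands_mult) auto
  then show ?case using insert.hyps by (simp add: scaleR_one_mult mult_ac)
qed (use expands_const[of M \<rho> "1 :: 'r cd"] in \<open>simp_all add: cd_wnorm_1\<close>)

section \<open>Cosine and cardinal sine of a square root\<close>

lemma norm_cos_sin_le:
  "norm (cos z) \<le> exp \<bar>Im z\<bar>" "norm (sin z) \<le> exp \<bar>Im z\<bar>" for z :: complex
proof -
  have "norm (exp (\<i> * z)) + norm (exp (- (\<i> * z))) \<le> exp \<bar>Im z\<bar> + exp \<bar>Im z\<bar>"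
    by (intro add_mono) (auto simp: norm_exp_eq_Re)
  from norm_triangle_le[OF this] norm_triangle_le_diff[OF this]
  have "norm (exp (\<i> * z) + exp (- (\<i> * z))) \<le> 2 * exp \<bar>Im z\<bar>"
    "norm (exp (\<i> * z) - exp (- (\<i> * z))) \<le> 2 * exp \<bar>Im z\<bar>"
    unfolding mult_2 .
  then show "norm (cos z) \<le> exp \<bar>Im z\<bar>" "norm (sin z) \<le> exp \<bar>Im z\<bar>"
    by (simp_all add: cos_exp_eq sin_exp_eq norm_divide norm_mult)
qed

text \<open>Given by its power series instead of a branch of the square root, so that it is entire;
  the same holds for \<open>sinc_sqrt\<close> below.\<close>

definition cos_sqrt :: "complex \<Rightarrow> complex"
  where "cos_sqrt z = (\<Sum>n. (-1) ^ n / fact (2 * n) * z ^ n)"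

definition sinc_sqrt :: "complex \<Rightarrow> complex"
  where "sinc_sqrt z = (\<Sum>n. (-1) ^ n / fact (2 * n + 1) * z ^ n)"

lemma norm_summable_sqrt_series:
  fixes z :: complex and m :: "nat \<Rightarrow> nat"
  assumes "\<And>n. n \<le> m n"
  shows "summable (\<lambda>n. norm ((-1) ^ n / fact (m n) * z ^ n))"
proof (rule summable_comparison_test'[OF summable_exp[of "norm z"], where N=0])
  fix n
  have "inverse (fact (m n)) \<le> (inverse (fact n) :: real)"
    by (intro le_imp_inverse_le fact_mono assms) auto
  from mult_right_mono[OF this, of "norm z ^ n"]
  have "inverse (fact (m n)) * norm z ^ n \<le> inverse (fact n) * norm z ^ n" by simp
  moreover have "norm (norm ((-1) ^ n / fact (m n) * z ^ n)) = inverse (fact (m n)) * norm z ^ n"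
    by (simp add: norm_mult norm_divide norm_power divide_inverse norm_inverse)
  ultimately show "norm (norm ((-1) ^ n / fact (m n) * z ^ n)) \<le> inverse (fact n) * norm z ^ n"
    by (simp only:)
qed

lemma cos_sqrt_sums: "(\<lambda>n. (-1) ^ n / fact (2 * n) * z ^ n) sums cos_sqrt z"
  unfolding cos_sqrt_def
  by (intro summable_sums summable_norm_cancel[OF norm_summable_sqrt_series]) auto

lemma sinc_sqrt_sums: "(\<lambda>n. (-1) ^ n / fact (2 * n + 1) * z ^ n) sums sinc_sqrt z"
  unfolding sinc_sqrt_def
  by (intro summable_sums summable_norm_cancel[OF norm_summable_sqrt_series]) auto

lemma holomorphic_cos_sqrt: "cos_sqrt holomorphic_on S" "sinc_sqrt holomorphic_on S"
proof -
  have *: "f holomorphic_on S" if "\<And>z. (\<lambda>n. a n * z ^ n) sums f z" for f and a :: "nat \<Rightarrow> complex"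
  proof -
    have "f holomorphic_on ball 0 (norm z + 1)" for z :: complex
      by (rule power_series_holomorphic[where a=a]) (use that in auto)
    then have "f field_differentiable at z" for z
      using holomorphic_on_imp_differentiable_at[of f "ball 0 (norm z + 1)" z] by simp
    then show ?thesis
      by (simp add: holomorphic_on_def field_differentiable_at_within)
  qed
  show "cos_sqrt holomorphic_on S" by (rule *[OF cos_sqrt_sums])
  show "sinc_sqrt holomorphic_on S" by (rule *[OF sinc_sqrt_sums])
qed

lemma cos_sqrt_square: "cos_sqrt (z\<^sup>2) = cos z"
proof -
  have "(\<lambda>n. cos_coeff (2 * n) *\<^sub>R z ^ (2 * n)) sums cos z"
  proof (rule sums_mono_reindex[THEN iffD2, OF _ _ cos_converges])
    show "strict_mono (\<lambda>n::nat. 2 * n)" by (rule strict_monoI) simp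
    show "cos_coeff n *\<^sub>R z ^ n = 0" if "n \<notin> range (\<lambda>n::nat. 2 * n)" for n
      using that by (auto simp: cos_coeff_def elim!: evenE)
  qed
  moreover have "cos_coeff (2 * n) *\<^sub>R z ^ (2 * n) = (-1) ^ n / fact (2 * n) * (z\<^sup>2) ^ n" for n
    by (simp add: cos_coeff_def scaleR_conv_of_real power_mult)
  ultimately show ?thesis
    using cos_sqrt_sums[of "z\<^sup>2"] sums_unique2 by simp
qed

lemma sinc_sqrt_square: "z * sinc_sqrt (z\<^sup>2) = sin z"
proof -
  have "(\<lambda>n. sin_coeff (2 * n + 1) *\<^sub>R z ^ (2 * n + 1)) sums sin z"
  proof (rule sums_mono_reindex[THEN iffD2, OF _ _ sin_converges])
    show "strict_mono (\<lambda>n::nat. 2 * n + 1)" by (rule strict_monoI) simp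
    show "sin_coeff n *\<^sub>R z ^ n = 0" if "n \<notin> range (\<lambda>n::nat. 2 * n + 1)" for n
      using that by (auto simp: sin_coeff_def elim!: oddE)
  qed
  moreover have "sin_coeff (2 * n + 1) *\<^sub>R z ^ (2 * n + 1)
      = z * ((-1) ^ n / fact (2 * n + 1) * (z\<^sup>2) ^ n)" for n
    by (simp add: sin_coeff_def scaleR_conv_of_real power_mult del: fact_Suc)
  ultimately show ?thesis
    using sums_mult[OF sinc_sqrt_sums[of "z\<^sup>2"], of z] sums_unique2 by simp
qed

lemma norm_cos_sqrt_square_le: "norm (cos_sqrt (z\<^sup>2)) \<le> exp 1 * exp \<bar>Im z\<bar>"
proof -
  have "1 * exp \<bar>Im z\<bar> \<le> exp 1 * exp \<bar>Im z\<bar>" by (intro mult_right_mono) auto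
  with norm_cos_sin_le(1)[of z] show ?thesis unfolding cos_sqrt_square by linarith
qed

text \<open>For |z| <= 1 the series is dominated by that of e; for |z| > 1 the division of sin z by
  z only helps. The bound for \<open>cos_sqrt\<close> carries the same factor \<open>exp 1\<close>
  so that both functions share one constant.\<close>

lemma norm_sinc_sqrt_square_le: "norm (sinc_sqrt (z\<^sup>2)) \<le> exp 1 * exp \<bar>Im z\<bar>"
proof (cases "norm z \<le> 1")
  case True
  have s: "summable (\<lambda>n. norm ((-1) ^ n / fact (2 * n + 1) * (z\<^sup>2) ^ n))"
    by (rule norm_summable_sqrt_series) simp
  have "norm (sinc_sqrt (z\<^sup>2)) \<le> (\<Sum>n. norm ((-1) ^ n / fact (2 * n + 1) * (z\<^sup>2) ^ n))"
    unfolding sinc_sqrt_def by (rule summable_norm[OF s])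
  also have "\<dots> \<le> (\<Sum>n. 1 ^ n /\<^sub>R fact n)"
  proof (rule suminf_le[OF _ s sums_summable[OF exp_converges]])
    fix n
    have "inverse (fact (2 * n + 1)) \<le> (inverse (fact n) :: real)"
      by (intro le_imp_inverse_le fact_mono) auto
    moreover have "norm ((z\<^sup>2) ^ n) \<le> 1"
      using True by (simp add: norm_power power_le_one)
    ultimately have "inverse (fact (2 * n + 1)) * norm ((z\<^sup>2) ^ n) \<le> inverse (fact n) * (1 :: real)"
      by (intro mult_mono) auto
    moreover have "norm ((-1) ^ n / fact (2 * n + 1) * (z\<^sup>2) ^ n)
        = inverse (fact (2 * n + 1)) * norm ((z\<^sup>2) ^ n)"
      by (simp add: norm_mult norm_divide norm_power divide_inverse norm_inverse del: fact_Suc)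
    ultimately show "norm ((-1) ^ n / fact (2 * n + 1) * (z\<^sup>2) ^ n) \<le> 1 ^ n /\<^sub>R fact n"
      by simp
  qed
  also have "\<dots> = exp 1 * 1" using exp_converges[of "1::real"] by (simp add: sums_iff)
  also have "\<dots> \<le> exp 1 * exp \<bar>Im z\<bar>" by (intro mult_left_mono) auto
  finally show ?thesis .
next
  case False
  then have "1 * norm (sinc_sqrt (z\<^sup>2)) \<le> norm z * norm (sinc_sqrt (z\<^sup>2))"
    by (intro mult_right_mono) auto
  also have "\<dots> = norm (sin z)" by (simp flip: sinc_sqrt_square norm_mult)
  also have "\<dots> \<le> 1 * exp \<bar>Im z\<bar>" using norm_cos_sin_le by simp
  also have "\<dots> \<le> exp 1 * exp \<bar>Im z\<bar>" by (intro mult_right_mono) auto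
  finally show ?thesis by simp
qed

text \<open>
  The discs about \<open>v\<^sup>2\<close> below lie in the image under squaring of the strip \<open>\<bar>Im z\<bar> \<le> \<delta>\<close>, and their
  radius is of the order of \<open>v\<close>; this is what lets the Taylor series at \<open>v\<^sup>2\<close> absorb increments
  of order \<open>v\<close> of the argument.
\<close>

lemma abs_Im_le_if_square_near:
  assumes "0 \<le> v" "0 < \<delta>" "norm (z\<^sup>2 - (of_real v)\<^sup>2) \<le> \<delta> * max v \<delta>"
  shows "\<bar>Im z\<bar> \<le> \<delta>"
proof (rule ccontr)
  assume *: "\<not> \<bar>Im z\<bar> \<le> \<delta>"
  \<comment> \<open>Of the two roots take the one with nonnegative real part. Then |w + v| is at
    least v and at least |Im w|, while |w - v| exceeds \<delta>; the factorisation of w^2 - v^2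
    gives the contradiction.\<close>
  define w where "w = (if 0 \<le> Re z then z else - z)"
  have w: "0 \<le> Re w" "\<bar>Im w\<bar> = \<bar>Im z\<bar>" "w\<^sup>2 = z\<^sup>2" by (auto simp: w_def)
  have "max v \<delta> \<le> norm (w + of_real v)"
    using * w assms abs_Re_le_cmod[of "w + of_real v"] abs_Im_le_cmod[of "w + of_real v"] by auto
  moreover have "\<delta> < norm (w - of_real v)"
    using * w abs_Im_le_cmod[of "w - of_real v"] by auto
  ultimately have "\<delta> * max v \<delta> < norm (w - of_real v) * norm (w + of_real v)"
    using assms by (intro mult_less_le_imp_less) auto
  also have "\<dots> = norm (w\<^sup>2 - (of_real v)\<^sup>2)"
    by (simp add: algebra_simps power2_eq_square flip: norm_mult)
  finally show False using assms w by simp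
qed

text \<open>Cauchy's inequality on the disc of radius \<delta> max(v, \<delta>): every point of its
  boundary circle is the square of some z with |Im z| <= \<delta>, so \<open>E\<close> is bounded
  there by A exp \<delta>, uniformly in v. The maximum keeps the radius positive when v = 0.\<close>

lemma taylor_coeff_near_square:
  assumes E: "E holomorphic_on UNIV" and A: "\<And>z. norm (E (z\<^sup>2)) \<le> A * exp \<bar>Im z\<bar>" "0 \<le> A"
    and v: "0 \<le> v" and \<delta>: "0 < \<delta>"
  shows "norm ((deriv ^^ k) E (of_real (v\<^sup>2)) / fact k) \<le> A * exp \<delta> / (\<delta> * max v \<delta>) ^ k"
proof -
  have "norm ((deriv ^^ k) E (of_real (v\<^sup>2))) \<le> fact k * (A * exp \<delta>) / (\<delta> * max v \<delta>) ^ k"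
  proof (rule Cauchy_inequality)
    show "E holomorphic_on ball (of_real (v\<^sup>2)) (\<delta> * max v \<delta>)"
      using E holomorphic_on_subset by blast
    show "continuous_on (cball (of_real (v\<^sup>2)) (\<delta> * max v \<delta>)) E"
      using E holomorphic_on_imp_continuous_on holomorphic_on_subset by blast
    show "0 < \<delta> * max v \<delta>" using \<delta> by (auto simp: max_def)
    show "norm (E x) \<le> A * exp \<delta>" if x: "norm (of_real (v\<^sup>2) - x) = \<delta> * max v \<delta>" for x
    proof -
      have "\<bar>Im (csqrt x)\<bar> \<le> \<delta>"
        using x by (intro abs_Im_le_if_square_near[OF v \<delta>]) (simp add: norm_minus_commute)
      then have "A * exp \<bar>Im (csqrt x)\<bar> \<le> A * exp \<delta>" using A(2) by (intro mult_left_mono) auto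
      with A(1)[of "csqrt x"] show ?thesis by simp
    qed
  qed
  then show ?thesis by (simp add: norm_divide divide_le_eq mult_ac)
qed

section \<open>Expansions of the exponentials of the kernels\<close>

lemma expands_cong:
  assumes "expands M \<rho> g B" "\<And>t h. g t h = g' t h" "\<And>t. B t \<le> B' t"
  shows "expands M \<rho> g' B'"
proof -
  have "g = g'" using assms(2) by blast
  with expands_mono[OF assms(1,3)] show ?thesis by simp
qed

text \<open>The increment stays within half the radius of the Cauchy disc, so the Taylor series at
  v^2 is dominated by a geometric series of ratio 1/2, whose sum is the factor 2. The width \<delta>
  may depend on \<open>t\<close>: the strip is widened to fit the increment.\<close>

lemma expands_near_square:
  fixes g :: "'t \<Rightarrow> 'r::finite cd \<Rightarrow> real"
  assumes g: "expands M \<rho> (\<lambda>t h. g t h *\<^sub>R (1 :: 'r cd)) B"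
    and E: "E holomorphic_on UNIV" and A: "\<And>z. norm (E (z\<^sup>2)) \<le> A * exp \<bar>Im z\<bar>" "0 \<le> A"
    and [measurable]: "v \<in> borel_measurable M" and v: "\<And>t. 0 \<le> v t" and \<delta>: "\<And>t. 0 < \<delta> t"
    and B: "\<And>t. B t \<le> \<delta> t * max (v t) (\<delta> t) / 2"
  shows "expands M \<rho> (\<lambda>t h. Re (E (of_real ((v t)\<^sup>2 + g t h))) *\<^sub>R (1 :: 'r cd))
    (\<lambda>t. cd_mult_const TYPE('r) * (2 * (A * exp (\<delta> t))))"
proof (rule expands_real_power_series[OF g])
  let ?a = "\<lambda>k t. Re ((deriv ^^ k) E (of_real ((v t)\<^sup>2)) / fact k)"
  define d where "d t = \<delta> t * max (v t) (\<delta> t)" for t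
  have d: "0 < d t" for t using \<delta>[of t] by (auto simp: d_def max_def)
  have B0: "0 \<le> B t" for t by (rule expands_nonneg[OF g])
  have *: "\<bar>?a k t\<bar> * B t ^ k \<le> A * exp (\<delta> t) * (1/2) ^ k" for k t
  proof -
    have "\<bar>?a k t\<bar> \<le> A * exp (\<delta> t) / d t ^ k"
      using taylor_coeff_near_square[OF E A v \<delta>, of k t t] abs_Re_le_cmod order_trans
      unfolding d_def by blast
    moreover have "B t ^ k \<le> (d t / 2) ^ k"
      using B[of t] B0 by (intro power_mono) (auto simp: d_def)
    ultimately have "\<bar>?a k t\<bar> * B t ^ k \<le> A * exp (\<delta> t) / d t ^ k * (d t / 2) ^ k"
      using A(2) d[of t] B0 by (intro mult_mono) auto
    also have "\<dots> = A * exp (\<delta> t) * (1/2) ^ k"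
      using d[of t] by (simp add: power_divide)
    finally show ?thesis .
  qed
  show "?a k \<in> borel_measurable M" for k
  proof -
    have "(deriv ^^ k) E holomorphic_on UNIV"
      using E by (intro holomorphic_higher_deriv) auto
    then have "continuous_on UNIV ((deriv ^^ k) E)" by (rule holomorphic_on_imp_continuous_on)
    then have "continuous_on UNIV (\<lambda>x::real. (deriv ^^ k) E (of_real x))"
      by (rule continuous_on_compose2) (auto intro: continuous_on_of_real)
    then have "continuous_on UNIV (\<lambda>x::real. Re ((deriv ^^ k) E (of_real x) / fact k))"
      by (intro continuous_on_Re continuous_on_divide continuous_on_const) auto
    from borel_measurable_continuous_onI[OF this] have [measurable]:
      "(\<lambda>x::real. Re ((deriv ^^ k) E (of_real x) / fact k)) \<in> borel_measurable borel" .
    show ?thesis by measurable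
  qed
  show "(\<Sum>k\<in>F. \<bar>?a k t\<bar> * B t ^ k) \<le> 2 * (A * exp (\<delta> t))" if "finite F" for F t
  proof -
    have "(\<Sum>k\<in>F. \<bar>?a k t\<bar> * B t ^ k) \<le> (\<Sum>k\<in>F. A * exp (\<delta> t) * (1/2) ^ k)"
      by (intro sum_mono *)
    also have "\<dots> = A * exp (\<delta> t) * (\<Sum>k\<in>F. (1/2) ^ k)" by (simp add: sum_distrib_left)
    also have "\<dots> \<le> A * exp (\<delta> t) * (\<Sum>k. (1/2) ^ k)"
      using A(2) that by (intro mult_left_mono sum_le_suminf) auto
    also have "\<dots> = 2 * (A * exp (\<delta> t))" by (simp add: suminf_geometric)
    finally show ?thesis .
  qed
  show "((\<lambda>k. ?a k t * g t h ^ k) has_sum Re (E (of_real ((v t)\<^sup>2 + g t h)))) UNIV"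
    if h: "norm h < \<rho>" for t h
  proof (rule norm_summable_imp_has_sum)
    have gB: "\<bar>g t h\<bar> \<le> B t" using expands_norm_le[OF g h, of t] by simp
    show "summable (\<lambda>k. norm (?a k t * g t h ^ k))"
    proof (rule summable_comparison_test'[where N=0])
      show "summable (\<lambda>k. A * exp (\<delta> t) * (1/2) ^ k)" by (intro summable_mult) auto
      fix k
      have "\<bar>?a k t\<bar> * \<bar>g t h\<bar> ^ k \<le> \<bar>?a k t\<bar> * B t ^ k"
        using gB by (intro mult_left_mono power_mono) auto
      with *[of k t] show "norm (norm (?a k t * g t h ^ k)) \<le> A * exp (\<delta> t) * (1/2) ^ k"
        by (simp only: real_norm_def abs_mult power_abs abs_abs)
    qed
    have "(\<lambda>k. (deriv ^^ k) E (of_real ((v t)\<^sup>2)) / fact k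
        * (of_real ((v t)\<^sup>2 + g t h) - of_real ((v t)\<^sup>2)) ^ k) sums E (of_real ((v t)\<^sup>2 + g t h))"
    proof (rule holomorphic_power_series)
      show "E holomorphic_on ball (of_real ((v t)\<^sup>2)) (d t)" using E holomorphic_on_subset by blast
      have "\<bar>g t h\<bar> < d t" using gB B[of t] d[of t] by (simp add: d_def)
      then show "of_real ((v t)\<^sup>2 + g t h) \<in> ball (of_real ((v t)\<^sup>2) :: complex) (d t)"
        by (simp add: dist_norm)
    qed
    from sums_Re[OF this] show "(\<lambda>k. ?a k t * g t h ^ k) sums Re (E (of_real ((v t)\<^sup>2 + g t h)))"
    proof (rule sums_cong[THEN iffD1, rotated])
      fix k
      have "(of_real ((v t)\<^sup>2 + g t h) - of_real ((v t)\<^sup>2)) ^ k = (of_real (g t h ^ k) :: complex)"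
        by simp
      moreover have "Re (z * of_real y) = Re z * y" for z y by simp
      ultimately show "Re ((deriv ^^ k) E (of_real ((v t)\<^sup>2)) / fact k
          * (of_real ((v t)\<^sup>2 + g t h) - of_real ((v t)\<^sup>2)) ^ k) = ?a k t * g t h ^ k"
        by (simp only:)
    qed
  qed
qed

text \<open>The kernel as a function of the real arguments x_j = p_j s_j + \<zeta>_j alone. An
  increment of p or of \<zeta> changes them affinely, so one estimate serves both variables.\<close>

definition cd_cartesian :: "(nat \<Rightarrow> real) \<Rightarrow> 'r::finite cd"
  where "cd_cartesian x = x 0 *\<^sub>R 1 + (\<Sum>j=1..2 ^ CARD('r) - 1. x j *\<^sub>R cd_i j)"

definition spherical_coeff :: "nat \<Rightarrow> (nat \<Rightarrow> real) \<Rightarrow> nat \<Rightarrow> real"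
  where "spherical_coeff N x k =
    (\<Prod>m=2..k. sin (x m)) * (if k < N then cos (x (k + 1)) else 1)"

definition cd_spherical :: "(nat \<Rightarrow> real) \<Rightarrow> 'r::finite cd"
  where "cd_spherical x = x 0 *\<^sub>R 1 +
    (\<Sum>k=1..2 ^ CARD('r) - 1. (x 1 * spherical_coeff (2 ^ CARD('r) - 1) x k) *\<^sub>R cd_i k)"

section \<open>Closed forms of the exponentials\<close>

lemma two_le_power_card: "2 \<le> (2::nat) ^ CARD('r::finite)"
  using self_le_power[of "2::nat" "CARD('r)"] by simp

lemma cd_coord_imag_sum:
  "cd_coord (\<Sum>j=1..2 ^ CARD('r) - 1. x j *\<^sub>R cd_i j :: 'r::finite cd) k =
    (if 1 \<le> k \<and> k \<le> 2 ^ CARD('r) - 1 then x k else 0)"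
proof -
  have "(\<Sum>j=1..2 ^ CARD('r) - 1. x j * cd_coord (cd_i j :: 'r cd) k)
      = (\<Sum>j=1..2 ^ CARD('r) - 1. if j = k then x j else 0)"
    using two_le_power_card[where 'r='r] by (intro sum.cong) (auto simp: cd_coord_i)
  then show ?thesis by simp
qed

lemma norm_cd_imag_sum:
  "norm (\<Sum>j=1..2 ^ CARD('r) - 1. x j *\<^sub>R cd_i j :: 'r::finite cd) =
    sqrt (\<Sum>j=1..2 ^ CARD('r) - 1. (x j)\<^sup>2)"
proof -
  let ?N = "2 ^ CARD('r) :: nat" and ?y = "(\<Sum>j=1..2 ^ CARD('r) - 1. x j *\<^sub>R cd_i j :: 'r cd)"
  have "inner ?y ?y = (\<Sum>k<?N. if 1 \<le> k \<and> k \<le> ?N - 1 then (x k)\<^sup>2 else 0)"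
    unfolding inner_cd_def
    by (intro sum.cong)
      (auto simp only: cd_coord_imag_sum power2_eq_square split: if_splits)
  also have "\<dots> = (\<Sum>k\<in>{1..?N - 1}. (x k)\<^sup>2)"
    using two_le_power_card[where 'r='r]
    by (intro sum.mono_neutral_cong_right) auto
  finally show ?thesis by (simp add: norm_eq_sqrt_inner)
qed

lemma cd_exp_cartesian:
  fixes x :: "nat \<Rightarrow> real"
  defines "q \<equiv> (\<Sum>j=1..2 ^ CARD('r::finite) - 1. (x j)\<^sup>2)"
  shows "cd_exp (- cd_cartesian x :: 'r cd) = exp (- x 0) *\<^sub>R
    (Re (cos_sqrt (of_real q)) *\<^sub>R 1 +
      (-1) *\<^sub>R (\<Sum>j=1..2 ^ CARD('r) - 1. (Re (sinc_sqrt (of_real q)) * x j) *\<^sub>R cd_i j))"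
proof -
  let ?N = "2 ^ CARD('r) - 1 :: nat"
  define y :: "'r cd" where "y = (\<Sum>j=1..?N. x j *\<^sub>R cd_i j)"
  define b where "b = norm y"
  \<comment> \<open>The direction of the vector part. If it vanishes, any imaginary unit will do,
    and i_1 exists since r >= 1. The results are even in b and therefore functions of q =
    b^2.\<close>
  define m :: "'r cd" where "m = (if b = 0 then cd_i 1 else y /\<^sub>R b)"
  have "0 \<le> q" by (simp add: q_def sum_nonneg)
  then have q: "q = b\<^sup>2" unfolding b_def y_def norm_cd_imag_sum q_def[symmetric] by simp
  have y: "y = b *\<^sub>R m" by (auto simp: m_def b_def)
  have "m * m = - 1"
  proof (rule cd_imag_unit_square)
    have "cd_coord y 0 = 0" unfolding y_def cd_coord_imag_sum by simp
    then show "cd_coord m 0 = 0" by (auto simp: m_def cd_coord_i)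
    have "norm (cd_i 1 :: 'r cd) = 1"
      using two_le_power_card[where 'r='r] by (intro cd_norm_i) simp
    then show "norm m = 1" by (auto simp: m_def b_def)
  qed
  note ex = cd_exp_plane[OF this, of "- x 0" "- b"]
  have cart: "cd_cartesian x = x 0 *\<^sub>R 1 + b *\<^sub>R m"
    unfolding cd_cartesian_def y[symmetric] y_def by (rule refl)
  from ex
  have e: "cd_exp (- cd_cartesian x :: 'r cd)
      = exp (- x 0) *\<^sub>R (cos b *\<^sub>R 1 + (-1) *\<^sub>R (sin b *\<^sub>R m))"
    unfolding cart by (simp add: algebra_simps)
  have c: "cos_sqrt (of_real q) = of_real (cos b)"
    using cos_sqrt_square[of "of_real b"] by (simp add: q cos_of_real)
  have sc: "b * Re (sinc_sqrt (of_real q)) = sin b"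
    using arg_cong[OF sinc_sqrt_square[of "of_real b"], of Re] by (simp add: q sin_of_real)
  have sm: "(\<Sum>j=1..?N. (c * x j) *\<^sub>R cd_i j) = c *\<^sub>R y" for c
    by (simp add: y_def scaleR_sum_right)
  show ?thesis unfolding e c sm y by (simp flip: sc add: mult.commute)
qed

text \<open>Telescoping: the squared product of sines left over after L terms splits, by sin^2 +
  cos^2 = 1, into the next term and the next remainder. The last coefficient, without a cosine, is
  the final remainder.\<close>

lemma sum_spherical_coeff_square:
  assumes "1 \<le> N" shows "(\<Sum>k=1..N. (spherical_coeff N x k)\<^sup>2) = 1"
proof -
  have "(\<Sum>k=1..L. ((\<Prod>m=2..k. sin (x m)) * cos (x (k + 1)))\<^sup>2) + (\<Prod>m=2..L+1. sin (x m))\<^sup>2 = 1" for L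
  proof (induction L)
    case (Suc L)
    have "((\<Prod>m=2..Suc L. sin (x m)) * cos (x (Suc L + 1)))\<^sup>2 + (\<Prod>m=2..Suc L+1. sin (x m))\<^sup>2
        = (\<Prod>m=2..L+1. sin (x m))\<^sup>2"
      by (simp add: power_mult_distrib flip: distrib_left)
    then show ?case using Suc.IH by simp
  qed simp
  from this[of "N - 1"] assms
  have 1: "(\<Sum>k=1..N-1. ((\<Prod>m=2..k. sin (x m)) * cos (x (k + 1)))\<^sup>2) + (\<Prod>m=2..N. sin (x m))\<^sup>2 = 1"
    by simp
  have "{1..N} = insert N {1..N-1}" using assms by auto
  moreover have "(\<Sum>k=1..N-1. (spherical_coeff N x k)\<^sup>2)
      = (\<Sum>k=1..N-1. ((\<Prod>m=2..k. sin (x m)) * cos (x (k + 1)))\<^sup>2)"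
    by (intro sum.cong) (auto simp: spherical_coeff_def)
  ultimately show ?thesis using 1 assms by (simp add: spherical_coeff_def)
qed

lemma cd_exp_spherical:
  "cd_exp (- cd_spherical x :: 'r::finite cd) = exp (- x 0) *\<^sub>R
    (cos (x 1) *\<^sub>R 1 + (-1) *\<^sub>R (\<Sum>k=1..2 ^ CARD('r) - 1.
      (sin (x 1) * spherical_coeff (2 ^ CARD('r) - 1) x k) *\<^sub>R cd_i k))"
proof -
  let ?N = "2 ^ CARD('r) - 1 :: nat"
  define m :: "'r cd" where "m = (\<Sum>k=1..?N. spherical_coeff ?N x k *\<^sub>R cd_i k)"
  have sm: "(\<Sum>k=1..?N. (c * spherical_coeff ?N x k) *\<^sub>R cd_i k) = c *\<^sub>R m" for c
    by (simp add: m_def scaleR_sum_right)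
  have "m * m = - 1"
  proof (rule cd_imag_unit_square)
    show "cd_coord m 0 = 0" unfolding m_def cd_coord_imag_sum by simp
    have "(1::nat) \<le> ?N" using two_le_power_card[where 'r='r] by simp
    then show "norm m = 1" unfolding m_def norm_cd_imag_sum
      by (simp only: sum_spherical_coeff_square real_sqrt_one)
  qed
  from cd_exp_plane[OF this, of "- x 0" "- x 1"]
  show ?thesis
    unfolding cd_spherical_def sm by (simp add: algebra_simps)
qed

text \<open>\<open>v\<close> holds the arguments at the base point and \<open>\<tau>\<close> their
  slopes in the coordinates of \<open>h\<close>. The base point enters exponentially only through
  its real part, otherwise linearly, and the exponential rate of the increment is proportional to
  \<rho>. Since \<open>C\<close> and \<open>L\<close> do not depend on \<rho>, this rate can be made
  small by shrinking the ball. For r = 1 equal slopes make the increment a real multiple of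
  \<open>h\<close> itself.\<close>

definition kernel_bound ::
    "'t measure \<Rightarrow> ((nat \<Rightarrow> real) \<Rightarrow> 'r::finite cd) \<Rightarrow> real \<Rightarrow> real \<Rightarrow> bool"
  where "kernel_bound M U C L \<longleftrightarrow> (\<forall>\<rho>\<ge>0. \<forall>v \<tau> :: nat \<Rightarrow> 't \<Rightarrow> real.
    (\<forall>j. v j \<in> borel_measurable M) \<longrightarrow> (\<forall>j. \<tau> j \<in> borel_measurable M) \<longrightarrow>
    (CARD('r) = 1 \<longrightarrow> \<tau> 0 = \<tau> 1) \<longrightarrow>
    expands M \<rho> (\<lambda>t h :: 'r cd. cd_exp (- U (\<lambda>j. v j t + \<tau> j t * cd_coord h j)))
      (\<lambda>t. C * exp (- v 0 t) * (1 + (\<Sum>j<2 ^ CARD('r). \<bar>v j t\<bar>)) *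
        exp (L * \<rho> * (\<Sum>j<2 ^ CARD('r). \<bar>\<tau> j t\<bar>))))"

definition kernel_expands :: "'t measure \<Rightarrow> ((nat \<Rightarrow> real) \<Rightarrow> 'r::finite cd) \<Rightarrow> bool"
  where "kernel_expands M U \<longleftrightarrow> (\<exists>C L. 0 \<le> C \<and> 0 \<le> L \<and> kernel_bound M U C L)"

section \<open>Bounds for the two kernels when r >= 2\<close>

lemma expands_lin:
  assumes "2 \<le> CARD('r::finite)" "j < 2 ^ CARD('r)" "0 \<le> \<rho>" "\<tau> \<in> borel_measurable M"
  shows "expands M \<rho> (\<lambda>t h :: 'r cd. (\<tau> t * cd_coord h j) *\<^sub>R (1 :: 'r cd))
    (\<lambda>t. \<bar>\<tau> t\<bar> * (cd_coord_const TYPE('r) * cd_mult_const TYPE('r) * \<rho>))"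
  using expands_scale[OF assms(4) expands_coord[OF assms(1,2) expands_var[OF assms(3)]]]
  by (simp add: mult_ac)

lemma expands_real:
  assumes "a \<in> borel_measurable M"
  shows "expands M \<rho> (\<lambda>t h. a t *\<^sub>R (1 :: 'r::finite cd)) (\<lambda>t. \<bar>a t\<bar> * cd_mult_const TYPE('r))"
  using expands_scale[OF assms expands_const[of M \<rho> "1 :: 'r cd"]] by (simp add: cd_wnorm_1)

lemma expands_affine:
  assumes "2 \<le> CARD('r::finite)" "j < 2 ^ CARD('r)" "0 \<le> \<rho>"
    "v \<in> borel_measurable M" "\<tau> \<in> borel_measurable M"
  shows "expands M \<rho> (\<lambda>t h :: 'r cd. (v t + \<tau> t * cd_coord h j) *\<^sub>R (1 :: 'r cd))
    (\<lambda>t. \<bar>v t\<bar> * cd_mult_const TYPE('r) +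
      \<bar>\<tau> t\<bar> * (cd_coord_const TYPE('r) * cd_mult_const TYPE('r) * \<rho>))"
  using expands_add[OF expands_real[OF assms(4)] expands_lin[OF assms(1-3,5)]]
  by (simp add: scaleR_add_left)

text \<open>Splitting off exp (- v) as a scalar keeps the sign of the base value; only the increment
  is replaced by its absolute value.\<close>

lemma expands_exp_affine:
  assumes "2 \<le> CARD('r::finite)" "0 \<le> \<rho>"
    and [measurable]: "v \<in> borel_measurable M" "\<tau> \<in> borel_measurable M"
  shows "expands M \<rho> (\<lambda>t h :: 'r cd. exp (- (v t + \<tau> t * cd_coord h 0)) *\<^sub>R (1 :: 'r cd))
    (\<lambda>t. exp (- v t) * (cd_mult_const TYPE('r) *
      exp (\<bar>\<tau> t\<bar> * (cd_coord_const TYPE('r) * cd_mult_const TYPE('r) * \<rho>))))"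
proof -
  have "expands M \<rho> (\<lambda>t h :: 'r cd. exp (- \<tau> t * cd_coord h 0) *\<^sub>R (1 :: 'r cd))
      (\<lambda>t. cd_mult_const TYPE('r) * exp (\<bar>- \<tau> t\<bar> * (cd_coord_const TYPE('r) * cd_mult_const TYPE('r) * \<rho>)))"
    by (intro expands_exp expands_lin assms) auto
  from expands_scale[OF _ this, of "\<lambda>t. exp (- v t)"] show ?thesis
    by (simp add: exp_add exp_diff exp_minus divide_inverse)
qed

text \<open>Origin of \<delta> = 6 w + 1: with m = max(V, \<delta>) the increment of the sum of
  squares is at most (2 m + w) w <= 3 m w = 6 w m / 2, which fits into half the Cauchy radius. The
  summand 1 keeps \<delta> positive.\<close>

lemma sum_cross_terms_le:
  fixes a s :: "'i \<Rightarrow> real"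
  assumes "finite I" "\<And>j. j \<in> I \<Longrightarrow> 0 \<le> s j" "\<And>j. j \<in> I \<Longrightarrow> \<bar>a j\<bar> \<le> V"
    and "(\<Sum>j\<in>I. s j) \<le> w"
  shows "(\<Sum>j\<in>I. 2 * \<bar>a j\<bar> * s j + s j * s j) \<le> (6 * w + 1) * max V (6 * w + 1) / 2"
proof -
  have w: "0 \<le> w" using order_trans[OF sum_nonneg[OF assms(2)] assms(4)] .
  have "s j \<le> w" if "j \<in> I" for j
    using member_le_sum[OF that, of s] assms by fastforce
  then have "(\<Sum>j\<in>I. 2 * \<bar>a j\<bar> * s j + s j * s j) \<le> (\<Sum>j\<in>I. (2 * max V (6 * w + 1) + w) * s j)"
    unfolding distrib_right using assms(2,3)
    by (intro sum_mono add_mono mult_right_mono) (auto simp: max.coboundedI1)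
  also have "\<dots> = (2 * max V (6 * w + 1) + w) * (\<Sum>j\<in>I. s j)" by (simp add: sum_distrib_left)
  also have "\<dots> \<le> (2 * max V (6 * w + 1) + w) * w"
    using assms(4) w by (intro mult_left_mono) auto
  also have "\<dots> \<le> (2 * max V (6 * w + 1) + max V (6 * w + 1)) * w"
    using w by (intro mult_right_mono add_mono) auto
  also have "\<dots> = (6 * w) * max V (6 * w + 1) / 2" by simp
  also have "\<dots> \<le> (6 * w + 1) * max V (6 * w + 1) / 2"
    using w by (intro divide_right_mono mult_right_mono) auto
  finally show ?thesis .
qed

lemma sum_lessThan_power_card:
  "(\<Sum>j<2 ^ CARD('r::finite). f j) = f 0 + (\<Sum>j=1..2 ^ CARD('r) - 1. f j)"
  for f :: "nat \<Rightarrow> real"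
proof -
  have "{..<2 ^ CARD('r)} = insert 0 {1..2 ^ CARD('r) - 1 :: nat}"
    using two_le_power_card[where 'r='r] by auto
  then show ?thesis by simp
qed

text \<open>The rate 8 collects 6 from the strip width 6 w + 1, one from the real exponential
  factor, and one from 1 + w <= exp w in the linear factor that multiplies \<open>sinc_sqrt\<close>.
  One factor \<open>exp 1\<close> comes from the bound on the entire functions, the other from the
  summand 1 of the width; the 2 is the geometric series.\<close>

lemma kernel_expands_cartesian:
  assumes r: "2 \<le> CARD('r::finite)"
  shows "kernel_expands (M :: 't measure) (cd_cartesian :: _ \<Rightarrow> 'r cd)"
proof -
  let ?K = "cd_mult_const TYPE('r)" and ?N = "2 ^ CARD('r) - 1 :: nat"
  let ?\<kappa> = "cd_coord_const TYPE('r) * ?K"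
  have K: "1 \<le> ?K" by (rule cd_mult_const)
  have \<kappa>: "0 \<le> ?\<kappa>" using K cd_coord_const_nonneg[where 'r='r] by simp
  have j: "j < 2 ^ CARD('r)" if "j \<in> {1..?N}" for j
    using that two_le_power_card[where 'r='r] by auto
  have "expands M \<rho> (\<lambda>t h :: 'r cd. cd_exp (- cd_cartesian (\<lambda>j. v j t + \<tau> j t * cd_coord h j)))
      (\<lambda>t. (2 * ?K ^ 4 * (exp 1)\<^sup>2) * exp (- v 0 t) * (1 + (\<Sum>j<2 ^ CARD('r). \<bar>v j t\<bar>)) *
          exp ((8 * ?\<kappa>) * \<rho> * (\<Sum>j<2 ^ CARD('r). \<bar>\<tau> j t\<bar>)))"
    if \<rho>: "0 \<le> \<rho>" and [measurable]: "\<And>j. v j \<in> borel_measurable M" "\<And>j. \<tau> j \<in> borel_measurable M"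
    for \<rho> and v \<tau> :: "nat \<Rightarrow> 't \<Rightarrow> real"
  proof -
    define s where "s j t = \<bar>\<tau> j t\<bar> * (?\<kappa> * \<rho>)" for j t
    define w where "w t = (\<Sum>j<2 ^ CARD('r). s j t)" for t
    define V where "V t = sqrt (\<Sum>j=1..?N. (v j t)\<^sup>2)" for t
    \<comment> \<open>The increment of q over its base value V^2; the cross terms make it of order V
      w and not merely w.\<close>
    define g where "g t h = (\<Sum>j=1..?N. 2 * v j t * (\<tau> j t * cd_coord h j)
        + (\<tau> j t * cd_coord h j) * (\<tau> j t * cd_coord h j))" for t and h :: "'r cd"
    have s0: "0 \<le> s j t" for j t using \<rho> \<kappa> by (simp add: s_def)
    have w0: "0 \<le> w t" for t using s0 by (simp add: w_def sum_nonneg)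
    have lin: "expands M \<rho> (\<lambda>t h :: 'r cd. (\<tau> j t * cd_coord h j) *\<^sub>R (1 :: 'r cd)) (s j)"
      if "j < 2 ^ CARD('r)" for j
      unfolding s_def by (rule expands_lin[OF r that \<rho>]) measurable
    have "expands M \<rho> (\<lambda>t h. \<Sum>j=1..?N. (2 * v j t) *\<^sub>R ((\<tau> j t * cd_coord h j) *\<^sub>R (1 :: 'r cd))
        + ((\<tau> j t * cd_coord h j) *\<^sub>R 1) * ((\<tau> j t * cd_coord h j) *\<^sub>R 1))
        (\<lambda>t. \<Sum>j=1..?N. \<bar>2 * v j t\<bar> * s j t + s j t * s j t)"
      by (intro expands_sum expands_add expands_scale expands_mult lin j) measurable
    then have g: "expands M \<rho> (\<lambda>t h. g t h *\<^sub>R (1 :: 'r cd))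
        (\<lambda>t. \<Sum>j=1..?N. \<bar>2 * v j t\<bar> * s j t + s j t * s j t)"
      by (rule expands_cong) (simp_all add: g_def scaleR_one_mult scaleR_sum_left scaleR_add_left)
    have ws: "w t = s 0 t + (\<Sum>j=1..?N. s j t)" for t
      unfolding w_def by (rule sum_lessThan_power_card)
    have B: "(\<Sum>j=1..?N. \<bar>2 * v j t\<bar> * s j t + s j t * s j t)
        \<le> (6 * w t + 1) * max (V t) (6 * w t + 1) / 2" for t
    proof -
      have "\<bar>v j t\<bar> \<le> V t" if "j \<in> {1..?N}" for j
        unfolding V_def by (intro real_le_rsqrt) (use that in \<open>auto intro!: member_le_sum\<close>)
      then show ?thesis
        using sum_cross_terms_le[of "{1..?N}" "\<lambda>j. s j t" "\<lambda>j. v j t" "V t" "w t"] s0 ws[of t]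
        by (simp add: abs_mult)
    qed
    have q: "(V t)\<^sup>2 + g t h = (\<Sum>j=1..?N. (v j t + \<tau> j t * cd_coord h j)\<^sup>2)" for t h
      by (simp add: V_def g_def sum_nonneg power2_eq_square algebra_simps flip: sum.distrib)
    have [measurable]: "V \<in> borel_measurable M" unfolding V_def by measurable
    have V0: "0 \<le> V t" for t by (simp add: V_def sum_nonneg)
    note near = expands_near_square[OF g, where v=V and \<delta>="\<lambda>t. 6 * w t + 1" and A="exp 1"]
    have c: "expands M \<rho> (\<lambda>t h. Re (cos_sqrt (of_real ((V t)\<^sup>2 + g t h))) *\<^sub>R (1 :: 'r cd))
        (\<lambda>t. ?K * (2 * (exp 1 * exp (6 * w t + 1))))"
      by (rule near[OF holomorphic_cos_sqrt(1) norm_cos_sqrt_square_le])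
         (use w0 B V0 in \<open>auto simp: add_nonneg_pos\<close>)
    have sc: "expands M \<rho> (\<lambda>t h. Re (sinc_sqrt (of_real ((V t)\<^sup>2 + g t h))) *\<^sub>R (1 :: 'r cd))
        (\<lambda>t. ?K * (2 * (exp 1 * exp (6 * w t + 1))))"
      by (rule near[OF holomorphic_cos_sqrt(2) norm_sinc_sqrt_square_le])
         (use w0 B V0 in \<open>auto simp: add_nonneg_pos\<close>)
    have aff: "expands M \<rho> (\<lambda>t h :: 'r cd. (v j t + \<tau> j t * cd_coord h j) *\<^sub>R (1 :: 'r cd))
        (\<lambda>t. \<bar>v j t\<bar> * ?K + s j t)" if "j < 2 ^ CARD('r)" for j
      unfolding s_def by (rule expands_affine[OF r that \<rho>]) measurable
    have e0: "expands M \<rho> (\<lambda>t h :: 'r cd. exp (- (v 0 t + \<tau> 0 t * cd_coord h 0)) *\<^sub>R (1 :: 'r cd))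
        (\<lambda>t. exp (- v 0 t) * (?K * exp (s 0 t)))"
      unfolding s_def by (rule expands_exp_affine[OF r \<rho>]) measurable
    let ?R = "\<lambda>t. ?K * (2 * (exp 1 * exp (6 * w t + 1)))"
    have "expands M \<rho> (\<lambda>t h. (exp (- (v 0 t + \<tau> 0 t * cd_coord h 0)) *\<^sub>R (1 :: 'r cd)) *
        (Re (cos_sqrt (of_real ((V t)\<^sup>2 + g t h))) *\<^sub>R 1 +
          (-1) *\<^sub>R (\<Sum>j=1..?N. (Re (sinc_sqrt (of_real ((V t)\<^sup>2 + g t h))) *\<^sub>R 1)
            * ((v j t + \<tau> j t * cd_coord h j) *\<^sub>R 1) * cd_i j)))
        (\<lambda>t. (exp (- v 0 t) * (?K * exp (s 0 t))) *
          (?R t + \<bar>-1\<bar> * (\<Sum>j=1..?N. ?R t * (\<bar>v j t\<bar> * ?K + s j t) * cd_wnorm (cd_i j :: 'r cd))))"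
      by (intro expands_mult expands_add expands_scale expands_sum expands_const aff e0 c sc j) auto
    then show ?thesis
    proof (rule expands_cong)
      show "(exp (- (v 0 t + \<tau> 0 t * cd_coord h 0)) *\<^sub>R (1 :: 'r cd)) *
        (Re (cos_sqrt (of_real ((V t)\<^sup>2 + g t h))) *\<^sub>R 1 +
          (-1) *\<^sub>R (\<Sum>j=1..?N. (Re (sinc_sqrt (of_real ((V t)\<^sup>2 + g t h))) *\<^sub>R 1)
            * ((v j t + \<tau> j t * cd_coord h j) *\<^sub>R 1) * cd_i j))
        = cd_exp (- cd_cartesian (\<lambda>j. v j t + \<tau> j t * cd_coord h j))" for t and h :: "'r cd"
        unfolding cd_exp_cartesian q by (simp add: cd_scaleR mult.commute)
      fix t
      define Z where "Z = (\<Sum>j<2 ^ CARD('r). \<bar>v j t\<bar>)"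
      have Z: "(\<Sum>j=1..?N. \<bar>v j t\<bar>) \<le> Z"
        unfolding Z_def sum_lessThan_power_card by simp
      have Z0: "0 \<le> Z" by (simp add: Z_def sum_nonneg)
      have "(\<Sum>j=1..?N. ?R t * (\<bar>v j t\<bar> * ?K + s j t) * cd_wnorm (cd_i j :: 'r cd))
          = (\<Sum>j=1..?N. ?R t * ?K * (\<bar>v j t\<bar> * ?K + s j t))"
        using j by (intro sum.cong) (auto simp: cd_wnorm_i)
      also have "\<dots> = ?R t * ?K * ((\<Sum>j=1..?N. \<bar>v j t\<bar>) * ?K + (\<Sum>j=1..?N. s j t))"
        by (simp add: sum.distrib flip: sum_distrib_left sum_distrib_right)
      also have "\<dots> \<le> ?R t * ?K * (Z * ?K + w t)"
        using K Z s0[of 0 t] by (intro mult_left_mono add_mono mult_right_mono) (auto simp: ws)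
      finally have "?R t + \<bar>-1\<bar> * (\<Sum>j=1..?N. ?R t * (\<bar>v j t\<bar> * ?K + s j t) * cd_wnorm (cd_i j :: 'r cd))
          \<le> ?R t * (1 + ?K * (Z * ?K + w t))" by (simp add: algebra_simps)
      also have "\<dots> \<le> ?R t * (?K\<^sup>2 * (1 + Z) * exp (w t))"
      proof (intro mult_left_mono)
        have K2: "1 \<le> ?K\<^sup>2" "?K \<le> ?K\<^sup>2" using K self_le_power[of ?K 2] by auto
        have "?K * w t \<le> ?K\<^sup>2 * w t" using K2 w0 by (intro mult_right_mono)
        then have "1 + ?K * (Z * ?K + w t) \<le> ?K\<^sup>2 * (1 + Z + w t)"
          using K2 by (simp add: algebra_simps power2_eq_square)
        also have "\<dots> \<le> ?K\<^sup>2 * ((1 + Z) * (1 + w t))"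
          using Z0 w0[of t] by (intro mult_left_mono) (auto simp: algebra_simps)
        also have "\<dots> \<le> ?K\<^sup>2 * ((1 + Z) * exp (w t))"
          using Z0 by (intro mult_left_mono exp_ge_add_one_self) auto
        finally show "1 + ?K * (Z * ?K + w t) \<le> ?K\<^sup>2 * (1 + Z) * exp (w t)" by (simp add: mult_ac)
      qed (use K in auto)
      finally have 1: "?R t + \<bar>-1\<bar> * (\<Sum>j=1..?N. ?R t * (\<bar>v j t\<bar> * ?K + s j t) * cd_wnorm (cd_i j :: 'r cd))
          \<le> ?R t * (?K\<^sup>2 * (1 + Z) * exp (w t))" .
      have "s 0 t \<le> w t" using s0 by (simp add: ws sum_nonneg)
      then have 2: "exp (- v 0 t) * (?K * exp (s 0 t)) \<le> exp (- v 0 t) * (?K * exp (w t))"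
        using K by (intro mult_left_mono) auto
      have "(exp (- v 0 t) * (?K * exp (s 0 t))) *
          (?R t + \<bar>-1\<bar> * (\<Sum>j=1..?N. ?R t * (\<bar>v j t\<bar> * ?K + s j t) * cd_wnorm (cd_i j :: 'r cd)))
          \<le> (exp (- v 0 t) * (?K * exp (w t))) * (?R t * (?K\<^sup>2 * (1 + Z) * exp (w t)))"
        using K s0 by (intro mult_mono 1 2) (auto intro!: add_nonneg_nonneg sum_nonneg mult_nonneg_nonneg)
      also have "\<dots> = (2 * ?K ^ 4 * (exp 1)\<^sup>2) * exp (- v 0 t) * (1 + Z) * exp (8 * w t)"
      proof -
        have "exp (8 * w t) = exp (w t) * exp (w t) * exp (6 * w t)"
          by (simp flip: exp_add)
        then show ?thesis
          by (simp add: exp_add power2_eq_square power4_eq_xxxx mult_ac)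
      qed
      also have "8 * w t = (8 * ?\<kappa>) * \<rho> * (\<Sum>j<2 ^ CARD('r). \<bar>\<tau> j t\<bar>)"
        by (simp add: w_def s_def sum_distrib_left mult_ac)
      finally show "(exp (- v 0 t) * (?K * exp (s 0 t))) *
          (?R t + \<bar>-1\<bar> * (\<Sum>j=1..?N. ?R t * (\<bar>v j t\<bar> * ?K + s j t) * cd_wnorm (cd_i j :: 'r cd)))
          \<le> (2 * ?K ^ 4 * (exp 1)\<^sup>2) * exp (- v 0 t) * (1 + (\<Sum>j<2 ^ CARD('r). \<bar>v j t\<bar>)) *
            exp ((8 * ?\<kappa>) * \<rho> * (\<Sum>j<2 ^ CARD('r). \<bar>\<tau> j t\<bar>))"
        unfolding Z_def .
    qed
  qed
  then show ?thesis
    unfolding kernel_expands_def kernel_bound_def using K \<kappa>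
    by (intro exI[of _ "2 * ?K ^ 4 * (exp 1)\<^sup>2"] exI[of _ "8 * ?\<kappa>"]) simp
qed

text \<open>The rate 4 counts four factors exp w: the real exponential, the sine of the first
  argument, the product of the remaining sines, and the final cosine.\<close>

lemma kernel_expands_spherical:
  assumes r: "2 \<le> CARD('r::finite)"
  shows "kernel_expands (M :: 't measure) (cd_spherical :: _ \<Rightarrow> 'r cd)"
proof -
  let ?K = "cd_mult_const TYPE('r)" and ?N = "2 ^ CARD('r) - 1 :: nat"
  let ?\<kappa> = "cd_coord_const TYPE('r) * ?K"
  define D where "D = ?K * (2 * ?K + ?N * ((2 * ?K) * ((?K * (2 * ?K) ^ ?N) * (2 * ?K)) * ?K))"
  have K: "1 \<le> ?K" by (rule cd_mult_const)
  have \<kappa>: "0 \<le> ?\<kappa>" using K cd_coord_const_nonneg[where 'r='r] by simp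
  have D: "0 \<le> D" using K by (simp add: D_def)
  have j: "j < 2 ^ CARD('r)" if "j \<in> {1..?N}" for j
    using that two_le_power_card[where 'r='r] by auto
  have "expands M \<rho> (\<lambda>t h :: 'r cd. cd_exp (- cd_spherical (\<lambda>j. v j t + \<tau> j t * cd_coord h j)))
      (\<lambda>t. D * exp (- v 0 t) * (1 + (\<Sum>j<2 ^ CARD('r). \<bar>v j t\<bar>)) *
          exp ((4 * ?\<kappa>) * \<rho> * (\<Sum>j<2 ^ CARD('r). \<bar>\<tau> j t\<bar>)))"
    if \<rho>: "0 \<le> \<rho>" and [measurable]: "\<And>j. v j \<in> borel_measurable M" "\<And>j. \<tau> j \<in> borel_measurable M"
    for \<rho> and v \<tau> :: "nat \<Rightarrow> 't \<Rightarrow> real"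
  proof -
    define s where "s j t = \<bar>\<tau> j t\<bar> * (?\<kappa> * \<rho>)" for j t
    define w where "w t = (\<Sum>j<2 ^ CARD('r). s j t)" for t
    have s0: "0 \<le> s j t" for j t using \<rho> \<kappa> by (simp add: s_def)
    have w0: "0 \<le> w t" for t using s0 by (simp add: w_def sum_nonneg)
    have sw: "s j t \<le> w t" if "j < 2 ^ CARD('r)" for j t
      unfolding w_def using that s0 by (intro member_le_sum) auto
    have lin: "expands M \<rho> (\<lambda>t h :: 'r cd. (\<tau> j t * cd_coord h j) *\<^sub>R (1 :: 'r cd)) (s j)"
      if "j < 2 ^ CARD('r)" for j
      unfolding s_def by (rule expands_lin[OF r that \<rho>]) measurable
    let ?x = "\<lambda>t (h :: 'r cd) j. v j t + \<tau> j t * cd_coord h j"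
    let ?B = "\<lambda>t. 2 * ?K * exp (w t)"
    have cs: "expands M \<rho> (\<lambda>t h. cos (?x t h j) *\<^sub>R (1 :: 'r cd)) (\<lambda>t. 2 * ?K * exp (s j t))"
      "expands M \<rho> (\<lambda>t h. sin (?x t h j) *\<^sub>R (1 :: 'r cd)) (\<lambda>t. 2 * ?K * exp (s j t))"
      if "j < 2 ^ CARD('r)" for j
      by (intro expands_cos_sin lin that; measurable)+
    have cs': "expands M \<rho> (\<lambda>t h. cos (?x t h j) *\<^sub>R (1 :: 'r cd)) ?B"
      "expands M \<rho> (\<lambda>t h. sin (?x t h j) *\<^sub>R (1 :: 'r cd)) ?B"
      if "j < 2 ^ CARD('r)" for j
      using K sw[OF that] by (auto intro!: expands_mono[OF cs(1)[OF that]] expands_mono[OF cs(2)[OF that]])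
    have pr: "expands M \<rho> (\<lambda>t h. (\<Prod>m=2..k. sin (?x t h m)) *\<^sub>R (1 :: 'r cd))
        (\<lambda>t. (?K * (2 * ?K) ^ ?N) * exp (w t))" if k: "k \<in> {1..?N}" for k
    proof (rule expands_mono)
      show "expands M \<rho> (\<lambda>t h. (\<Prod>m=2..k. sin (?x t h m)) *\<^sub>R (1 :: 'r cd))
          (\<lambda>t. ?K * (\<Prod>m=2..k. 2 * ?K * exp (s m t)))"
        using k j by (intro expands_prod cs) auto
      fix t
      \<comment> \<open>Each sine is taken with its own bound \<open>s m\<close> and not with
        \<open>w\<close>: the exponents then add up to at most \<open>w\<close>, so the whole
        product costs a single factor exp w.\<close>
      have "(\<Prod>m=2..k. 2 * ?K * exp (s m t)) = (2 * ?K) ^ (k - 1) * exp (\<Sum>m=2..k. s m t)"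
        by (simp add: prod.distrib exp_sum)
      also have "\<dots> \<le> (2 * ?K) ^ ?N * exp (w t)"
      proof (intro mult_mono)
        show "(2 * ?K) ^ (k - 1) \<le> (2 * ?K) ^ ?N"
          using K k by (intro power_increasing) auto
        have "(\<Sum>m=2..k. s m t) \<le> w t"
          unfolding w_def using k j s0 by (intro sum_mono2) auto
        then show "exp (\<Sum>m=2..k. s m t) \<le> exp (w t)" by simp
      qed (use K in auto)
      finally show "?K * (\<Prod>m=2..k. 2 * ?K * exp (s m t)) \<le> (?K * (2 * ?K) ^ ?N) * exp (w t)"
        using K by (simp add: mult_left_mono mult.assoc)
    qed
    have last: "expands M \<rho> (\<lambda>t h. (if k < ?N then cos (?x t h (k + 1)) else 1) *\<^sub>R (1 :: 'r cd)) ?B"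
      if k: "k \<in> {1..?N}" for k
    proof (cases "k < ?N")
      case True
      then show ?thesis using cs'(1)[of "k + 1"] by simp
    next
      case False
      have "?K \<le> ?B t" for t
      proof -
        have "1 \<le> exp (w t)" using w0 by simp
        then have "1 \<le> 2 * exp (w t)" by linarith
        then have "?K * 1 \<le> ?K * (2 * exp (w t))" using K by (intro mult_left_mono) auto
        then show ?thesis by simp
      qed
      with False show ?thesis
        using expands_mono[OF expands_const[of M \<rho> "1 :: 'r cd"], of ?B] by (simp add: cd_wnorm_1)
    qed
    have e0: "expands M \<rho> (\<lambda>t h :: 'r cd. exp (- (v 0 t + \<tau> 0 t * cd_coord h 0)) *\<^sub>R (1 :: 'r cd))
        (\<lambda>t. exp (- v 0 t) * (?K * exp (s 0 t)))"
      unfolding s_def by (rule expands_exp_affine[OF r \<rho>]) measurable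
    have one: "1 < (2::nat) ^ CARD('r)" using two_le_power_card[where 'r='r] by simp
    let ?T = "\<lambda>t. ?B t * (((?K * (2 * ?K) ^ ?N) * exp (w t)) * ?B t)"
    have "expands M \<rho> (\<lambda>t h. (exp (- (v 0 t + \<tau> 0 t * cd_coord h 0)) *\<^sub>R (1 :: 'r cd)) *
        (cos (?x t h 1) *\<^sub>R 1 + (-1) *\<^sub>R (\<Sum>k=1..?N. ((sin (?x t h 1) *\<^sub>R 1) *
          (((\<Prod>m=2..k. sin (?x t h m)) *\<^sub>R 1) * ((if k < ?N then cos (?x t h (k + 1)) else 1) *\<^sub>R 1)))
            * cd_i k)))
        (\<lambda>t. (exp (- v 0 t) * (?K * exp (s 0 t))) *
          (?B t + \<bar>-1\<bar> * (\<Sum>k=1..?N. ?T t * cd_wnorm (cd_i k :: 'r cd))))"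
      by (intro expands_mult expands_add expands_scale expands_sum expands_const cs' e0 pr last j one) auto
    then show ?thesis
    proof (rule expands_cong)
      show "(exp (- (v 0 t + \<tau> 0 t * cd_coord h 0)) *\<^sub>R (1 :: 'r cd)) *
        (cos (?x t h 1) *\<^sub>R 1 + (-1) *\<^sub>R (\<Sum>k=1..?N. ((sin (?x t h 1) *\<^sub>R 1) *
          (((\<Prod>m=2..k. sin (?x t h m)) *\<^sub>R 1) * ((if k < ?N then cos (?x t h (k + 1)) else 1) *\<^sub>R 1)))
            * cd_i k)) = cd_exp (- cd_spherical (?x t h))" for t and h :: "'r cd"
        unfolding cd_exp_spherical spherical_coeff_def by (simp only: scaleR_one_mult) (simp add: cd_scaleR)
      fix t
      have e1: "1 \<le> exp (w t)" using w0 by simp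
      define Z where "Z = (\<Sum>j<2 ^ CARD('r). \<bar>v j t\<bar>)"
      have Z0: "0 \<le> Z" by (simp add: Z_def sum_nonneg)
      have "(\<Sum>k=1..?N. ?T t * cd_wnorm (cd_i k :: 'r cd)) = (\<Sum>k=1..?N. ?T t * ?K)"
        using j by (intro sum.cong) (auto simp: cd_wnorm_i)
      also have "\<dots> = (?N * ((2 * ?K) * ((?K * (2 * ?K) ^ ?N) * (2 * ?K)) * ?K)) * exp (w t) ^ 3"
        by (simp add: power3_eq_cube mult_ac)
      finally have S: "(\<Sum>k=1..?N. ?T t * cd_wnorm (cd_i k :: 'r cd))
          = (?N * ((2 * ?K) * ((?K * (2 * ?K) ^ ?N) * (2 * ?K)) * ?K)) * exp (w t) ^ 3" .
      have "?B t \<le> 2 * ?K * exp (w t) ^ 3"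
        using K e1 self_le_power[OF e1, of 3] by (intro mult_left_mono) auto
      then have "?B t + \<bar>-1\<bar> * (\<Sum>k=1..?N. ?T t * cd_wnorm (cd_i k :: 'r cd))
          \<le> (2 * ?K + ?N * ((2 * ?K) * ((?K * (2 * ?K) ^ ?N) * (2 * ?K)) * ?K)) * exp (w t) ^ 3"
        unfolding S by (simp add: algebra_simps)
      moreover have "exp (- v 0 t) * (?K * exp (s 0 t)) \<le> exp (- v 0 t) * (?K * exp (w t))"
        using K sw[of 0 t] by (intro mult_left_mono) auto
      ultimately have "(exp (- v 0 t) * (?K * exp (s 0 t))) *
          (?B t + \<bar>-1\<bar> * (\<Sum>k=1..?N. ?T t * cd_wnorm (cd_i k :: 'r cd)))
          \<le> (exp (- v 0 t) * (?K * exp (w t))) *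
            ((2 * ?K + ?N * ((2 * ?K) * ((?K * (2 * ?K) ^ ?N) * (2 * ?K)) * ?K)) * exp (w t) ^ 3)"
        using K by (intro mult_mono) (auto intro!: add_nonneg_nonneg sum_nonneg mult_nonneg_nonneg)
      also have "\<dots> = D * exp (- v 0 t) * exp (4 * w t) * 1"
      proof -
        have "exp (4 * w t) = exp (w t) * exp (w t) ^ 3"
          by (simp flip: exp_of_nat_mult exp_add)
        then show ?thesis by (simp add: D_def mult_ac)
      qed
      also have "\<dots> \<le> D * exp (- v 0 t) * exp (4 * w t) * (1 + Z)"
        using D Z0 by (intro mult_left_mono) auto
      also have "4 * w t = (4 * ?\<kappa>) * \<rho> * (\<Sum>j<2 ^ CARD('r). \<bar>\<tau> j t\<bar>)"
        by (simp add: w_def s_def sum_distrib_left mult_ac)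
      finally show "(exp (- v 0 t) * (?K * exp (s 0 t))) *
          (?B t + \<bar>-1\<bar> * (\<Sum>k=1..?N. ?T t * cd_wnorm (cd_i k :: 'r cd)))
          \<le> D * exp (- v 0 t) * (1 + (\<Sum>j<2 ^ CARD('r). \<bar>v j t\<bar>)) *
            exp ((4 * ?\<kappa>) * \<rho> * (\<Sum>j<2 ^ CARD('r). \<bar>\<tau> j t\<bar>))"
        unfolding Z_def by (simp add: mult_ac)
    qed
  qed
  then show ?thesis
    unfolding kernel_expands_def kernel_bound_def using D \<kappa>
    by (intro exI[of _ D] exI[of _ "4 * ?\<kappa>"]) simp
qed

section \<open>The complex case\<close>

lemma cd_exp_plane_mult:
  fixes m :: "'r::finite cd"
  assumes "m * m = - 1"
  shows "cd_exp (x *\<^sub>R 1 + b *\<^sub>R m) * cd_exp (y *\<^sub>R 1 + c *\<^sub>R m)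
    = cd_exp ((x + y) *\<^sub>R 1 + (b + c) *\<^sub>R m)"
  unfolding cd_exp_plane[OF assms]
  by (simp add: cd_distrib cd_scaleR assms exp_add cos_add sin_add algebra_simps)

lemma cd_power_scaleR: "(c *\<^sub>R x) ^ k = c ^ k *\<^sub>R x ^ k" for x :: "'r::finite cd"
  by (induction k) (simp_all add: cd_scaleR)

text \<open>
  For \<open>r = 1\<close> the real coordinates are not sums of monomials; instead, the exponential is
  multiplicative and the increment enters through the power series in \<open>h\<close> itself.
\<close>

lemma kernel_expands_complex:
  fixes U :: "(nat \<Rightarrow> real) \<Rightarrow> 'r::finite cd"
  assumes r: "CARD('r) = 1" and U: "\<And>x. U x = x 0 *\<^sub>R 1 + x 1 *\<^sub>R cd_i 1"
  shows "kernel_expands (M :: 't measure) U"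
proof -
  let ?K = "cd_mult_const TYPE('r)"
  have K: "1 \<le> ?K" by (rule cd_mult_const)
  have i: "cd_i 1 * cd_i 1 = (- 1 :: 'r cd)" by (rule cd_i_squared) (simp_all add: r)
  have h: "h = cd_coord h 0 *\<^sub>R 1 + cd_coord h 1 *\<^sub>R cd_i 1" for h :: "'r cd"
    using cd_expand[of h] by (simp add: r one_cd_def numeral_2_eq_2)
  have "expands M \<rho> (\<lambda>t h. cd_exp (- U (\<lambda>j. v j t + \<tau> j t * cd_coord h j)))
      (\<lambda>t. (2 * ?K\<^sup>2) * exp (- v 0 t) * (1 + (\<Sum>j<2 ^ CARD('r). \<bar>v j t\<bar>)) *
          exp (?K * \<rho> * (\<Sum>j<2 ^ CARD('r). \<bar>\<tau> j t\<bar>)))"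
    if \<rho>: "0 \<le> \<rho>" and [measurable]: "\<And>j. v j \<in> borel_measurable M" "\<And>j. \<tau> j \<in> borel_measurable M"
      and \<tau>: "\<tau> 0 = \<tau> 1"
    for \<rho> and v \<tau> :: "nat \<Rightarrow> 't \<Rightarrow> real"
  proof -
    \<comment> \<open>The exponential at the base point, in closed form: its angle appears only
      under sine and cosine, so the bound involves exp (- v 0 t) alone. The remaining factor
      \<open>e2\<close> is the exponential of a real multiple of \<open>h\<close>.\<close>
    have e1: "expands M \<rho> (\<lambda>t h. (exp (- v 0 t) * cos (- v 1 t)) *\<^sub>R 1
        + (exp (- v 0 t) * sin (- v 1 t)) *\<^sub>R (cd_i 1 :: 'r cd))
        (\<lambda>t. \<bar>exp (- v 0 t) * cos (- v 1 t)\<bar> * cd_wnorm (1 :: 'r cd)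
          + \<bar>exp (- v 0 t) * sin (- v 1 t)\<bar> * cd_wnorm (cd_i 1 :: 'r cd))"
      by (intro expands_add expands_scale expands_const) measurable
    have e2: "expands M \<rho> (\<lambda>t h :: 'r cd. cd_exp ((- \<tau> 0 t) *\<^sub>R h))
        (\<lambda>t. cd_wnorm (1 :: 'r cd) * exp (\<bar>\<tau> 0 t\<bar> * (?K * \<rho>)))"
    proof (rule expands_power_series[OF expands_var[OF \<rho>], where a="\<lambda>k t. (- \<tau> 0 t) ^ k / fact k"])
      have bd: "(\<Sum>k\<in>F. \<bar>(- \<tau> 0 t) ^ k / fact k\<bar> * (?K * \<rho>) ^ k) \<le> exp (\<bar>\<tau> 0 t\<bar> * (?K * \<rho>))"
        if "finite F" for F t
        using sum_pow_fact_le_exp[OF that, of "\<bar>\<tau> 0 t\<bar> * (?K * \<rho>)"] K \<rho>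
        by (simp add: power_abs power_mult_distrib)
      show "(\<Sum>k\<in>F. \<bar>(- \<tau> 0 t) ^ k / fact k\<bar> * (?K * \<rho>) ^ k) \<le> exp (\<bar>\<tau> 0 t\<bar> * (?K * \<rho>))"
        if "finite F" for F t by (rule bd[OF that])
      fix t and h :: "'r cd" assume h: "norm h < \<rho>"
      have le: "norm (((- \<tau> 0 t) ^ k / fact k) *\<^sub>R h ^ k)
          \<le> \<bar>(- \<tau> 0 t) ^ k / fact k\<bar> * (?K * (?K * \<rho>) ^ k)" for k
        using expands_norm_le[OF expands_power[OF expands_var[OF \<rho>]] h, of k]
        by (simp add: cd_wnorm_1 mult_left_mono del: abs_divide)
      have s: "summable (\<lambda>k. norm (((- \<tau> 0 t) ^ k / fact k) *\<^sub>R h ^ k))"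
      proof (rule bounded_imp_summable)
        fix n
        have "(\<Sum>k\<le>n. norm (((- \<tau> 0 t) ^ k / fact k) *\<^sub>R h ^ k))
            \<le> (\<Sum>k\<le>n. \<bar>(- \<tau> 0 t) ^ k / fact k\<bar> * (?K * (?K * \<rho>) ^ k))"
          by (intro sum_mono le)
        also have "\<dots> = ?K * (\<Sum>k\<le>n. \<bar>(- \<tau> 0 t) ^ k / fact k\<bar> * (?K * \<rho>) ^ k)"
          by (simp add: sum_distrib_left mult_ac)
        also have "\<dots> \<le> ?K * exp (\<bar>\<tau> 0 t\<bar> * (?K * \<rho>))"
          using K by (intro mult_left_mono bd) auto
        finally show "(\<Sum>k\<le>n. norm (((- \<tau> 0 t) ^ k / fact k) *\<^sub>R h ^ k))
            \<le> ?K * exp (\<bar>\<tau> 0 t\<bar> * (?K * \<rho>))" .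
      qed simp
      have "cd_exp ((- \<tau> 0 t) *\<^sub>R h) = (\<Sum>k. ((- \<tau> 0 t) ^ k / fact k) *\<^sub>R h ^ k)"
        unfolding cd_exp_def cd_power_scaleR by (simp add: divide_inverse mult.commute)
      then show "((\<lambda>k. ((- \<tau> 0 t) ^ k / fact k) *\<^sub>R h ^ k) has_sum cd_exp ((- \<tau> 0 t) *\<^sub>R h)) UNIV"
        using norm_summable_imp_has_sum[OF s summable_sums[OF summable_norm_cancel[OF s]]] by simp
    qed measurable
    show ?thesis
    proof (rule expands_cong[OF expands_mult[OF e1 e2]])
      fix t and h :: "'r cd"
      have "- U (\<lambda>j. v j t + \<tau> j t * cd_coord h j)
          = (- v 0 t + - \<tau> 0 t * cd_coord h 0) *\<^sub>R 1 + (- v 1 t + - \<tau> 0 t * cd_coord h 1) *\<^sub>R cd_i 1"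
        unfolding U \<tau> by (simp add: algebra_simps)
      also have "cd_exp \<dots> = cd_exp ((- v 0 t) *\<^sub>R 1 + (- v 1 t) *\<^sub>R cd_i 1) *
          cd_exp ((- \<tau> 0 t * cd_coord h 0) *\<^sub>R 1 + (- \<tau> 0 t * cd_coord h 1) *\<^sub>R (cd_i 1 :: 'r cd))"
        by (rule cd_exp_plane_mult[OF i, symmetric])
      also have "(- \<tau> 0 t * cd_coord h 0) *\<^sub>R 1 + (- \<tau> 0 t * cd_coord h 1) *\<^sub>R (cd_i 1 :: 'r cd)
          = (- \<tau> 0 t) *\<^sub>R h"
        by (subst (3) h) (simp add: scaleR_add_right)
      finally show "((exp (- v 0 t) * cos (- v 1 t)) *\<^sub>R 1
          + (exp (- v 0 t) * sin (- v 1 t)) *\<^sub>R (cd_i 1 :: 'r cd)) * cd_exp ((- \<tau> 0 t) *\<^sub>R h)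
          = cd_exp (- U (\<lambda>j. v j t + \<tau> j t * cd_coord h j))"
        by (simp only: cd_exp_plane[OF i])
    next
      fix t
      let ?E = "exp (?K * \<rho> * (\<Sum>j<2 ^ CARD('r). \<bar>\<tau> j t\<bar>))"
      let ?Z = "\<Sum>j<2 ^ CARD('r). \<bar>v j t\<bar>"
      have w: "cd_wnorm (1 :: 'r cd) = ?K" "cd_wnorm (cd_i 1 :: 'r cd) = ?K"
        by (simp_all add: cd_wnorm_1 cd_wnorm_i r)
      have "\<bar>exp (- v 0 t) * cos (- v 1 t)\<bar> * ?K + \<bar>exp (- v 0 t) * sin (- v 1 t)\<bar> * ?K
          = (\<bar>cos (v 1 t)\<bar> + \<bar>sin (v 1 t)\<bar>) * (?K * exp (- v 0 t))"
        by (simp add: abs_mult algebra_simps)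
      also have "\<dots> \<le> 2 * (?K * exp (- v 0 t))"
      proof (rule mult_right_mono)
        show "\<bar>cos (v 1 t)\<bar> + \<bar>sin (v 1 t)\<bar> \<le> 2"
          using abs_cos_le_one[of "v 1 t"] abs_sin_le_one[of "v 1 t"] by linarith
      qed (use K in auto)
      finally have 1: "\<bar>exp (- v 0 t) * cos (- v 1 t)\<bar> * ?K + \<bar>exp (- v 0 t) * sin (- v 1 t)\<bar> * ?K
          \<le> 2 * (?K * exp (- v 0 t))" .
      have "\<bar>\<tau> 0 t\<bar> \<le> (\<Sum>j<2 ^ CARD('r). \<bar>\<tau> j t\<bar>)"
        by (rule member_le_sum) auto
      then have "?K * \<rho> * \<bar>\<tau> 0 t\<bar> \<le> ?K * \<rho> * (\<Sum>j<2 ^ CARD('r). \<bar>\<tau> j t\<bar>)"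
        using K \<rho> by (intro mult_left_mono) auto
      then have 2: "?K * exp (\<bar>\<tau> 0 t\<bar> * (?K * \<rho>)) \<le> ?K * ?E"
        using K by (intro mult_left_mono) (auto simp: mult_ac)
      have "(\<bar>exp (- v 0 t) * cos (- v 1 t)\<bar> * ?K + \<bar>exp (- v 0 t) * sin (- v 1 t)\<bar> * ?K) *
          (?K * exp (\<bar>\<tau> 0 t\<bar> * (?K * \<rho>))) \<le> (2 * (?K * exp (- v 0 t))) * (?K * ?E)"
        using K by (intro mult_mono 1 2) auto
      also have "\<dots> = (2 * ?K\<^sup>2) * exp (- v 0 t) * 1 * ?E"
        by (simp add: power2_eq_square)
      also have "\<dots> \<le> (2 * ?K\<^sup>2) * exp (- v 0 t) * (1 + ?Z) * ?E"
        by (intro mult_right_mono mult_left_mono) (auto intro!: sum_nonneg)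
      finally show "(\<bar>exp (- v 0 t) * cos (- v 1 t)\<bar> * cd_wnorm (1 :: 'r cd)
          + \<bar>exp (- v 0 t) * sin (- v 1 t)\<bar> * cd_wnorm (cd_i 1 :: 'r cd)) *
          (cd_wnorm (1 :: 'r cd) * exp (\<bar>\<tau> 0 t\<bar> * (?K * \<rho>)))
          \<le> (2 * ?K\<^sup>2) * exp (- v 0 t) * (1 + ?Z) * ?E"
        unfolding w .
    qed
  qed
  then show ?thesis
    unfolding kernel_expands_def kernel_bound_def using K r
    by (intro exI[of _ "2 * ?K\<^sup>2"] exI[of _ ?K]) simp
qed

lemma kernel_expands_kernels:
  "kernel_expands M (cd_cartesian :: _ \<Rightarrow> 'r::finite cd)"
  "kernel_expands M (cd_spherical :: _ \<Rightarrow> 'r::finite cd)"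
proof -
  consider "CARD('r) = 1" | "2 \<le> CARD('r)"
    using zero_less_card_finite[where 'a='r] by linarith
  then have "kernel_expands M (cd_cartesian :: _ \<Rightarrow> 'r cd) \<and> kernel_expands M (cd_spherical :: _ \<Rightarrow> 'r cd)"
  proof cases
    case 1
    then show ?thesis
      by (intro conjI kernel_expands_complex)
         (simp_all add: cd_cartesian_def cd_spherical_def spherical_coeff_def)
  qed (simp add: kernel_expands_cartesian kernel_expands_spherical)
  then show "kernel_expands M (cd_cartesian :: _ \<Rightarrow> 'r::finite cd)"
    "kernel_expands M (cd_spherical :: _ \<Rightarrow> 'r::finite cd)" by auto
qed

section \<open>Kernel arguments as affine functions of the variables\<close>

lemma cd_coord_truncate:
  assumes "n \<le> 2 ^ CARD('r) - 1"
  shows "cd_coord (cd_truncate n z :: 'r::finite cd) k = (if k \<le> n then cd_coord z k else 0)"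
proof -
  have "(\<Sum>j\<le>n. cd_coord z j * cd_coord (cd_i j :: 'r cd) k)
      = (\<Sum>j\<le>n. if j = k then cd_coord z j else 0)"
    using assms two_le_power_card[where 'r='r] by (intro sum.cong) (auto simp: cd_coord_i)
  then show ?thesis by (simp add: cd_truncate_def)
qed

text \<open>The factor of p_j in the j-th argument. For j > n the term \<open>t $ e j\<close> has no
  meaning for the kernel, but it is multiplied by a truncated coordinate, which is 0.\<close>

definition cartesian_scale :: "nat \<Rightarrow> (nat \<Rightarrow> 'n) \<Rightarrow> nat \<Rightarrow> real ^ 'n \<Rightarrow> real"
  where "cartesian_scale n e j t = (if j = 0 then \<Sum>m=1..n. t $ e m else t $ e j)"

text \<open>The lower limit \<open>max 1 j\<close> lets the index 0 share the full sum s_1, which is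
  the factor of p_0.\<close>

definition spherical_scale :: "nat \<Rightarrow> (nat \<Rightarrow> 'n) \<Rightarrow> nat \<Rightarrow> real ^ 'n \<Rightarrow> real"
  where "spherical_scale n e j t = (\<Sum>m=max 1 j..n. t $ e m)"

lemma cartesian_kernel_eq:
  fixes p \<zeta> :: "'r::finite cd"
  assumes n: "n \<le> 2 ^ CARD('r) - 1"
  shows "cartesian_kernel n e (cd_truncate n p) t (cd_truncate n \<zeta>) =
    cd_cartesian (\<lambda>j. cd_coord (cd_truncate n p) j * cartesian_scale n e j t
      + cd_coord (cd_truncate n \<zeta>) j)"
proof (rule cd_eqI)
  fix k assume k: "k < (2::nat) ^ CARD('r)"
  have "(\<Sum>j=1..n. x j * cd_coord (cd_i j :: 'r cd) k) = (if 1 \<le> k \<and> k \<le> n then x k else 0)" for x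
  proof -
    have "(\<Sum>j=1..n. x j * cd_coord (cd_i j :: 'r cd) k) = (\<Sum>j=1..n. if j = k then x j else 0)"
      using n two_le_power_card[where 'r='r] by (intro sum.cong) (auto simp: cd_coord_i)
    then show ?thesis by simp
  qed
  then show "cd_coord (cartesian_kernel n e (cd_truncate n p) t (cd_truncate n \<zeta>)) k =
      cd_coord (cd_cartesian (\<lambda>j. cd_coord (cd_truncate n p) j * cartesian_scale n e j t
        + cd_coord (cd_truncate n \<zeta>) j) :: 'r cd) k"
    unfolding cartesian_kernel_def cd_cartesian_def cd_coord_simps(2) cd_coord_imag_sum
    using k by (auto simp: cartesian_scale_def one_cd_def cd_coord_i cd_coord_truncate[OF n])
qed

lemma spherical_kernel_eq:
  fixes p \<zeta> :: "'r::finite cd"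
  shows "spherical_kernel n e p t \<zeta> =
    cd_spherical (\<lambda>j. cd_coord p j * spherical_scale n e j t + cd_coord \<zeta> j)"
proof -
  have s: "spherical_scale n e j t = (\<Sum>m=j..n. t $ e m)" if "1 \<le> j" for j
    using that by (simp add: spherical_scale_def max_def)
  have s0: "spherical_scale n e 0 t = (\<Sum>m=1..n. t $ e m)"
    by (simp add: spherical_scale_def)
  have s_Suc: "spherical_scale n e (k + 1) t = (\<Sum>m=k+1..n. t $ e m)" for k
    by (rule s) simp
  have prod: "(\<Prod>m=2..k. sin (cd_coord p m * spherical_scale n e m t + cd_coord \<zeta> m))
      = (\<Prod>m=2..k. sin (cd_coord p m * (\<Sum>l=m..n. t $ e l) + cd_coord \<zeta> m))" for k
    by (intro prod.cong) (auto simp: s)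
  show ?thesis
    unfolding spherical_kernel_def cd_spherical_def spherical_coeff_def Let_def s0 s_Suc prod
    by (simp add: s scaleR_add_left mult.assoc)
qed

section \<open>Holomorphy of the image\<close>

text \<open>By completeness of Lebesgue measure the set of continuity points is measurable; the
  function is continuous on it, and the exceptional null set does not affect measurability.\<close>

lemma borel_measurable_lebesgue_if_AE_isCont:
  fixes f :: "'a::euclidean_space \<Rightarrow> 'b::euclidean_space"
  assumes "AE t in lebesgue. isCont f t"
  shows "f \<in> borel_measurable lebesgue"
proof -
  let ?S = "{t. isCont f t}"
  obtain N where N: "N \<in> null_sets lebesgue" "- ?S \<subseteq> N"
    using assms by (auto simp: eventually_ae_filter)
  then have "- ?S \<in> null_sets lebesgue"
    using complete_measure.complete null_sets_completion_subset by blast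
  then have "?S \<in> sets lebesgue"
    using null_setsD2 by (metis Compl_in_sets_lebesgue)
  moreover have "continuous_on ?S f"
    by (simp add: continuous_at_imp_continuous_on)
  ultimately have "f \<in> borel_measurable (lebesgue_on ?S)"
    by (intro continuous_imp_measurable_on_sets_lebesgue)
  then have "(\<lambda>t. if t \<in> ?S then f t else 0) \<in> borel_measurable lebesgue"
    using borel_measurable_if[OF \<open>?S \<in> sets lebesgue\<close>] by blast
  moreover have "AE t in lebesgue. (if t \<in> ?S then f t else 0) = f t"
    using assms by (rule AE_mp) auto
  ultimately show ?thesis
    by (rule borel_measurable_AE)
qed

lemma nn_integral_exp_minus_abs_finite:
  assumes "0 < \<epsilon>"
  shows "(\<integral>\<^sup>+x. ennreal (exp (- \<epsilon> * \<bar>x\<bar>)) \<partial>lborel) < \<infinity>"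
proof -
  define g :: "real \<Rightarrow> real" where "g x = (if x \<in> {0..} then exp (- \<epsilon> * x) else 0)" for x
  have [measurable]: "g \<in> borel_measurable borel" unfolding g_def by measurable
  have "(g has_integral exp (- \<epsilon> * 0) / \<epsilon>) UNIV"
    unfolding g_def has_integral_restrict_UNIV by (rule has_integral_exp_minus_to_infinity[OF assms])
  then have g: "(\<integral>\<^sup>+x. ennreal (g x) \<partial>lborel) < \<infinity>"
    by (subst nn_integral_has_integral_lborel) (auto simp: g_def)
  have "(\<integral>\<^sup>+x. ennreal (exp (- \<epsilon> * \<bar>x\<bar>)) \<partial>lborel)
      \<le> (\<integral>\<^sup>+x. ennreal (g x) + ennreal (g (0 + (-1) * x)) \<partial>lborel)"
    by (intro nn_integral_mono) (auto simp: g_def simp flip: ennreal_plus intro!: ennreal_leI)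
  also have "\<dots> = (\<integral>\<^sup>+x. ennreal (g x) \<partial>lborel) + (\<integral>\<^sup>+x. ennreal (g (0 + (-1) * x)) \<partial>lborel)"
    by (intro nn_integral_add) measurable
  also have "(\<integral>\<^sup>+x. ennreal (g (0 + (-1) * x)) \<partial>lborel) = (\<integral>\<^sup>+x. ennreal (g x) \<partial>lborel)"
    using nn_integral_real_affine[of "\<lambda>x. ennreal (g x)" "-1" 0] by simp
  finally show ?thesis using g by (auto simp: ennreal_add_eq_top less_top intro: le_less_trans)
qed

text \<open>The l1 norm is chosen because its exponential factorises over the coordinates, which
  reduces the integral to a product of one-dimensional ones.\<close>

lemma integrable_exp_minus_l1:
  assumes "0 < \<epsilon>"
  shows "integrable lebesgue (\<lambda>t :: real ^ 'n. exp (- \<epsilon> * (\<Sum>i\<in>UNIV. \<bar>t $ i\<bar>)))"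
proof -
  have Basis: "(\<Sum>b\<in>Basis. \<bar>t \<bullet> b\<bar>) = (\<Sum>i\<in>UNIV. \<bar>t $ i\<bar>)" for t :: "real ^ 'n"
    by (simp add: Basis_vec_def sum.UNION_disjoint axis_eq_axis inner_axis UNION_singleton_eq_range
        sum.reindex inj_on_def)
  have "(\<integral>\<^sup>+t. ennreal (exp (- \<epsilon> * (\<Sum>i\<in>UNIV. \<bar>t $ i\<bar>))) \<partial>(lborel :: (real ^ 'n) measure))
      = (\<integral>\<^sup>+t. (\<Prod>b\<in>(Basis :: (real ^ 'n) set). ennreal (exp (- \<epsilon> * \<bar>t \<bullet> b\<bar>))) \<partial>lborel)"
    by (intro nn_integral_cong)
       (simp add: prod_ennreal sum_distrib_left flip: Basis exp_sum)
  also have "\<dots> = (\<Prod>b\<in>(Basis :: (real ^ 'n) set). (\<integral>\<^sup>+x. ennreal (exp (- \<epsilon> * \<bar>x\<bar>)) \<partial>lborel))"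
    by (rule nn_integral_lborel_prod) auto
  also have "\<dots> < \<infinity>"
    using nn_integral_exp_minus_abs_finite[OF assms]
    by (simp add: power_less_top_ennreal)
  finally have "integrable lborel (\<lambda>t :: real ^ 'n. exp (- \<epsilon> * (\<Sum>i\<in>UNIV. \<bar>t $ i\<bar>)))"
    by (intro integrableI_bounded) auto
  then show ?thesis by (subst integrable_completion) auto
qed

text \<open>Coordinatewise: for t_i >= 0 the exponent a_1 - P is at most -\<epsilon>, and for t_i <
  0 the exponent a_(-1) - P is at least \<epsilon>. Either way the contribution to the exponent is
  at most -\<epsilon> |t_i|.\<close>

lemma growth_exponents_decay:
  fixes f :: "real ^ 'n \<Rightarrow> 'r::finite cd"
  assumes "growth_exponents f a" and \<epsilon>: "\<epsilon> \<le> P - a 1" "\<epsilon> \<le> a (- 1) - P"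
  obtains C where "0 \<le> C"
    "\<And>t. norm (f t) * exp (- P * (\<Sum>i\<in>UNIV. t $ i)) \<le> C * exp (- \<epsilon> * (\<Sum>i\<in>UNIV. \<bar>t $ i\<bar>))"
proof -
  \<comment> \<open>Orthants are indexed by the set of their coordinates of sign 1. They are finite
    in number, so the sum of their constants serves for all t.\<close>
  define v where "v S i = (if i \<in> S then 1 else - 1 :: int)" for S :: "'n set" and i
  have "\<exists>C>0. \<forall>t. (\<forall>j. of_int (v S j) * t $ j \<ge> 0) \<longrightarrow>
      norm (f t) < C * exp (\<Sum>j\<in>UNIV. a (v S j) * t $ j)" for S
  proof -
    have "range (v S) \<subseteq> {-1, 1}" by (auto simp: v_def)
    with assms(1) show ?thesis unfolding growth_exponents_def by blast
  qed
  then obtain C where C: "\<And>S. 0 < C S" "\<And>S t. (\<forall>j. of_int (v S j) * t $ j \<ge> 0) \<Longrightarrow>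
      norm (f t) < C S * exp (\<Sum>j\<in>UNIV. a (v S j) * t $ j)" by metis
  show thesis
  proof (rule that)
    show "0 \<le> (\<Sum>S\<in>UNIV. C S)" using C(1) by (simp add: sum_nonneg less_imp_le)
    fix t :: "real ^ 'n"
    let ?S = "{i. 0 \<le> t $ i}"
    have "a (v ?S i) * t $ i + (- P * t $ i) \<le> - \<epsilon> * \<bar>t $ i\<bar>" for i
    proof (cases "0 \<le> t $ i")
      case True
      then show ?thesis using mult_right_mono[OF \<epsilon>(1) True] by (simp add: v_def algebra_simps)
    next
      case False
      then show ?thesis
        using mult_right_mono[OF \<epsilon>(2), of "- t $ i"] by (simp add: v_def algebra_simps)
    qed
    then have "(\<Sum>i\<in>UNIV. a (v ?S i) * t $ i + (- P * t $ i)) \<le> (\<Sum>i\<in>UNIV. - \<epsilon> * \<bar>t $ i\<bar>)"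
      by (rule sum_mono)
    then have le: "(\<Sum>i\<in>UNIV. a (v ?S i) * t $ i) + - P * (\<Sum>i\<in>UNIV. t $ i)
        \<le> - \<epsilon> * (\<Sum>i\<in>UNIV. \<bar>t $ i\<bar>)"
      by (simp only: sum.distrib sum_distrib_left)
    have "norm (f t) \<le> C ?S * exp (\<Sum>i\<in>UNIV. a (v ?S i) * t $ i)"
      using C(2)[of ?S t] by (auto simp: v_def intro: less_imp_le)
    then have "norm (f t) * exp (- P * (\<Sum>i\<in>UNIV. t $ i))
        \<le> (C ?S * exp (\<Sum>i\<in>UNIV. a (v ?S i) * t $ i)) * exp (- P * (\<Sum>i\<in>UNIV. t $ i))"
      by (rule mult_right_mono) simp
    also have "\<dots> = C ?S * exp ((\<Sum>i\<in>UNIV. a (v ?S i) * t $ i) + - P * (\<Sum>i\<in>UNIV. t $ i))"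
      by (simp only: exp_add mult.assoc)
    also have "\<dots> \<le> (\<Sum>S\<in>UNIV. C S) * exp (- \<epsilon> * (\<Sum>i\<in>UNIV. \<bar>t $ i\<bar>))"
    proof (intro mult_mono)
      show "C ?S \<le> (\<Sum>S\<in>UNIV. C S)"
        by (rule member_le_sum) (use C(1) in \<open>auto simp: less_imp_le\<close>)
      show "0 \<le> (\<Sum>S\<in>UNIV. C S)" using C(1) by (simp add: sum_nonneg less_imp_le)
    qed (use le in auto)
    finally show "norm (f t) * exp (- P * (\<Sum>i\<in>UNIV. t $ i))
        \<le> (\<Sum>S\<in>UNIV. C S) * exp (- \<epsilon> * (\<Sum>i\<in>UNIV. \<bar>t $ i\<bar>))" .
  qed
qed

section \<open>Expansion of the integrand and of its integral\<close>

lemma abs_coord_sum_le: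
  "(\<Sum>l<2 ^ CARD('r). \<bar>cd_coord x l\<bar>) \<le> 2 ^ CARD('r) * norm x" for x :: "'r::finite cd"
  using sum_bounded_above[of "{..<2 ^ CARD('r)}" "\<lambda>l. \<bar>cd_coord x l\<bar>" "norm x"] abs_cd_coord_le[of x]
  by simp

lemma measurable_cd_coord:
  assumes [measurable]: "f \<in> borel_measurable M"
  shows "(\<lambda>t. cd_coord (f t :: 'r::finite cd) l) \<in> borel_measurable M"
proof (cases "l < 2 ^ CARD('r)")
  case True
  then have "(\<lambda>t. cd_coord (f t) l) = (\<lambda>t. inner (f t) (cd_i l))" by (simp add: inner_cd_i)
  then show ?thesis by simp
qed (simp add: cd_coord_eq_0)

text \<open>Coefficients of an expansion must be real, so an algebra-valued function of
  \<open>t\<close> is distributed over the constants i_l.\<close>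

lemma expands_measurable:
  fixes f :: "'t \<Rightarrow> 'r::finite cd"
  assumes "f \<in> borel_measurable M"
  shows "expands M \<rho> (\<lambda>t h. f t)
    (\<lambda>t. 2 ^ CARD('r) * cd_mult_const TYPE('r) * norm (f t))"
proof (rule expands_cong)
  let ?K = "cd_mult_const TYPE('r)"
  show "expands M \<rho> (\<lambda>t h. \<Sum>l<2 ^ CARD('r). cd_coord (f t) l *\<^sub>R (cd_i l :: 'r cd))
      (\<lambda>t. \<Sum>l<2 ^ CARD('r). \<bar>cd_coord (f t) l\<bar> * cd_wnorm (cd_i l :: 'r cd))"
    by (intro expands_sum expands_scale expands_const measurable_cd_coord assms)
  show "(\<Sum>l<2 ^ CARD('r). cd_coord (f t) l *\<^sub>R (cd_i l :: 'r cd)) = f t" for t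
    by (rule cd_expand[symmetric])
  fix t
  have "(\<Sum>l<2 ^ CARD('r). \<bar>cd_coord (f t) l\<bar> * cd_wnorm (cd_i l :: 'r cd))
      = (\<Sum>l<2 ^ CARD('r). \<bar>cd_coord (f t) l\<bar>) * ?K"
    unfolding sum_distrib_right by (intro sum.cong) (auto simp: cd_wnorm_i)
  also have "\<dots> \<le> (2 ^ CARD('r) * norm (f t)) * ?K"
    using cd_mult_const(1)[where 'r='r] by (intro mult_right_mono abs_coord_sum_le) auto
  finally show "(\<Sum>l<2 ^ CARD('r). \<bar>cd_coord (f t) l\<bar> * cd_wnorm (cd_i l :: 'r cd))
      \<le> 2 ^ CARD('r) * ?K * norm (f t)" by (simp add: mult_ac)
qed

text \<open>The decay budget: \<epsilon> is half the distance of \<open>P\<close> from the ends of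
  the strip, so the original times exp (- Re u) decays at rate 2 \<epsilon>. The linear factor of
  the kernel bound takes \<epsilon> / 2, the increment another \<epsilon> / 2, and rate \<epsilon>
  is left for integrability. The bound 1 + S on the slopes fits increments of p, with slopes up to
  S, as well as those of \<zeta>, with slopes at most 1.\<close>

lemma kernel_integral_expansion:
  fixes f :: "real ^ 'n \<Rightarrow> 'r::finite cd" and v \<tau> :: "nat \<Rightarrow> real ^ 'n \<Rightarrow> real"
  defines "S \<equiv> (\<lambda>t :: real ^ 'n. \<Sum>i\<in>UNIV. \<bar>t $ i\<bar>)"
  assumes U: "kernel_expands (lebesgue :: (real ^ 'n) measure) (U :: _ \<Rightarrow> 'r cd)"
    and f: "f \<in> borel_measurable lebesgue"
    and growth: "growth_exponents f a" and P: "a 1 < P" "P < a (- 1)"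
    and meas: "\<And>j. v j \<in> borel_measurable lebesgue" "\<And>j. \<tau> j \<in> borel_measurable lebesgue"
    and \<tau>01: "CARD('r) = 1 \<Longrightarrow> \<tau> 0 = \<tau> 1"
    and v0: "\<And>t. v 0 t = P * (\<Sum>i\<in>UNIV. t $ i) + z"
    and v: "\<And>j t. \<bar>v j t\<bar> \<le> c * (1 + S t)" and \<tau>: "\<And>j t. \<bar>\<tau> j t\<bar> \<le> 1 + S t"
  shows "\<exists>\<rho>0>0. \<forall>\<rho>. 0 < \<rho> \<and> \<rho> \<le> \<rho>0 \<longrightarrow>
    integral_expands lebesgue \<rho> (\<lambda>t h. f t * cd_exp (- U (\<lambda>j. v j t + \<tau> j t * cd_coord h j)))"
proof -
  let ?K = "cd_mult_const TYPE('r)"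
  define N :: real where "N = 2 ^ CARD('r)"
  have K: "1 \<le> ?K" by (rule cd_mult_const)
  have N: "1 \<le> N" by (simp add: N_def)
  have S0: "0 \<le> S t" for t by (simp add: S_def sum_nonneg)
  have c: "0 \<le> c"
  proof -
    have "0 \<le> c * (1 + S 0)" using v[of 0 0] abs_ge_zero[of "v 0 0"] by linarith
    then show ?thesis using S0[of 0] by (simp add: zero_le_mult_iff)
  qed
  define \<epsilon> where "\<epsilon> = min (P - a 1) (a (- 1) - P) / 2"
  have \<epsilon>: "0 < \<epsilon>" "2 * \<epsilon> \<le> P - a 1" "2 * \<epsilon> \<le> a (- 1) - P"
    using P by (auto simp: \<epsilon>_def)
  obtain Cf where Cf0: "0 \<le> Cf" and Cf1: "\<And>t. norm (f t) * exp (- P * (\<Sum>i\<in>UNIV. t $ i))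
      \<le> Cf * exp (- (2 * \<epsilon>) * (\<Sum>i\<in>UNIV. \<bar>t $ i\<bar>))"
    by (rule growth_exponents_decay[OF growth \<epsilon>(2,3)]) (rule that)
  have Cf: "norm (f t) * exp (- P * (\<Sum>i\<in>UNIV. t $ i)) \<le> Cf * exp (- (2 * \<epsilon>) * S t)" for t
    unfolding S_def by (rule Cf1)
  obtain C L where CL': "0 \<le> C \<and> 0 \<le> L \<and> kernel_bound (lebesgue :: (real ^ 'n) measure) U C L"
    using U unfolding kernel_expands_def by (elim exE) (rule that)
  then have C: "0 \<le> C" and L: "0 \<le> L" and CL: "kernel_bound (lebesgue :: (real ^ 'n) measure) U C L"
    by simp_all
  have ex: "expands lebesgue \<rho> (\<lambda>t h :: 'r cd. cd_exp (- U (\<lambda>j. v j t + \<tau> j t * cd_coord h j)))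
        (\<lambda>t. C * exp (- v 0 t) * (1 + (\<Sum>j<2 ^ CARD('r). \<bar>v j t\<bar>)) *
          exp (L * \<rho> * (\<Sum>j<2 ^ CARD('r). \<bar>\<tau> j t\<bar>)))" if "0 \<le> \<rho>" for \<rho>
    by (rule CL[unfolded kernel_bound_def, rule_format, OF that meas \<tau>01])
  \<comment> \<open>Chosen so that (L + 1) \<rho>0 N = \<epsilon> / 2, where N counts the slopes;
    using L + 1 avoids a division by zero when L = 0.\<close>
  define \<rho>0 where "\<rho>0 = \<epsilon> / (2 * (L + 1) * N)"
  have \<rho>0: "0 < \<rho>0" using \<epsilon> L N by (simp add: \<rho>0_def)
  have L\<rho>: "L * \<rho> * N \<le> \<epsilon> / 2" if "0 < \<rho>" "\<rho> \<le> \<rho>0" for \<rho>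
  proof -
    have "L * \<rho> * N \<le> (L + 1) * \<rho>0 * N"
      using that L N by (intro mult_right_mono mult_mono) auto
    moreover have "x * (\<epsilon> / (2 * x * N)) * N = \<epsilon> / 2" if "0 < x" for x using that N by simp
    then have "(L + 1) * \<rho>0 * N = \<epsilon> / 2" using L unfolding \<rho>0_def
      by (metis add_nonneg_pos zero_less_one)
    ultimately show ?thesis by simp
  qed
  define D where "D = N * ?K * C * exp (- z) * Cf * ((1 + N * c) * (1 + 2 / \<epsilon>)) * exp (\<epsilon> / 2)"
  define W where "W t = D * exp (- \<epsilon> * S t)" for t
  have W: "integrable lebesgue W"
    unfolding W_def S_def using integrable_exp_minus_l1[OF \<epsilon>(1)] by (intro integrable_mult_right)
  have "integral_expands lebesgue \<rho> (\<lambda>t h. f t * cd_exp (- U (\<lambda>j. v j t + \<tau> j t * cd_coord h j)))"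
    if \<rho>: "0 < \<rho>" "\<rho> \<le> \<rho>0" for \<rho>
  proof (rule integral_expandsI[OF expands_mult[OF expands_measurable[OF f] ex] W])
    show "0 \<le> \<rho>" using \<rho> by simp
    fix t
    have v': "1 + (\<Sum>j<2 ^ CARD('r). \<bar>v j t\<bar>) \<le> (1 + N * c) * (1 + S t)"
      using sum_bounded_above[of "{..<2 ^ CARD('r)}" "\<lambda>j. \<bar>v j t\<bar>" "c * (1 + S t)"] v S0[of t]
      by (simp add: N_def algebra_simps)
    \<comment> \<open>Trades the linear growth for a small exponential: after this, 1 + x <= exp x
      with x = \<epsilon> S / 2.\<close>
    have "1 + S t \<le> (1 + 2 / \<epsilon>) * (1 + \<epsilon> / 2 * S t)"
      using \<epsilon>(1) S0[of t] by (simp add: field_simps)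
    also have "\<dots> \<le> (1 + 2 / \<epsilon>) * exp (\<epsilon> / 2 * S t)"
      using \<epsilon>(1) by (intro mult_left_mono exp_ge_add_one_self) auto
    finally have "(1 + N * c) * (1 + S t) \<le> (1 + N * c) * ((1 + 2 / \<epsilon>) * exp (\<epsilon> / 2 * S t))"
      using N c by (intro mult_left_mono) auto
    with v' have v'': "1 + (\<Sum>j<2 ^ CARD('r). \<bar>v j t\<bar>)
        \<le> ((1 + N * c) * (1 + 2 / \<epsilon>)) * exp (\<epsilon> / 2 * S t)"
      by (simp add: mult.assoc)
    have "(\<Sum>j<2 ^ CARD('r). \<bar>\<tau> j t\<bar>) \<le> N * (1 + S t)"
      using sum_bounded_above[of "{..<2 ^ CARD('r)}" "\<lambda>j. \<bar>\<tau> j t\<bar>" "1 + S t"] \<tau> by (simp add: N_def)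
    then have "L * \<rho> * (\<Sum>j<2 ^ CARD('r). \<bar>\<tau> j t\<bar>) \<le> L * \<rho> * (N * (1 + S t))"
      using L \<rho> by (intro mult_left_mono) auto
    also have "\<dots> = (L * \<rho> * N) * (1 + S t)" by simp
    also have "\<dots> \<le> \<epsilon> / 2 * (1 + S t)" using L\<rho>[OF \<rho>] S0[of t] by (intro mult_right_mono) auto
    finally have t': "exp (L * \<rho> * (\<Sum>j<2 ^ CARD('r). \<bar>\<tau> j t\<bar>)) \<le> exp (\<epsilon> / 2) * exp (\<epsilon> / 2 * S t)"
      by (simp add: distrib_left flip: exp_add)
    have ev0: "exp (- v 0 t) = exp (- z) * exp (- P * (\<Sum>i\<in>UNIV. t $ i))"
      by (simp add: v0 flip: exp_add)
    have "2 ^ CARD('r) * ?K * norm (f t) * (C * exp (- v 0 t) * (1 + (\<Sum>j<2 ^ CARD('r). \<bar>v j t\<bar>)) *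
          exp (L * \<rho> * (\<Sum>j<2 ^ CARD('r). \<bar>\<tau> j t\<bar>)))
        = (N * ?K * C * exp (- z)) * (norm (f t) * exp (- P * (\<Sum>i\<in>UNIV. t $ i))) *
          (1 + (\<Sum>j<2 ^ CARD('r). \<bar>v j t\<bar>)) * exp (L * \<rho> * (\<Sum>j<2 ^ CARD('r). \<bar>\<tau> j t\<bar>))"
      unfolding ev0 N_def by (simp add: mult_ac)
    also have "\<dots> \<le> (N * ?K * C * exp (- z)) * (Cf * exp (- (2 * \<epsilon>) * S t)) *
          (((1 + N * c) * (1 + 2 / \<epsilon>)) * exp (\<epsilon> / 2 * S t)) * (exp (\<epsilon> / 2) * exp (\<epsilon> / 2 * S t))"
      using N K C Cf0 c \<epsilon>(1)
      by (intro mult_mono mult_left_mono Cf v'' t') (auto intro!: add_nonneg_nonneg sum_nonneg)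
    also have "\<dots> = D * (exp (- (2 * \<epsilon>) * S t) * exp (\<epsilon> / 2 * S t) * exp (\<epsilon> / 2 * S t))"
      by (simp only: D_def mult_ac)
    also have "exp (- (2 * \<epsilon>) * S t) * exp (\<epsilon> / 2 * S t) * exp (\<epsilon> / 2 * S t) = exp (- \<epsilon> * S t)"
      by (simp flip: exp_add)
    finally show "2 ^ CARD('r) * ?K * norm (f t) * (C * exp (- v 0 t) * (1 + (\<Sum>j<2 ^ CARD('r). \<bar>v j t\<bar>)) *
          exp (L * \<rho> * (\<Sum>j<2 ^ CARD('r). \<bar>\<tau> j t\<bar>))) \<le> W t"
      by (simp add: W_def)
  qed
  with \<rho>0 show ?thesis by blast
qed

text \<open>Expansions are asked for all sufficiently small radii because the ball must still be
  shrunk until it lies inside the domain.\<close>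

lemma cd_holomorphic_onI:
  fixes F :: "'r::finite cd \<Rightarrow> 'r cd"
  assumes "open U"
    and g: "\<And>z0. z0 \<in> U \<Longrightarrow> \<exists>\<rho>0>0. \<forall>\<rho>. 0 < \<rho> \<and> \<rho> \<le> \<rho>0 \<longrightarrow> integral_expands M \<rho> (g z0)"
    and F: "\<And>z0 h. F (z0 + h) = (LINT t|M. g z0 t h)"
  shows "F cd_holomorphic_on U"
  unfolding cd_holomorphic_on_def
proof
  fix z0 assume z0: "z0 \<in> U"
  obtain \<rho>1 where \<rho>1: "0 < \<rho>1" "ball z0 \<rho>1 \<subseteq> U"
    using assms(1) z0 open_contains_ball by blast
  obtain \<rho>0 where \<rho>0: "0 < \<rho>0" "\<forall>\<rho>. 0 < \<rho> \<and> \<rho> \<le> \<rho>0 \<longrightarrow> integral_expands M \<rho> (g z0)"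
    using g[OF z0] by blast
  define \<rho> where "\<rho> = min \<rho>0 \<rho>1"
  have \<rho>: "0 < \<rho>" "\<rho> \<le> \<rho>0" using \<rho>0(1) \<rho>1(1) by (simp_all add: \<rho>_def)
  then have "integral_expands M \<rho> (g z0)" using \<rho>0(2) by blast
  then obtain m b where mb: "summable b" "\<forall>h. norm h < \<rho> \<longrightarrow>
      (\<forall>k. norm (na_eval (m k) h) \<le> b k) \<and> (\<lambda>k. na_eval (m k) h) sums (LINT t|M. g z0 t h)"
    unfolding integral_expands_def by (elim exE conjE)
  have "\<forall>z\<in>ball z0 \<rho>. (\<forall>k. norm (na_eval (m k) (z - z0)) \<le> b k) \<and>
      (\<lambda>k. na_eval (m k) (z - z0)) sums F z"
  proof
    fix z assume "z \<in> ball z0 \<rho>"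
    then have "norm (z - z0) < \<rho>" by (simp add: dist_norm norm_minus_commute)
    with mb(2) have "(\<forall>k. norm (na_eval (m k) (z - z0)) \<le> b k) \<and>
        (\<lambda>k. na_eval (m k) (z - z0)) sums F (z0 + (z - z0))"
      unfolding F by blast
    then show "(\<forall>k. norm (na_eval (m k) (z - z0)) \<le> b k) \<and>
        (\<lambda>k. na_eval (m k) (z - z0)) sums F z" by simp
  qed
  moreover have "ball z0 \<rho> \<subseteq> U" using \<rho>1(2) by (auto simp: \<rho>_def)
  ultimately show "\<exists>\<rho>>0. ball z0 \<rho> \<subseteq> U \<and> (\<exists>m B. summable B \<and> (\<forall>z\<in>ball z0 \<rho>.
      (\<forall>k. norm (na_eval (m k) (z - z0)) \<le> B k) \<and> (\<lambda>k. na_eval (m k) (z - z0)) sums F z))"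
    using \<rho>(1) mb(1) by blast
qed

lemma open_growth_strip: "open (growth_strip a :: 'r::finite cd set)"
proof -
  have "cd_Re z = inner z (cd_i 0)" for z :: "'r cd"
    by (simp add: cd_Re_def inner_cd_i)
  then have "growth_strip a = {z :: 'r cd. a 1 < inner z (cd_i 0)} \<inter> {z. inner z (cd_i 0) < a (- 1)}"
    by (auto simp: growth_strip_def)
  then show ?thesis
    by (auto intro!: open_Int open_Collect_less continuous_intros)
qed

text \<open>Both holomorphy claims come from one estimate: an increment of p acts on the j-th
  argument with slope \<open>\<sigma> j\<close>, an increment of \<zeta> with slope 1, and
  truncation sets the slopes beyond n to 0. Since n >= 1, the slopes of indices 0 and 1 survive
  together, as the complex case requires. Integrability is the case h = 0.\<close>

lemma laplace_image_holomorphic: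
  fixes f :: "real ^ 'n \<Rightarrow> 'r::finite cd" and \<sigma> :: "nat \<Rightarrow> real ^ 'n \<Rightarrow> real"
  assumes n: "1 \<le> n" "n \<le> 2 ^ CARD('r) - 1"
    and U: "kernel_expands (lebesgue :: (real ^ 'n) measure) (U :: _ \<Rightarrow> 'r cd)"
    and f: "f \<in> borel_measurable lebesgue"
    and growth: "growth_exponents f a"
    and u: "\<And>p t \<zeta>. u (cd_truncate n p) t (cd_truncate n \<zeta>) =
      U (\<lambda>j. cd_coord (cd_truncate n p) j * \<sigma> j t + cd_coord (cd_truncate n \<zeta>) j)"
    and [measurable]: "\<And>j. \<sigma> j \<in> borel_measurable lebesgue"
    and \<sigma>: "\<And>j t. \<bar>\<sigma> j t\<bar> \<le> (\<Sum>i\<in>UNIV. \<bar>t $ i\<bar>)" and \<sigma>0: "\<And>t. \<sigma> 0 t = (\<Sum>i\<in>UNIV. t $ i)"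
    and \<sigma>01: "CARD('r) = 1 \<Longrightarrow> \<sigma> 0 = \<sigma> 1"
  shows "(\<forall>p\<in>growth_strip a. \<forall>\<zeta>. integrable lebesgue (image_integrand n f u p \<zeta>)) \<and>
    (\<forall>\<zeta>. (\<lambda>p. laplace_image n f u p \<zeta>) cd_holomorphic_on growth_strip a) \<and>
    (\<forall>p\<in>growth_strip a. (\<lambda>\<zeta>. laplace_image n f u p \<zeta>) cd_holomorphic_on UNIV)"
proof -
  let ?T = "cd_truncate n :: 'r cd \<Rightarrow> 'r cd"
  note T = cd_coord_truncate[OF n(2)]
  define v where "v p \<zeta> j t = cd_coord (?T p) j * \<sigma> j t + cd_coord (?T \<zeta>) j" for p \<zeta> j t
  define \<tau>p where "\<tau>p j t = (if j \<le> n then \<sigma> j t else 0)" for j t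
  define \<tau>z where "\<tau>z j t = (if j \<le> n then 1 else 0 :: real)" for j and t :: "real ^ 'n"
  have int_p: "image_integrand n f u (p + h) \<zeta>
      = (\<lambda>t. f t * cd_exp (- U (\<lambda>j. v p \<zeta> j t + \<tau>p j t * cd_coord h j)))" for p \<zeta> h
  proof -
    have "(\<lambda>j. cd_coord (?T (p + h)) j * \<sigma> j t + cd_coord (?T \<zeta>) j)
        = (\<lambda>j. v p \<zeta> j t + \<tau>p j t * cd_coord h j)" for t
      by (auto simp: fun_eq_iff v_def \<tau>p_def T algebra_simps)
    then show ?thesis by (simp add: fun_eq_iff image_integrand_def u)
  qed
  have int_z: "image_integrand n f u p (\<zeta> + h)
      = (\<lambda>t. f t * cd_exp (- U (\<lambda>j. v p \<zeta> j t + \<tau>z j t * cd_coord h j)))" for p \<zeta> h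
  proof -
    have "(\<lambda>j. cd_coord (?T p) j * \<sigma> j t + cd_coord (?T (\<zeta> + h)) j)
        = (\<lambda>j. v p \<zeta> j t + \<tau>z j t * cd_coord h j)" for t
      by (auto simp: fun_eq_iff v_def \<tau>z_def T algebra_simps)
    then show ?thesis by (simp add: fun_eq_iff image_integrand_def u)
  qed
  define g where "g \<tau> p \<zeta> t h = f t * cd_exp (- U (\<lambda>j. v p \<zeta> j t + \<tau> j t * cd_coord h j))"
    for \<tau> :: "nat \<Rightarrow> real ^ 'n \<Rightarrow> real" and p \<zeta> t and h :: "'r cd"
  have main: "\<exists>\<rho>0>0. \<forall>\<rho>. 0 < \<rho> \<and> \<rho> \<le> \<rho>0 \<longrightarrow> integral_expands lebesgue \<rho> (g \<tau> p \<zeta>)"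
    if p: "p \<in> growth_strip a" and \<tau>: "\<tau> = \<tau>p \<or> \<tau> = \<tau>z" for p \<zeta> \<tau>
    unfolding g_def[abs_def]
  proof (rule kernel_integral_expansion[OF U f growth, where P="cd_Re p" and z="cd_Re \<zeta>"
        and c="norm p + norm \<zeta>"])
    show "a 1 < cd_Re p" "cd_Re p < a (- 1)" using p by (auto simp: growth_strip_def)
    show "v p \<zeta> j \<in> borel_measurable lebesgue" for j unfolding v_def by measurable
    show "\<tau> j \<in> borel_measurable lebesgue" for j
      using \<tau> by (auto simp: \<tau>p_def[abs_def] \<tau>z_def[abs_def])
    show "\<tau> 0 = \<tau> 1" if "CARD('r) = 1"
      using \<tau> \<sigma>01[OF that] n(1) by (auto simp: \<tau>p_def[abs_def] \<tau>z_def[abs_def])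
    show "v p \<zeta> 0 t = cd_Re p * (\<Sum>i\<in>UNIV. t $ i) + cd_Re \<zeta>" for t
      by (simp add: v_def T \<sigma>0 cd_Re_def)
    have S0: "0 \<le> (\<Sum>i\<in>UNIV. \<bar>t $ i\<bar>)" for t :: "real ^ 'n" by (simp add: sum_nonneg)
    show "\<bar>\<tau> j t\<bar> \<le> 1 + (\<Sum>i\<in>UNIV. \<bar>t $ i\<bar>)" for j t
      using \<tau> \<sigma>[of j t] S0[of t] by (auto simp: \<tau>p_def \<tau>z_def)
    show "\<bar>v p \<zeta> j t\<bar> \<le> (norm p + norm \<zeta>) * (1 + (\<Sum>i\<in>UNIV. \<bar>t $ i\<bar>))" for j t
    proof -
      have Tle: "\<bar>cd_coord (?T x) j\<bar> \<le> norm x" for x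
        using abs_cd_coord_le[of x j] by (simp add: T)
      have "\<bar>v p \<zeta> j t\<bar> \<le> \<bar>cd_coord (?T p) j\<bar> * \<bar>\<sigma> j t\<bar> + \<bar>cd_coord (?T \<zeta>) j\<bar>"
        unfolding v_def by (simp add: abs_triangle_ineq flip: abs_mult)
      also have "\<dots> \<le> norm p * (1 + (\<Sum>i\<in>UNIV. \<bar>t $ i\<bar>)) + norm \<zeta> * (1 + (\<Sum>i\<in>UNIV. \<bar>t $ i\<bar>))"
      proof (intro add_mono mult_mono Tle)
        show "\<bar>\<sigma> j t\<bar> \<le> 1 + (\<Sum>i\<in>UNIV. \<bar>t $ i\<bar>)" using \<sigma>[of j t] by simp
        have "norm \<zeta> * 1 \<le> norm \<zeta> * (1 + (\<Sum>i\<in>UNIV. \<bar>t $ i\<bar>))"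
          using S0[of t] by (intro mult_left_mono) auto
        with Tle[of \<zeta>] show "\<bar>cd_coord (?T \<zeta>) j\<bar> \<le> norm \<zeta> * (1 + (\<Sum>i\<in>UNIV. \<bar>t $ i\<bar>))" by simp
      qed auto
      finally show ?thesis by (simp add: distrib_right)
    qed
  qed
  show ?thesis
  proof (intro conjI ballI allI)
    fix p \<zeta> assume p: "p \<in> (growth_strip a :: 'r cd set)"
    obtain \<rho> where "0 < \<rho>" "integral_expands lebesgue \<rho> (g \<tau>p p \<zeta>)"
      using main[OF p, of \<tau>p \<zeta>] by auto
    then have "integrable lebesgue (\<lambda>t. g \<tau>p p \<zeta> t 0)"
      unfolding integral_expands_def by simp
    then show "integrable lebesgue (image_integrand n f u p \<zeta>)"
      using int_p[of p 0 \<zeta>] by (simp add: g_def)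
  next
    fix \<zeta>
    show "(\<lambda>p. laplace_image n f u p \<zeta>) cd_holomorphic_on growth_strip a"
      by (rule cd_holomorphic_onI[OF open_growth_strip main[of _ \<tau>p \<zeta>]])
         (simp_all add: laplace_image_def int_p g_def)
  next
    fix p assume p: "p \<in> (growth_strip a :: 'r cd set)"
    show "(\<lambda>\<zeta>. laplace_image n f u p \<zeta>) cd_holomorphic_on UNIV"
      by (rule cd_holomorphic_onI[OF open_UNIV main[OF p, of \<tau>z]])
         (simp_all add: laplace_image_def int_z g_def)
  qed
qed

theorem theorem4:
  fixes r n :: nat
    and e :: "nat \<Rightarrow> 'n::finite"
    and f :: "real ^ 'n \<Rightarrow> 'r::finite cd"
    and a :: "int \<Rightarrow> real"
    and u :: "'r cd \<Rightarrow> real ^ 'n \<Rightarrow> 'r cd \<Rightarrow> 'r cd"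
  assumes "1 \<le> r" and "CARD('r) = r"
    and "2 ^ (r - 1) \<le> n" and "n \<le> 2 ^ r - 1"
    and "bij_betw e {1..n} UNIV"
    and "is_original f" and "growth_exponents f a" and "a 1 < a (-1)"
    and "u = cartesian_kernel n e \<or> u = spherical_kernel n e"
  shows "(\<forall>p\<in>growth_strip a. \<forall>\<zeta>. integrable lebesgue (image_integrand n f u p \<zeta>)) \<and>
    (\<forall>\<zeta>. (\<lambda>p. laplace_image n f u p \<zeta>) cd_holomorphic_on growth_strip a) \<and>
    (\<forall>p\<in>growth_strip a. (\<lambda>\<zeta>. laplace_image n f u p \<zeta>) cd_holomorphic_on UNIV)"
proof -
  have "(1::nat) \<le> 2 ^ (r - 1)" by simp
  then have "1 \<le> n" using assms(3) by (rule order_trans)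
  then have n: "1 \<le> n" "n \<le> 2 ^ CARD('r) - 1"
    using assms(2,4) by simp_all
  \<comment> \<open>For r = 1 the sum of all t_j is then t_1, so the Cartesian factors of p_0 and
    p_1 coincide.\<close>
  have n1: "n = 1" if "CARD('r) = 1" using n that by simp
  have f: "f \<in> borel_measurable lebesgue"
    using assms(6) by (intro borel_measurable_lebesgue_if_AE_isCont) (simp add: is_original_def)
  have sum_e: "(\<Sum>m=1..n. g (e m)) = (\<Sum>i\<in>UNIV. g i)" for g :: "'n \<Rightarrow> real"
    by (rule sum.reindex_bij_betw[OF assms(5)])
  have part: "\<bar>\<Sum>m\<in>I. t $ e m\<bar> \<le> (\<Sum>i\<in>UNIV. \<bar>t $ i\<bar>)" if "I \<subseteq> {1..n}" for I and t :: "real ^ 'n"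
  proof -
    have "\<bar>\<Sum>m\<in>I. t $ e m\<bar> \<le> (\<Sum>m\<in>I. \<bar>t $ e m\<bar>)" by (rule sum_abs)
    also have "\<dots> \<le> (\<Sum>m=1..n. \<bar>t $ e m\<bar>)" using that by (intro sum_mono2) auto
    finally show ?thesis unfolding sum_e[of "\<lambda>i. \<bar>t $ i\<bar>"] .
  qed
  have [measurable]: "(\<lambda>t :: real ^ 'n. t $ i) \<in> borel_measurable lebesgue" for i
    by (intro measurable_completion) measurable
  from assms(9) show ?thesis
  proof
    assume u: "u = cartesian_kernel n e"
    let ?\<sigma> = "cartesian_scale n e"
    show ?thesis
    proof (rule laplace_image_holomorphic[OF n kernel_expands_kernels(1) f assms(7), where \<sigma>="?\<sigma>"])
      show "u (cd_truncate n p) t (cd_truncate n \<zeta>) =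
          cd_cartesian (\<lambda>j. cd_coord (cd_truncate n p) j * ?\<sigma> j t + cd_coord (cd_truncate n \<zeta>) j)"
        for p t \<zeta> unfolding u by (rule cartesian_kernel_eq[OF n(2)])
      show "?\<sigma> j \<in> borel_measurable lebesgue" for j
        unfolding cartesian_scale_def[abs_def] by measurable
      show "\<bar>?\<sigma> j t\<bar> \<le> (\<Sum>i\<in>UNIV. \<bar>t $ i\<bar>)" for j t
      proof (cases "j = 0")
        case True
        then show ?thesis using part[of "{1..n}" t] by (simp add: cartesian_scale_def)
      next
        case False
        have "\<bar>t $ e j\<bar> \<le> (\<Sum>i\<in>UNIV. \<bar>t $ i\<bar>)" by (rule member_le_sum) auto
        then show ?thesis using False by (simp add: cartesian_scale_def)
      qed
      show "?\<sigma> 0 t = (\<Sum>i\<in>UNIV. t $ i)" for t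
        using sum_e[of "\<lambda>i. t $ i"] by (simp add: cartesian_scale_def)
      show "?\<sigma> 0 = ?\<sigma> 1" if "CARD('r) = 1"
        using n1[OF that] by (simp add: cartesian_scale_def fun_eq_iff)
    qed
  next
    assume u: "u = spherical_kernel n e"
    let ?\<sigma> = "spherical_scale n e"
    show ?thesis
    proof (rule laplace_image_holomorphic[OF n kernel_expands_kernels(2) f assms(7), where \<sigma>="?\<sigma>"])
      show "u (cd_truncate n p) t (cd_truncate n \<zeta>) =
          cd_spherical (\<lambda>j. cd_coord (cd_truncate n p) j * ?\<sigma> j t + cd_coord (cd_truncate n \<zeta>) j)"
        for p t \<zeta> unfolding u by (rule spherical_kernel_eq)
      show "?\<sigma> j \<in> borel_measurable lebesgue" for j
        unfolding spherical_scale_def[abs_def] by measurable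
      show "\<bar>?\<sigma> j t\<bar> \<le> (\<Sum>i\<in>UNIV. \<bar>t $ i\<bar>)" for j t
        unfolding spherical_scale_def by (rule part) auto
      show "?\<sigma> 0 t = (\<Sum>i\<in>UNIV. t $ i)" for t
        using sum_e[of "\<lambda>i. t $ i"] by (simp add: spherical_scale_def)
      show "?\<sigma> 0 = ?\<sigma> 1" if "CARD('r) = 1"
        by (simp add: spherical_scale_def fun_eq_iff)
    qed
  qed
qed

end
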